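(* Let $r,s,t$ be parameters and consider on $\mathbb H$ the differential equation $$y''(z)=\pi^2\left(rE_4(z)+s\frac{E_6(z)^2}{E_4(z)^2}+t\frac{E_4(z)^4}{E_6(z)^2}\right)y(z),$$ with local exponents $\frac12\pm\kappa_i$ at $i$, $\frac12\pm\kappa_\rho$ at $\rho$, and $\pm\kappa_\infty$ at $\infty$, where $\kappa_i,\kappa_\rho,\kappa_\infty\ge0$; equivalently $s=\frac{1-4\kappa_\rho^2}{9}$, $t=\frac{1-4\kappa_i^2}{4}$, $r+s+t=-(2\kappa_\infty)^2$. Set $$(n_i,n_\rho,n_\infty)=\left(\kappa_i,\frac{2\kappa_\rho}{3},2\kappa_\infty\right).$$ Then the differential equation is apparent throughout $\mathbb H\cup\{\text{cusps}\}$ if and only if $n_i,n_\rho,n_\infty$ are positive integers satisfying (i) the sum of these three integers is odd, and (ii) the sum of any two of these integers is greater than the third. Moreover, in such a case, the ratio of any two (nonzero) solutions is a modular function on $\mathrm{SL}(2,\mathbb Z)$.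
   Context: $\mathbb H$ is the upper half-plane, $q=e^{2\pi iz}$, $i=\sqrt{-1}$, $\rho=(1+\sqrt{-3})/2$, $'=d/dz$; the cusps are $\mathbb Q\cup\{\infty\}$. $E_4=1+240\sum_{m\ge1}\frac{m^3q^m}{1-q^m}$ and $E_6=1-504\sum_{m\ge1}\frac{m^5q^m}{1-q^m}$; modulo $\mathrm{SL}(2,\mathbb Z)$ their only zeros are simple zeros at $\rho$ and $i$, respectively. Local exponents at $\infty$ are exponents in $q$ of $(q\,d/dq)^2y=-\frac{Q}{4\pi^2}y$, where $Q$ is the coefficient of $y$ on the right-hand side. The equation is apparent at a singular point $p\in\mathbb H$ if the local exponents are $\frac12\pm\kappa$ with $\kappa\in\frac12\mathbb Z_{\ge0}$ and no solution has a logarithmic singularity at $p$; it is apparent at the cusp $\infty$ if the local exponents are $\pm\kappa_\infty$ with $\kappa_\infty\in\frac12\mathbb Z_{\ge0}$ and no solution has a logarithmic singularity (in the variable $q$) at $\infty$. By modularity all cusps behave like $\infty$. Apparent throughout $\mathbb H\cup\{\text{cusps}\}$ means apparent at every singular point in $\mathbb H$ and at the cusps. A modular function on $\mathrm{SL}(2,\mathbb Z)$ is an $\mathrm{SL}(2,\mathbb Z)$-invariant meromorphic function on $\mathbb H$ that is meromorphic at $\infty$. *)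

theory Defs
  imports "HOL-Complex_Analysis.Complex_Analysis" "HOL-Computational_Algebra.Polynomial"
begin

definition upper_half_plane :: "complex set" where
  "upper_half_plane = {z. Im z > 0}"

definition nome :: "complex \<Rightarrow> complex" where
  "nome z = exp (2 * of_real pi * \<i> * z)"

definition rho :: complex where
  "rho = (1 + \<i> * of_real (sqrt 3)) / 2"

text \<open>The summation index is shifted: the term for \<open>m\<close> is the usual Lambert term for \<open>m + 1\<close>.
  Only the values on the upper half-plane are meaningful.\<close>

definition E4 :: "complex \<Rightarrow> complex" where
  "E4 z = 1 + 240 * (\<Sum>m. of_nat (Suc m) ^ 3 * nome z ^ Suc m / (1 - nome z ^ Suc m))"

definition E6 :: "complex \<Rightarrow> complex" where
  "E6 z = 1 - 504 * (\<Sum>m. of_nat (Suc m) ^ 5 * nome z ^ Suc m / (1 - nome z ^ Suc m))"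

definition ode_coeff :: "complex \<Rightarrow> complex \<Rightarrow> complex \<Rightarrow> complex \<Rightarrow> complex" where
  "ode_coeff r s t z =
     of_real pi ^ 2 * (r * E4 z + s * (E6 z ^ 2 / E4 z ^ 2) + t * (E4 z ^ 4 / E6 z ^ 2))"

text \<open>Everything below concerns the equation \<open>y'' = Q y\<close>.\<close>

definition solution_on ::
  "(complex \<Rightarrow> complex) \<Rightarrow> complex set \<Rightarrow> (complex \<Rightarrow> complex) \<Rightarrow> bool" where
  "solution_on Q U y \<longleftrightarrow>
     y holomorphic_on U \<and> (\<forall>z\<in>U. (deriv ^^ 2) y z = Q z * y z)"

text \<open>Writing \<open>Q z = A z / (z - p)\<^sup>2\<close> with \<open>A\<close> holomorphic at \<open>p\<close> (so \<open>p\<close> is a regular singular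
  or an ordinary point), the exponents are the roots, with multiplicity, of the indicial
  polynomial \<open>X (X - 1) - A p\<close>.\<close>

definition local_exponents_at ::
  "(complex \<Rightarrow> complex) \<Rightarrow> complex \<Rightarrow> complex \<Rightarrow> complex \<Rightarrow> bool" where
  "local_exponents_at Q p \<alpha> \<beta> \<longleftrightarrow>
     (\<exists>R>0. \<exists>A. A holomorphic_on ball p R \<and>
        (\<forall>z\<in>ball p R - {p}. Q z = A z / (z - p) ^ 2) \<and>
        [:- A p, -1, 1:] = [:- \<alpha>, 1:] * [:- \<beta>, 1:])"

text \<open>In the variable \<open>q = nome z\<close>, with \<open>Q z = G q\<close>, the equation reads
  \<open>(q d/dq)\<^sup>2 y = - G q / (4 \<pi>\<^sup>2) * y\<close>, with indicial polynomial \<open>X\<^sup>2 + G 0 / (4 \<pi>\<^sup>2)\<close>.\<close>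

definition local_exponents_infinity ::
  "(complex \<Rightarrow> complex) \<Rightarrow> complex \<Rightarrow> complex \<Rightarrow> bool" where
  "local_exponents_infinity Q \<alpha> \<beta> \<longleftrightarrow>
     (\<exists>R>0. \<exists>G. G holomorphic_on ball 0 R \<and>
        (\<forall>z. nome z \<in> ball 0 R \<longrightarrow> Q z = G (nome z)) \<and>
        [:G 0 / (4 * of_real pi ^ 2), 0, 1:] = [:- \<alpha>, 1:] * [:- \<beta>, 1:])"

text \<open>Solutions near a singular point are multivalued; they are represented by their principal
  branch, on the disc slit along the ray leaving \<open>p\<close> to the left, where \<open>powr\<close> and \<open>Ln\<close> of
  \<open>z - p\<close> are holomorphic.\<close>

definition slit_ball :: "complex \<Rightarrow> real \<Rightarrow> complex set" where
  "slit_ball p R = {z \<in> ball p R. z - p \<notin> \<real>\<^sub>\<le>\<^sub>0}"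

text \<open>A solution has a logarithmic singularity if a term with \<open>log (z - p)\<close> really occurs in its
  Frobenius expansion.\<close>

definition log_solution_at ::
  "(complex \<Rightarrow> complex) \<Rightarrow> complex \<Rightarrow> (complex \<Rightarrow> complex) \<Rightarrow> bool" where
  "log_solution_at Q p y \<longleftrightarrow>
     (\<exists>R>0. Q holomorphic_on ball p R - {p} \<and> solution_on Q (slit_ball p R) y \<and>
        (\<exists>\<alpha> g h. g holomorphic_on ball p R \<and> h holomorphic_on ball p R \<and>
           (\<exists>z\<in>ball p R. h z \<noteq> 0) \<and>
           (\<forall>z\<in>slit_ball p R. y z = (z - p) powr \<alpha> * (g z + h z * Ln (z - p)))))"

text \<open>Near the cusp, \<open>q\<^sup>\<alpha> = exp (2 \<pi> \<i> \<alpha> z)\<close> and \<open>log q = 2 \<pi> \<i> z\<close> are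
  single-valued in \<open>z\<close>, and \<open>Im z > Y\<close> means \<open>\<bar>q\<bar> < exp (- 2 \<pi> Y)\<close>.\<close>

definition log_solution_infinity ::
  "(complex \<Rightarrow> complex) \<Rightarrow> (complex \<Rightarrow> complex) \<Rightarrow> bool" where
  "log_solution_infinity Q y \<longleftrightarrow>
     (\<exists>Y. Q holomorphic_on {z. Im z > Y} \<and> solution_on Q {z. Im z > Y} y \<and>
        (\<exists>\<alpha> g h. g holomorphic_on ball 0 (exp (- 2 * pi * Y)) \<and>
           h holomorphic_on ball 0 (exp (- 2 * pi * Y)) \<and>
           (\<exists>q\<in>ball 0 (exp (- 2 * pi * Y)). h q \<noteq> 0) \<and>
           (\<forall>z. Im z > Y \<longrightarrow> y z = exp (2 * of_real pi * \<i> * \<alpha> * z) *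
              (g (nome z) + h (nome z) * (2 * of_real pi * \<i> * z)))))"

definition apparent_at :: "(complex \<Rightarrow> complex) \<Rightarrow> complex \<Rightarrow> bool" where
  "apparent_at Q p \<longleftrightarrow>
     (\<exists>k::nat. local_exponents_at Q p (1/2 + of_nat k / 2) (1/2 - of_nat k / 2)) \<and>
     \<not> (\<exists>y. log_solution_at Q p y)"

definition apparent_at_infinity :: "(complex \<Rightarrow> complex) \<Rightarrow> bool" where
  "apparent_at_infinity Q \<longleftrightarrow>
     (\<exists>k::nat. local_exponents_infinity Q (of_nat k / 2) (- (of_nat k / 2))) \<and>
     \<not> (\<exists>y. log_solution_infinity Q y)"

definition mobius :: "int \<Rightarrow> int \<Rightarrow> int \<Rightarrow> int \<Rightarrow> complex \<Rightarrow> complex" where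
  "mobius a b c d z = (of_int a * z + of_int b) / (of_int c * z + of_int d)"

text \<open>If \<open>y\<close> solves \<open>y'' = Q y\<close> and \<open>a d - b c = 1\<close>, then
  \<open>z \<mapsto> (c z + d) * y (mobius a b c d z)\<close> solves \<open>y'' = slash4 Q a b c d y\<close>. The cusp
  \<open>a / c\<close> of the former equation is the cusp \<open>\<infinity>\<close> of the latter.\<close>

definition slash4 ::
  "(complex \<Rightarrow> complex) \<Rightarrow> int \<Rightarrow> int \<Rightarrow> int \<Rightarrow> int \<Rightarrow> complex \<Rightarrow> complex" where
  "slash4 Q a b c d z = Q (mobius a b c d z) / (of_int c * z + of_int d) ^ 4"

definition apparent_throughout :: "(complex \<Rightarrow> complex) \<Rightarrow> bool" where
  "apparent_throughout Q \<longleftrightarrow>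
     (\<forall>p\<in>upper_half_plane. is_pole Q p \<longrightarrow> apparent_at Q p) \<and>
     (\<forall>a b c d. a * d - b * c = 1 \<longrightarrow> apparent_at_infinity (slash4 Q a b c d))"

text \<open>Nicely meromorphic: removable singularities are filled in, and the value at a pole is 0 by
  convention, so that invariance can be required pointwise.\<close>

definition modular_function :: "(complex \<Rightarrow> complex) \<Rightarrow> bool" where
  "modular_function f \<longleftrightarrow>
     f nicely_meromorphic_on upper_half_plane \<and>
     (\<forall>a b c d. a * d - b * c = 1 \<longrightarrow>
        (\<forall>z\<in>upper_half_plane. f (mobius a b c d z) = f z)) \<and>
     (\<exists>g Y. g meromorphic_on {0} \<and> (\<forall>z. Im z > Y \<longrightarrow> f z = g (nome z)))"

text \<open>Solutions may be multivalued on the upper half-plane, so a pair of solutions is given by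
  branches on some domain \<open>U\<close> without singular points; by the identity theorem the branches
  determine the solutions, and \<open>f\<close> is the analytic continuation of their ratio.\<close>

definition solution_ratios_modular :: "(complex \<Rightarrow> complex) \<Rightarrow> bool" where
  "solution_ratios_modular Q \<longleftrightarrow>
     (\<forall>U y1 y2. open U \<and> connected U \<and> U \<subseteq> upper_half_plane \<and> Q holomorphic_on U \<and>
        solution_on Q U y1 \<and> solution_on Q U y2 \<and>
        (\<exists>z\<in>U. y1 z \<noteq> 0) \<and> (\<exists>z\<in>U. y2 z \<noteq> 0) \<longrightarrow>
        (\<exists>f. modular_function f \<and> (\<forall>z\<in>U. y2 z \<noteq> 0 \<longrightarrow> f z = y1 z / y2 z)))"

end

theory Submission
  imports Defs
begin

text \<open>
  The substitution \<open>y = E4\<^sup>e E6\<^sup>f \<Delta>\<^sup>g u(x)\<close> with \<open>x = 1728 / j\<close> turns the equation into a hypergeometric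
  equation whose exponent differences at the images of the cusp, of \<open>\<i>\<close> and of \<open>\<rho>\<close> are
  \<open>n\<^sub>\<infinity>\<close>, \<open>n\<^sub>i\<close> and \<open>n\<^sub>\<rho>\<close>. If the exponent difference at a point is a natural number \<open>n\<close>, a logarithm
  is absent there iff one of the first \<open>n\<close> steps of the recursion for the local power series solution
  degenerates. At the cusp this says that
  \<open>n\<^sub>i + n\<^sub>\<rho>\<close> or \<open>n\<^sub>i - n\<^sub>\<rho>\<close> is an integer of absolute value less than \<open>n\<^sub>\<infinity>\<close> and of the opposite parity;
  since \<open>n\<^sub>i \<in> \<int>/2\<close> and \<open>n\<^sub>\<rho> \<in> \<int>/3\<close>, all three numbers are integers, and the same criterion at \<open>\<i>\<close> gives the
  remaining triangle inequality. Conversely, under the parity and triangle conditions all solutions \<open>u\<close>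
  are polynomials, so that there are no logarithms anywhere and ratios of solutions are rational
  functions of \<open>j\<close>.

  The pull-back rests on Ramanujan's differential equations. They follow from two Rankin-Cohen
  brackets of \<open>E4\<close> and \<open>E6\<close>, together with the fact that a cusp form of weight 12 with a double zero at
  the cusp is zero; the same identities show that \<open>E4\<^sup>3 - E6\<^sup>2\<close> has no zeros.
\<close>

section \<open>Lambert series\<close>

text \<open>The geometric input on x = 1728 / j, namely that \<open>E4\<close> and \<open>E6\<close>
  have only simple zeros and \<open>discr\<close> none, is read off from differential equations.
  These rest on modularity, on the first q-coefficients 240 and -504 and on a maximum principle.
  Modularity in turn comes from identifying the Lambert series with lattice sums, and this is where
  the cotangent and its derivatives enter.

  The obstacle is that the prefactor and the solutions are multivalued. Every pull-back is therefore
  made on a domain with holomorphic logarithms of \<open>E4\<close>, \<open>E6\<close> and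
  \<open>discr\<close>: a slit disc, a half-plane Im z > Y or a small disc without zeros. Monodromy
  enters only when two local shapes of one solution, with and without a logarithm, are compared.

  A point \<open>\<i>\<close> or \<open>rho\<close> need not be singular: if t = 0 or s = 0,
  apparentness says nothing there and the exponent 1/2 is read off from the parameter. The cusp is
  always covered, so integrality is extracted there first; it excludes t = 0, and only then is
  \<open>\<i>\<close> used for the last inequality.\<close>

lemma summable_power_mult_geometric:
  fixes r :: real
  assumes "0 \<le> r" "r < 1"
  shows "summable (\<lambda>n. real (Suc n) ^ k * r ^ n)"
proof (cases "r = 0")
  case True
  have "(\<lambda>n. real (Suc n) ^ k * r ^ n) = (\<lambda>n. if n = 0 then 1 else 0)"
    using True by (auto simp: fun_eq_iff power_0_left)
  then show ?thesis by simp
next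
  case False
  with assms have r: "0 < r" by simp
  have "(\<lambda>n. (real (Suc (Suc n)) / real (Suc n)) ^ k * r) \<longlonglongrightarrow> 1 ^ k * r"
    by (intro tendsto_intros) (use LIMSEQ_Suc_n_over_n in \<open>real_asymp\<close>)
  then have "\<forall>\<^sub>F n in sequentially. (real (Suc (Suc n)) / real (Suc n)) ^ k * r < (1 + r) / 2"
    by (rule order_tendstoD) (use assms in simp)
  then obtain N where N: "\<And>n. n \<ge> N \<Longrightarrow> (real (Suc (Suc n)) / real (Suc n)) ^ k * r < (1 + r) / 2"
    by (auto simp: eventually_sequentially)
  show ?thesis
  proof (rule summable_ratio_test[where c = "(1 + r) / 2" and N = N])
    show "(1 + r) / 2 < 1" using assms by simp
    fix n assume "N \<le> n"
    from N[OF this] have "(real (Suc (Suc n)) / real (Suc n)) ^ k * r \<le> (1 + r) / 2" by simp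
    then have "((real (Suc (Suc n)) / real (Suc n)) ^ k * r) * (real (Suc n) ^ k * r ^ n)
        \<le> (1 + r) / 2 * (real (Suc n) ^ k * r ^ n)"
      using r by (intro mult_right_mono) auto
    then show "norm (real (Suc (Suc n)) ^ k * r ^ Suc n) \<le> (1 + r) / 2 * norm (real (Suc n) ^ k * r ^ n)"
      using r by (simp add: power_divide field_simps del: of_nat_Suc)
  qed
qed

text \<open>The usual Lambert series divided by q. The value at 0 is then 1, which yields the
  derivatives of \<open>e4\<close> and \<open>e6\<close> at 0 without differentiating a series of
  quotients.\<close>

definition lambert :: "nat \<Rightarrow> complex \<Rightarrow> complex" where
  "lambert k q = (\<Sum>m. of_nat (Suc m) ^ k * q ^ m / (1 - q ^ Suc m))"

lemma norm_lambert_term_le: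
  fixes q :: complex
  assumes "norm q \<le> r" "r < 1"
  shows "norm (of_nat (Suc m) ^ k * q ^ m / (1 - q ^ Suc m)) \<le> real (Suc m) ^ k * r ^ m / (1 - r)"
proof -
  have r: "0 \<le> r" using assms(1) norm_ge_zero order_trans by blast
  have "norm q ^ Suc m \<le> norm q"
    using assms power_Suc_le_self[of "norm q" m] by simp
  then have "1 - r \<le> norm (1 - q ^ Suc m)"
    using assms(1) norm_triangle_ineq2[of 1 "q ^ Suc m"] unfolding norm_power norm_one by linarith
  moreover have "norm q ^ m \<le> r ^ m" using assms by (intro power_mono) auto
  ultimately show ?thesis
    using assms r by (simp add: norm_divide norm_mult norm_power frac_le mult_left_mono del: of_nat_Suc)
qed

lemma summable_lambert_bound:
  assumes "0 \<le> r" "r < 1"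
  shows "summable (\<lambda>m. real (Suc m) ^ k * r ^ m / (1 - r))"
  using summable_power_mult_geometric[OF assms] by (rule summable_divide)

lemma lambert_holomorphic: "lambert k holomorphic_on ball 0 1"
proof (rule holomorphic_uniform_sequence[where
      f = "\<lambda>n q. \<Sum>m<n. of_nat (Suc m) ^ k * q ^ m / (1 - q ^ Suc m)"])
  show "open (ball (0::complex) 1)" by simp
  show "(\<lambda>q. \<Sum>m<n. of_nat (Suc m) ^ k * q ^ m / (1 - q ^ Suc m)) holomorphic_on ball 0 1" for n
  proof (intro holomorphic_intros)
    fix q :: complex and m :: nat assume "q \<in> ball 0 1"
    then have "norm q < 1" by simp
    then have "norm (q ^ Suc m) < 1" unfolding norm_power
      by (metis norm_ge_zero power_less_one_iff zero_less_Suc power_less_one_iff)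
    then show "1 - q ^ Suc m \<noteq> 0" by (metis eq_iff_diff_eq_0 less_irrefl norm_one)
  qed
  fix x :: complex assume x: "x \<in> ball 0 1"
  define r where "r = (1 + norm x) / 2"
  have r: "0 \<le> r" "r < 1" using x by (auto simp: r_def)
  have sub: "norm y \<le> r" if "y \<in> cball x ((1 - norm x) / 2)" for y
  proof -
    have "norm y \<le> norm x + norm (y - x)"
      by (metis add.commute diff_add_cancel norm_triangle_ineq)
    also have "\<dots> \<le> r" using that by (simp add: r_def dist_norm norm_minus_commute field_simps)
    finally show ?thesis .
  qed
  show "\<exists>d>0. cball x d \<subseteq> ball 0 1 \<and> uniform_limit (cball x d)
          (\<lambda>n q. \<Sum>m<n. of_nat (Suc m) ^ k * q ^ m / (1 - q ^ Suc m)) (lambert k) sequentially"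
  proof (intro exI conjI)
    show "0 < (1 - norm x) / 2" using x by simp
    show "cball x ((1 - norm x) / 2) \<subseteq> ball 0 1" using sub r by force
    show "uniform_limit (cball x ((1 - norm x) / 2))
          (\<lambda>n q. \<Sum>m<n. of_nat (Suc m) ^ k * q ^ m / (1 - q ^ Suc m)) (lambert k) sequentially"
      unfolding lambert_def
      by (rule Weierstrass_m_test[OF norm_lambert_term_le summable_lambert_bound])
        (use r sub in auto)
  qed
qed

lemma lambert_0: "lambert k 0 = 1"
proof -
  have "lambert k 0 = (\<Sum>m. if m = 0 then 1 else 0)"
    unfolding lambert_def by (intro suminf_cong) auto
  also have "\<dots> = 1" using sums_single[of 0 "\<lambda>_. 1::complex"] by (simp add: sums_iff)
  finally show ?thesis .
qed

lemma lambert_summable: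
  fixes q :: complex
  assumes "norm q < 1"
  shows "summable (\<lambda>m. of_nat (Suc m) ^ k * q ^ m / (1 - q ^ Suc m))"
  by (rule summable_comparison_test'[OF summable_lambert_bound[of "norm q"] norm_lambert_term_le])
    (use assms in auto)

text \<open>\<open>E4\<close> and \<open>E6\<close> as functions of q. Their domain includes q = 0,
  so statements about the cusp become statements about Taylor coefficients at 0.\<close>

definition e4 :: "complex \<Rightarrow> complex" where "e4 q = 1 + 240 * (q * lambert 3 q)"
definition e6 :: "complex \<Rightarrow> complex" where "e6 q = 1 - 504 * (q * lambert 5 q)"

lemma norm_nome: "norm (nome z) = exp (- 2 * pi * Im z)"
  unfolding nome_def norm_exp_eq_Re by simp

lemma norm_nome_less_1_iff: "norm (nome z) < 1 \<longleftrightarrow> Im z > 0"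
  unfolding norm_nome by (simp add: zero_less_mult_iff)

lemma nome_nonzero [simp]: "nome z \<noteq> 0"
  by (simp add: nome_def)

lemma upper_half_plane_iff [simp]: "z \<in> upper_half_plane \<longleftrightarrow> Im z > 0"
  by (simp add: upper_half_plane_def)

lemma open_upper_half_plane [simp]: "open upper_half_plane"
  unfolding upper_half_plane_def by (simp add: open_halfspace_Im_gt)

lemma convex_upper_half_plane: "convex upper_half_plane"
  unfolding upper_half_plane_def by (simp add: convex_halfspace_Im_gt)

lemma lambert_mult:
  assumes "norm q < 1"
  shows "q * lambert k q = (\<Sum>m. of_nat (Suc m) ^ k * q ^ Suc m / (1 - q ^ Suc m))"
  unfolding lambert_def suminf_mult[OF lambert_summable[OF assms], symmetric]
  by (intro suminf_cong) (simp add: field_simps)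

lemma E4_eq_e4: "Im z > 0 \<Longrightarrow> E4 z = e4 (nome z)"
  unfolding E4_def e4_def by (subst lambert_mult) (simp_all add: norm_nome_less_1_iff)

lemma E6_eq_e6: "Im z > 0 \<Longrightarrow> E6 z = e6 (nome z)"
  unfolding E6_def e6_def by (subst lambert_mult) (simp_all add: norm_nome_less_1_iff)

lemma e4_holomorphic [holomorphic_intros]: "A \<subseteq> ball 0 1 \<Longrightarrow> e4 holomorphic_on A"
  unfolding e4_def by (intro holomorphic_intros holomorphic_on_subset[OF lambert_holomorphic])

lemma e6_holomorphic [holomorphic_intros]: "A \<subseteq> ball 0 1 \<Longrightarrow> e6 holomorphic_on A"
  unfolding e6_def by (intro holomorphic_intros holomorphic_on_subset[OF lambert_holomorphic])

lemma e4_0 [simp]: "e4 0 = 1" and e6_0 [simp]: "e6 0 = 1"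
  by (simp_all add: e4_def e6_def)

lemma deriv_id_mult_lambert: "((\<lambda>q. q * lambert k q) has_field_derivative 1) (at 0)"
proof -
  have "lambert k field_differentiable (at 0)"
    using lambert_holomorphic by (simp add: holomorphic_on_open field_differentiable_def)
  then obtain D where "(lambert k has_field_derivative D) (at 0)"
    by (auto simp: field_differentiable_def)
  from DERIV_mult[OF DERIV_ident this] show ?thesis by (simp add: lambert_0)
qed

lemma deriv_e4_0: "deriv e4 0 = 240"
proof -
  have "(e4 has_field_derivative 240) (at 0)"
    using DERIV_add[OF DERIV_const[of 1] DERIV_cmult[OF deriv_id_mult_lambert[of 3], of 240]]
    unfolding e4_def[abs_def] by simp
  then show ?thesis by (rule DERIV_imp_deriv)
qed

lemma deriv_e6_0: "deriv e6 0 = -504"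
proof -
  have "(e6 has_field_derivative -504) (at 0)"
    using DERIV_diff[OF DERIV_const[of 1] DERIV_cmult[OF deriv_id_mult_lambert[of 5], of 504]]
    unfolding e6_def[abs_def] by simp
  then show ?thesis by (rule DERIV_imp_deriv)
qed

section \<open>The nome and power sums in it\<close>

lemma nome_derivative: "(nome has_field_derivative 2 * of_real pi * \<i> * nome z) (at z within A)"
  unfolding nome_def by (auto intro!: derivative_eq_intros)

lemma nome_holomorphic [holomorphic_intros]: "f holomorphic_on A \<Longrightarrow> (\<lambda>z. nome (f z)) holomorphic_on A"
  unfolding nome_def by (intro holomorphic_intros)

text \<open>The polylogarithm of order -k. The operator q d/dq raises k by one, just as d/dz does
  for the derivatives of the cotangent.\<close>

definition power_sum :: "nat \<Rightarrow> complex \<Rightarrow> complex" where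
  "power_sum k q = (\<Sum>n. of_nat (Suc n) ^ k * q ^ Suc n)"

lemma norm_summable_power_sum:
  assumes "norm q < 1"
  shows "summable (\<lambda>n. norm (of_nat (Suc n) ^ k * q ^ Suc n :: complex))"
proof -
  have "summable (\<lambda>n. (real (Suc n) ^ k * norm q ^ n) * norm q)"
    by (intro summable_mult2 summable_power_mult_geometric) (use assms in auto)
  then show ?thesis by (simp add: norm_mult norm_power mult_ac del: of_nat_Suc)
qed

lemma power_sum_0: "norm q < 1 \<Longrightarrow> power_sum 0 q = q / (1 - q)"
  unfolding power_sum_def using suminf_mult[of "\<lambda>n. q ^ n" q] suminf_geometric[of q]
  by (simp add: summable_geometric)

lemma power_sum_derivative:
  assumes "norm q < 1" "q \<noteq> 0"
  shows "(power_sum k has_field_derivative power_sum (Suc k) q / q) (at q)"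
proof -
  \<comment> \<open>The coefficient at 0 is set to 0 by hand because \<open>0 ^ 0 = 1\<close> would
    add a constant term for k = 0.\<close>
  define c :: "nat \<Rightarrow> complex" where "c n = (if n = 0 then 0 else of_nat n ^ k)" for n
  have sum: "summable (\<lambda>n. c n * w ^ n)" if "norm w < 1" for w
  proof -
    have "summable (\<lambda>n. c (Suc n) * w ^ Suc n)"
      using summable_norm_cancel[OF norm_summable_power_sum[OF that, of k]] by (simp add: c_def)
    then show ?thesis by (subst (asm) summable_Suc_iff)
  qed
  have eq: "power_sum k w = (\<Sum>n. c n * w ^ n)" if "norm w < 1" for w
    using suminf_split_head[OF sum[OF that]] by (simp add: power_sum_def c_def)
  have "((\<lambda>w. \<Sum>n. c n * w ^ n) has_field_derivative (\<Sum>n. diffs c n * q ^ n)) (at q)"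
    using sum assms(1) by (rule termdiffs_strong')
  moreover have "(\<Sum>n. diffs c n * q ^ n) = power_sum (Suc k) q / q"
  proof -
    have "summable (\<lambda>n. of_nat (Suc n) ^ Suc k * q ^ Suc n)"
      using summable_norm_cancel[OF norm_summable_power_sum[OF assms(1), of "Suc k"]] by simp
    then have "(\<Sum>n. of_nat (Suc n) ^ Suc k * q ^ Suc n / q) = power_sum (Suc k) q / q"
      unfolding power_sum_def by (rule suminf_divide)
    moreover have "diffs c n * q ^ n = of_nat (Suc n) ^ Suc k * q ^ Suc n / q" for n
      using assms by (simp add: diffs_def c_def)
    ultimately show ?thesis by simp
  qed
  ultimately have "((\<lambda>w. \<Sum>n. c n * w ^ n) has_field_derivative power_sum (Suc k) q / q) (at q)"
    by simp
  then show ?thesis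
    by (rule has_field_derivative_transform_within_open[where S = "ball 0 1"])
      (use assms eq in auto)
qed

lemma power_sum_nome_derivative:
  assumes "Im z > 0"
  shows "((\<lambda>z. power_sum k (nome z)) has_field_derivative
           2 * of_real pi * \<i> * power_sum (Suc k) (nome z)) (at z)"
  using DERIV_chain2[OF power_sum_derivative nome_derivative, of z k] assms
  by (simp add: norm_nome_less_1_iff mult_ac)

section \<open>Eisenstein series as lattice sums\<close>

lemma Digamma_reflection:
  fixes z :: complex
  assumes "z \<notin> \<int>"
  shows "Digamma z - Digamma (1 - z) = - of_real pi * cos (of_real pi * z) / sin (of_real pi * z)"
proof -
  have nz: "sin (of_real pi * z) \<noteq> 0"
    using assms by (auto simp: sin_eq_0 mult.commute)
  have z1: "z \<notin> \<int>\<^sub>\<le>\<^sub>0" using assms nonpos_Ints_subset_Ints by blast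
  have "1 - z \<notin> \<int>" using assms by (metis Ints_1 Ints_diff diff_diff_eq2 add_diff_cancel_left')
  then have z2: "1 - z \<notin> \<int>\<^sub>\<le>\<^sub>0" using nonpos_Ints_subset_Ints by blast
  \<comment> \<open>The reflection formula Gamma z * Gamma (1 - z) = \<pi> / sin (\<pi> z) is
    differentiated on both sides and divided by itself.\<close>
  have "((\<lambda>z. Gamma z * Gamma (1 - z)) has_field_derivative
      Gamma z * Gamma (1 - z) * (Digamma z - Digamma (1 - z))) (at z)"
    using z1 z2 by (auto intro!: derivative_eq_intros simp: algebra_simps)
  moreover have "((\<lambda>z. Gamma z * Gamma (1 - z)) has_field_derivative
      - (of_real pi * of_real pi * cos (of_real pi * z)) / sin (of_real pi * z) ^ 2) (at z)"
    unfolding Gamma_reflection_complex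
    using nz by (auto intro!: derivative_eq_intros simp: power2_eq_square)
  ultimately have E: "Gamma z * Gamma (1 - z) * (Digamma z - Digamma (1 - z)) =
      - (of_real pi * of_real pi * cos (of_real pi * z)) / sin (of_real pi * z) ^ 2"
    by (rule DERIV_unique)
  have alg: "X = - P * C / S" if "P / S * X = - (P * P * C) / S ^ 2" "S \<noteq> 0" "P \<noteq> 0" for P S C X :: complex
  proof -
    have "P * (S * X + C * P) = 0"
      using that by (simp add: field_simps power2_eq_square)
    then have "X * S = - P * C"
      using that(3) by (simp add: eq_neg_iff_add_eq_0 mult.commute add.commute)
    then show ?thesis by (subst nonzero_eq_divide_eq[OF that(2)])
  qed
  show ?thesis
    by (rule alg[OF E[unfolded Gamma_reflection_complex] nz]) simp
qed

text \<open>The k-th derivative of - \<pi> cot (\<pi> z), written so that both of its faces are at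
  hand: a pair of half-sided sums of inverse powers, and by repeated differentiation a power series
  in q.\<close>

definition refl_polygamma :: "nat \<Rightarrow> complex \<Rightarrow> complex" where
  "refl_polygamma k z = Polygamma k z - (-1) ^ k * Polygamma k (1 - z)"

lemma refl_polygamma_derivative:
  assumes "z \<notin> \<int>"
  shows "(refl_polygamma k has_field_derivative refl_polygamma (Suc k) z) (at z)"
proof -
  have z1: "z \<notin> \<int>\<^sub>\<le>\<^sub>0" using assms nonpos_Ints_subset_Ints by blast
  have "1 - z \<notin> \<int>" using assms by (metis Ints_1 Ints_diff diff_diff_eq2 add_diff_cancel_left')
  then have z2: "1 - z \<notin> \<int>\<^sub>\<le>\<^sub>0" using nonpos_Ints_subset_Ints by blast
  have "((\<lambda>z. Polygamma k (1 - z)) has_field_derivative Polygamma (Suc k) (1 - z) * (- 1)) (at z)"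
    by (rule DERIV_chain2[where f = "Polygamma k" and g = "\<lambda>z. 1 - z", OF has_field_derivative_Polygamma[OF z2]]) (auto intro!: derivative_eq_intros)
  from DERIV_diff[OF has_field_derivative_Polygamma[OF z1, of k] DERIV_cmult[OF this, of "(-1) ^ k"]]
  show ?thesis
    unfolding refl_polygamma_def[abs_def] by (simp add: refl_polygamma_def)
qed

lemma open_not_Ints: "open (- \<int> :: complex set)"
  using closed_Ints by blast

lemma not_Ints_upper: "Im z > 0 \<Longrightarrow> z \<notin> \<int>"
  by (auto elim!: Ints_cases)

lemma refl_polygamma_Suc_eqI:
  assumes "open S" "S \<subseteq> - \<int>" "\<And>w. w \<in> S \<Longrightarrow> refl_polygamma k w = f w" "z \<in> S"
    and "(f has_field_derivative D) (at z)"
  shows "refl_polygamma (Suc k) z = D"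
proof -
  have "(refl_polygamma k has_field_derivative D) (at z)"
    using assms by (intro has_field_derivative_transform_within_open[OF assms(5,1,4)]) auto
  then show ?thesis
    using DERIV_unique refl_polygamma_derivative[of z k] assms(2,4) by blast
qed

lemma refl_polygamma_0:
  "z \<notin> \<int> \<Longrightarrow> refl_polygamma 0 z = - of_real pi * cos (of_real pi * z) / sin (of_real pi * z)"
  using Digamma_reflection[of z] by (simp add: refl_polygamma_def)

lemma refl_polygamma_0_nome:
  assumes "Im z > 0"
  shows "refl_polygamma 0 z = of_real pi * \<i> * (1 + 2 * power_sum 0 (nome z))"
proof -
  have nz: "sin (of_real pi * z) \<noteq> 0"
    using not_Ints_upper[OF assms] by (auto simp: sin_eq_0 mult.commute)
  define w where "w = exp (\<i> * (of_real pi * z))"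
  have w0: "w \<noteq> 0" by (simp add: w_def)
  have q: "nome z = w ^ 2"
    unfolding w_def nome_def exp_of_nat_mult[symmetric] by (simp add: mult_ac)
  have q1: "norm (nome z) < 1" using assms by (simp add: norm_nome_less_1_iff)
  then have q1': "nome z \<noteq> 1" by auto
  have inv: "exp (- (\<i> * (of_real pi * z))) = 1 / w"
    by (simp add: w_def exp_minus field_simps)
  have c: "cos (of_real pi * z) = (w + 1 / w) / 2"
    unfolding cos_exp_eq inv using w_def by simp
  have s: "sin (of_real pi * z) = (w - 1 / w) / (2 * \<i>)"
    unfolding sin_exp_eq inv using w_def by simp
  have w2: "w ^ 2 \<noteq> 1" using q q1' by simp
  have "refl_polygamma 0 z = - of_real pi * ((w + 1 / w) / 2) / ((w - 1 / w) / (2 * \<i>))"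
    using refl_polygamma_0[OF not_Ints_upper[OF assms]] unfolding c s .
  also have "\<dots> = of_real pi * \<i> * (1 + w ^ 2) / (1 - w ^ 2)"
    using w0 w2 by (simp add: divide_simps power2_eq_square) (simp add: algebra_simps)
  also have "\<dots> = of_real pi * \<i> * (1 + 2 * (w ^ 2 / (1 - w ^ 2)))"
    using w2 by (simp add: divide_simps)
  finally show ?thesis using power_sum_0[OF q1] q by simp
qed

text \<open>Each derivative in z multiplies by 2 \<pi> i and raises the index of the power sum. The
  constant 1 in the case k = 0 is killed by the first derivative, hence the restriction to k > 0.
  Together with \<open>sum_shifted_powers\<close> this is Lipschitz's formula.\<close>

lemma refl_polygamma_nome:
  assumes "Im z > 0" "k > 0"
  shows "refl_polygamma k z = (2 * of_real pi * \<i>) ^ Suc k * power_sum k (nome z)"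
  using assms(2,1)
proof (induction k arbitrary: z rule: nat_induct_non_zero)
  case 1
  have "refl_polygamma (Suc 0) z = (2 * of_real pi * \<i>) ^ 2 * power_sum (Suc 0) (nome z)"
    by (rule refl_polygamma_Suc_eqI[OF open_upper_half_plane _ refl_polygamma_0_nome])
      (use 1 not_Ints_upper in \<open>auto intro!: derivative_eq_intros power_sum_nome_derivative
          simp: power2_eq_square algebra_simps\<close>)
  then show ?case by (simp add: power2_eq_square)
next
  case (Suc k)
  show ?case
    by (rule refl_polygamma_Suc_eqI[OF open_upper_half_plane _ Suc.IH])
      (use Suc.prems not_Ints_upper in \<open>auto intro!: derivative_eq_intros power_sum_nome_derivative
          simp: algebra_simps\<close>)
qed

text \<open>The function \<open>c = - \<pi> cot (\<pi> z)\<close> satisfies \<open>c' = \<pi>\<^sup>2 + c\<^sup>2\<close> and vanishes at \<open>1/2\<close>, which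
  gives all its derivatives at \<open>1/2\<close>.\<close>

lemma refl_polygamma_half:
  "refl_polygamma 3 (1/2) = 2 * of_real pi ^ 4"
  "refl_polygamma 5 (1/2) = 16 * of_real pi ^ 6"
proof -
  let ?c = "\<lambda>k. refl_polygamma k"
  have half: "(1/2 :: complex) \<in> - \<int>"
    using fraction_not_in_Ints[where 'a = complex, of 2 1] by simp
  have a1: "?c 1 z = of_real pi ^ 2 + ?c 0 z ^ 2" if "z \<in> - \<int>" for z
  proof -
    have nz: "sin (of_real pi * z) \<noteq> 0"
      using that by (auto simp: sin_eq_0 mult.commute)
    have "?c (Suc 0) z = of_real pi ^ 2 + ?c 0 z ^ 2"
    proof (rule refl_polygamma_Suc_eqI[OF open_not_Ints order_refl refl_polygamma_0 that])
      show "((\<lambda>w. - of_real pi * cos (of_real pi * w) / sin (of_real pi * w)) has_field_derivative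
          of_real pi ^ 2 + ?c 0 z ^ 2) (at z)"
        unfolding refl_polygamma_0[OF that[unfolded Compl_iff]]
        using nz by (auto intro!: derivative_eq_intros simp: field_simps power2_eq_square)
    qed auto
    then show ?thesis by simp
  qed
  have d: "(?c 0 has_field_derivative ?c 1 z) (at z)" "(?c 1 has_field_derivative ?c 2 z) (at z)"
    "(?c 2 has_field_derivative ?c 3 z) (at z)" "(?c 3 has_field_derivative ?c 4 z) (at z)"
    if "z \<in> - \<int>" for z
    using refl_polygamma_derivative[of z 0] refl_polygamma_derivative[of z 1]
      refl_polygamma_derivative[of z 2] refl_polygamma_derivative[of z 3] that
    by (simp_all add: eval_nat_numeral)
  note d = d d[unfolded One_nat_def]
  have step: "?c m z = D" if "m = Suc k" "\<And>w. w \<in> - \<int> \<Longrightarrow> ?c k w = f w"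
    "(f has_field_derivative D) (at z)" "z \<in> - \<int>" for m k f z D
    unfolding that(1) by (rule refl_polygamma_Suc_eqI[OF open_not_Ints order_refl that(2,4,3)])
  have a2: "?c 2 z = 2 * ?c 0 z * ?c 1 z" if "z \<in> - \<int>" for z
    by (rule step[OF _ a1 _ that]) (auto intro!: derivative_eq_intros d that)
  have a3: "?c 3 z = 2 * ?c 1 z ^ 2 + 2 * ?c 0 z * ?c 2 z" if "z \<in> - \<int>" for z
    by (rule step[OF _ a2 _ that]) (auto intro!: derivative_eq_intros d that simp: algebra_simps power2_eq_square)
  have a4: "?c 4 z = 6 * ?c 1 z * ?c 2 z + 2 * ?c 0 z * ?c 3 z" if "z \<in> - \<int>" for z
    by (rule step[OF _ a3 _ that]) (auto intro!: derivative_eq_intros d that simp: algebra_simps)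
  have a5: "?c 5 z = 6 * ?c 2 z ^ 2 + 8 * ?c 1 z * ?c 3 z + 2 * ?c 0 z * ?c 4 z" if "z \<in> - \<int>" for z
    by (rule step[OF _ a4 _ that]) (auto intro!: derivative_eq_intros d that simp: algebra_simps power2_eq_square)
  have c0: "?c 0 (1/2) = 0" by (simp add: refl_polygamma_def)
  have c1: "?c 1 (1/2) = of_real pi ^ 2" using a1[OF half] c0 by simp
  have c2: "?c 2 (1/2) = 0" using a2[OF half] c0 by simp
  show c3: "?c 3 (1/2) = 2 * of_real pi ^ 4" using a3[OF half] c0 c1 by (simp flip: power_mult)
  show "?c 5 (1/2) = 16 * of_real pi ^ 6" using a5[OF half] c0 c1 c2 c3 by (simp flip: power_add)
qed

section \<open>Absolutely convergent sums over the integers\<close>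

lemma norm_summable_inverse_shift_power:
  fixes z :: complex
  assumes "k \<ge> 2"
  shows "summable (\<lambda>n. norm (inverse ((z + of_nat n) ^ k)))"
proof (rule summable_comparison_test_ev)
  show "summable (\<lambda>n. 2 ^ k * inverse (of_nat n ^ k :: real))"
    using inverse_power_summable[OF assms, where 'a = real] by (intro summable_mult) simp
  have "norm (norm (inverse ((z + of_nat n) ^ k))) \<le> 2 ^ k * inverse (real n ^ k)"
    if "real n > 2 * norm z" for n
  proof -
    have n: "0 < real n" using that norm_ge_zero[of z] by linarith
    have "real n \<le> 2 * norm (z + of_nat n)"
      using norm_triangle_ineq4[of "z + of_nat n" z] that unfolding add_diff_cancel_left' by simp
    moreover from this have "norm (z + of_nat n) > 0" using n by linarith
    ultimately have "inverse (norm (z + of_nat n)) \<le> 2 * inverse (real n)"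
      using n by (simp add: divide_simps split: if_splits)
    then have "inverse (norm (z + of_nat n)) ^ k \<le> (2 * inverse (real n)) ^ k"
      by (intro power_mono) auto
    then show ?thesis by (simp add: norm_inverse norm_power power_mult_distrib power_inverse)
  qed
  moreover have "\<forall>\<^sub>F n in sequentially. real n > 2 * norm z"
    using filterlim_real_sequentially by (simp add: filterlim_at_top_dense)
  ultimately show "\<forall>\<^sub>F n in sequentially.
      norm (norm (inverse ((z + of_nat n) ^ k))) \<le> 2 ^ k * inverse (real n ^ k)"
    by (elim eventually_mono) simp
qed

text \<open>The negative half starts at -1, so the halves are disjoint and z + (-1 - n) = - (1 - z +
  n) is, up to sign, the shift that occurs in the series of a polygamma function at 1 - z.\<close>

lemma int_UNIV_split: "(UNIV :: int set) = range int \<union> range (\<lambda>n. -1 - int n)"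
proof -
  have "x \<in> range int \<union> range (\<lambda>n. -1 - int n)" for x
  proof (cases "x \<ge> 0")
    case True
    then show ?thesis by (auto intro: image_eqI[of _ _ "nat x"])
  next
    case False
    then show ?thesis by (auto intro: image_eqI[of _ _ "nat (-1 - x)"])
  qed
  then show ?thesis by blast
qed

lemma abs_summable_on_int_iff:
  fixes f :: "int \<Rightarrow> 'a::banach"
  shows "(\<lambda>x. norm (f x)) summable_on UNIV \<longleftrightarrow>
    summable (\<lambda>n. norm (f (int n))) \<and> summable (\<lambda>n. norm (f (- 1 - int n)))"
proof -
  have inj: "inj int" "inj (\<lambda>n. -1 - int n)" by (auto simp: inj_def)
  have "(\<lambda>x. norm (f x)) summable_on UNIV \<longleftrightarrow>
      (\<lambda>x. norm (f x)) summable_on range int \<and> (\<lambda>x. norm (f x)) summable_on range (\<lambda>n. -1 - int n)"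
    unfolding int_UNIV_split
  proof (safe)
    assume "(\<lambda>x. norm (f x)) summable_on (range int \<union> range (\<lambda>n. -1 - int n))"
    then show "(\<lambda>x. norm (f x)) summable_on range int" "(\<lambda>x. norm (f x)) summable_on range (\<lambda>n. -1 - int n)"
      by (auto elim: summable_on_subset_banach)
  next
    assume "(\<lambda>x. norm (f x)) summable_on range int" "(\<lambda>x. norm (f x)) summable_on range (\<lambda>n. -1 - int n)"
    then show "(\<lambda>x. norm (f x)) summable_on (range int \<union> range (\<lambda>n. -1 - int n))"
      by (rule summable_on_Un_disjoint) auto
  qed
  also have "\<dots> \<longleftrightarrow> summable (\<lambda>n. norm (f (int n))) \<and> summable (\<lambda>n. norm (f (- 1 - int n)))"
    unfolding summable_on_reindex[OF inj(1)] summable_on_reindex[OF inj(2)]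
    by (simp add: summable_on_UNIV_nonneg_real_iff o_def)
  finally show ?thesis .
qed

lemma infsum_int_split:
  fixes f :: "int \<Rightarrow> complex"
  assumes "f summable_on UNIV"
  shows "infsum f UNIV = (\<Sum>n. f (int n)) + (\<Sum>n. f (- 1 - int n))"
proof -
  have inj: "inj int" "inj (\<lambda>n. -1 - int n)" by (auto simp: inj_def)
  have abs: "(\<lambda>x. norm (f x)) summable_on UNIV" using assms by (simp add: summable_on_iff_abs_summable_on_complex)
  have s: "f summable_on range int" "f summable_on range (\<lambda>n. -1 - int n)"
    using assms by (auto elim: summable_on_subset_banach)
  have "infsum f UNIV = infsum f (range int) + infsum f (range (\<lambda>n. -1 - int n))"
    unfolding int_UNIV_split by (rule infsum_Un_disjoint[OF s]) auto
  also have "infsum f (range int) = infsum (\<lambda>n. f (int n)) UNIV"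
    by (simp add: infsum_reindex[OF inj(1)] o_def)
  also have "\<dots> = (\<Sum>n. f (int n))"
    using abs unfolding abs_summable_on_int_iff
    by (intro infsumI norm_summable_imp_has_sum) (auto intro: summable_sums summable_norm_cancel)
  also have "infsum f (range (\<lambda>n. -1 - int n)) = infsum (\<lambda>n. f (-1 - int n)) UNIV"
    by (simp add: infsum_reindex[OF inj(2)] o_def)
  also have "\<dots> = (\<Sum>n. f (- 1 - int n))"
    using abs unfolding abs_summable_on_int_iff
    by (intro infsumI norm_summable_imp_has_sum) (auto intro: summable_sums summable_norm_cancel)
  finally show ?thesis .
qed

lemma infsum_int_even:
  fixes f :: "int \<Rightarrow> complex"
  assumes "f summable_on UNIV" "\<And>n. f (- n) = f n"
  shows "infsum f UNIV = f 0 + 2 * (\<Sum>n. f (int (Suc n)))"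
proof -
  have abs: "(\<lambda>x. norm (f x)) summable_on UNIV" using assms by (simp add: summable_on_iff_abs_summable_on_complex)
  then have s: "summable (\<lambda>n. f (int n))"
    unfolding abs_summable_on_int_iff by (auto intro: summable_norm_cancel)
  have "f (- 1 - int n) = f (int (Suc n))" for n
    using assms(2)[of "int (Suc n)"] by (simp add: algebra_simps)
  then have "(\<Sum>n. f (- 1 - int n)) = (\<Sum>n. f (int (Suc n)))" by simp
  moreover have "(\<Sum>n. f (int n)) = f 0 + (\<Sum>n. f (int (Suc n)))"
    unfolding suminf_split_head[OF s] by simp
  ultimately show ?thesis
    unfolding infsum_int_split[OF assms(1)] by (simp only: mult_2 add.assoc)
qed

section \<open>Lattice sums and their transformation under the modular group\<close>

lemma abs_summable_on_mult_Times:
  fixes a :: "'a \<Rightarrow> real" and b :: "'b \<Rightarrow> real"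
  assumes "(\<lambda>x. norm (a x)) summable_on A" "(\<lambda>x. norm (b x)) summable_on B"
  shows "(\<lambda>(x, y). norm (a x * b y)) summable_on A \<times> B"
proof -
  have "(\<lambda>p. norm (case p of (x, y) \<Rightarrow> a x * b y)) summable_on A \<times> B"
    by (rule Infinite_Sum.abs_summable_on_Sigma_iff[THEN iffD2])
      (use assms in \<open>auto simp: norm_mult abs_mult infsum_cmult_right'
        intro!: summable_on_cmult_right summable_on_cmult_left\<close>)
  then show ?thesis by (simp add: case_prod_unfold)
qed

text \<open>For k > 0 the pair (0, 0) contributes \<open>inverse 0 = 0\<close>, so the sum is over
  the non-zero lattice vectors.\<close>

definition lattice_sum :: "nat \<Rightarrow> complex \<Rightarrow> complex" where
  "lattice_sum k z = (\<Sum>\<^sub>\<infinity>(m, n)\<in>UNIV. inverse ((of_int m * z + of_int n) ^ k))"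

text \<open>Any two norms on the real plane are comparable; the explicit constant comes from
  bounding m by the imaginary part and then n by the triangle inequality.\<close>

lemma lattice_norm_bound:
  assumes "Im z > 0"
  shows "\<bar>real_of_int m\<bar> + \<bar>real_of_int n\<bar> \<le> (1 + (1 + norm z) / Im z) * norm (of_int m * z + of_int n)"
proof -
  define w where "w = of_int m * z + of_int n"
  have "\<bar>Im w\<bar> \<le> norm w" by (rule abs_Im_le_cmod)
  then have "\<bar>real_of_int m\<bar> * Im z \<le> norm w" using assms by (simp add: w_def abs_mult)
  then have m: "\<bar>real_of_int m\<bar> \<le> norm w / Im z" using assms by (simp add: field_simps)
  have "norm (of_int n :: complex) \<le> norm w + norm (of_int m * z)"
    using norm_triangle_ineq4[of w "of_int m * z"] by (simp add: w_def)
  also have "norm (of_int m * z) \<le> norm w / Im z * norm z"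
    unfolding norm_mult norm_of_int of_int_abs by (rule mult_right_mono[OF m]) simp
  finally have "\<bar>real_of_int m\<bar> + \<bar>real_of_int n\<bar> \<le> norm w / Im z + (norm w + norm w / Im z * norm z)"
    using m by (simp del: of_int_abs)
  also have "\<dots> = (1 + (1 + norm z) / Im z) * norm w"
    using assms by (simp add: field_simps)
  finally show ?thesis by (simp add: w_def)
qed

text \<open>With s = |m| + |n| >= 1 one has (1 + |m|) (1 + |n|) <= 4 s^2, so s^-4 is at most 16
  times a product of two convergent one-variable series. The comparison s^4 <= s^k is where k >= 4
  enters.\<close>

lemma lattice_summable:
  assumes "Im z > 0" "k \<ge> 4"
  shows "(\<lambda>(m, n). norm (inverse ((of_int m * z + of_int n) ^ k))) summable_on (UNIV :: (int \<times> int) set)"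
proof -
  define C where "C = 1 + (1 + norm z) / Im z"
  have C: "C > 0" using assms by (simp add: C_def add_pos_nonneg)
  define a :: "int \<Rightarrow> real" where "a m = inverse ((1 + \<bar>real_of_int m\<bar>) ^ 2)" for m
  have a0: "a m > 0" for m by (simp add: a_def)
  have "summable (\<lambda>n. inverse (real (Suc n) ^ 2))"
    using inverse_power_summable[of 2, where 'a = real] by (subst summable_Suc_iff) simp
  moreover from this have "summable (\<lambda>n. inverse (real (Suc (Suc n)) ^ 2))"
    by (subst summable_Suc_iff)
  ultimately have "(\<lambda>x. norm (a x)) summable_on UNIV"
    unfolding abs_summable_on_int_iff by (simp add: a_def add_ac)
  then have "(\<lambda>(x, y). 16 * C ^ k * (a x * a y)) summable_on UNIV \<times> UNIV"
    using abs_summable_on_mult_Times[of a UNIV a UNIV] a0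
    by (auto simp: abs_mult case_prod_unfold less_imp_le intro: summable_on_cmult_right)
  then have "(\<lambda>(x, y). 16 * C ^ k * (a x * a y)) summable_on UNIV" by simp
  then show ?thesis
  proof (rule summable_on_comparison_test)
    fix x :: "int \<times> int"
    obtain m n where x: "x = (m, n)" by fastforce
    define s where "s = \<bar>real_of_int m\<bar> + \<bar>real_of_int n\<bar>"
    have "norm (inverse ((of_int m * z + of_int n) ^ k)) \<le> 16 * C ^ k * (a m * a n)"
    proof (cases "(m, n) = (0, 0)")
      case True
      then show ?thesis using assms C by (simp add: a_def power_0_left)
    next
      case False
      then have "1 \<le> \<bar>m\<bar> + \<bar>n\<bar>" by auto
      then have s1: "1 \<le> s" unfolding s_def by (metis of_int_1_le_iff of_int_abs of_int_add)
      let ?w = "of_int m * z + of_int n"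
      have sw: "s \<le> C * norm ?w" using lattice_norm_bound[OF assms(1)] by (simp add: s_def C_def)
      then have w0: "norm ?w > 0" using s1 C by (metis less_le_trans mult_zero_right norm_ge_zero not_one_le_zero order_le_less)
      have "s ^ k \<le> (C * norm ?w) ^ k" using sw s1 by (intro power_mono) auto
      moreover have "s ^ 4 \<le> s ^ k" using s1 assms by (intro power_increasing)
      ultimately have 1: "s ^ 4 \<le> C ^ k * norm ?w ^ k" by (simp add: power_mult_distrib)
      have "(1 + \<bar>real_of_int m\<bar>) * (1 + \<bar>real_of_int n\<bar>) \<le> (2 * s) * (2 * s)"
        using s1 by (intro mult_mono) (auto simp: s_def)
      then have "((1 + \<bar>real_of_int m\<bar>) * (1 + \<bar>real_of_int n\<bar>)) ^ 2 \<le> ((2 * s) * (2 * s)) ^ 2"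
        by (intro power_mono) auto
      then have 2: "((1 + \<bar>real_of_int m\<bar>) * (1 + \<bar>real_of_int n\<bar>)) ^ 2 \<le> 16 * s ^ 4"
        by (simp add: power_mult_distrib power4_eq_xxxx power2_eq_square)
      define M where "M = ((1 + \<bar>real_of_int m\<bar>) * (1 + \<bar>real_of_int n\<bar>)) ^ 2"
      have M: "M > 0" unfolding M_def by (intro zero_less_power mult_pos_pos) auto
      have aM: "a m * a n = inverse M" by (simp add: M_def a_def power_mult_distrib inverse_mult_distrib)
      have "M \<le> 16 * C ^ k * norm ?w ^ k" using 1 2 by (simp add: M_def)
      then have "inverse (norm ?w ^ k) \<le> 16 * C ^ k * inverse M"
        using M w0 by (simp add: field_simps)
      then show ?thesis by (simp add: aM norm_inverse norm_power)
    qed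
    then show "(case x of (m, n) \<Rightarrow> norm (inverse ((of_int m * z + of_int n) ^ k)))
        \<le> (case x of (x, y) \<Rightarrow> 16 * C ^ k * (a x * a y))" by (simp add: x)
  qed (auto simp: case_prod_unfold)
qed

lemma mobius_denom_nonzero:
  assumes "a * d - b * c = (1::int)" "Im z > 0"
  shows "of_int c * z + of_int d \<noteq> 0"
proof
  assume *: "of_int c * z + of_int d = 0"
  then have "Im (of_int c * z + of_int d) = 0" by simp
  then have "c = 0" using assms by simp
  with * assms show False by auto
qed

lemma Im_mobius:
  assumes "a * d - b * c = 1" "Im z > 0"
  shows "Im (mobius a b c d z) = Im z / norm (of_int c * z + of_int d) ^ 2"
proof -
  have "real_of_int a * d - b * c = 1" using assms(1) by (metis of_int_1 of_int_diff of_int_mult)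
  then have "real_of_int a * of_int d - of_int b * of_int c = 1" by simp
  then have eq: "real_of_int a * Im z * (c * Re z + d) - (a * Re z + b) * (c * Im z) = Im z"
    by algebra
  show ?thesis
    unfolding mobius_def Im_divide cmod_power2 using eq by (simp add: algebra_simps)
qed

lemma Im_mobius_pos:
  assumes "a * d - b * c = 1" "Im z > 0"
  shows "Im (mobius a b c d z) > 0"
  using Im_mobius[OF assms] mobius_denom_nonzero[OF assms] assms(2) by simp

text \<open>Up to the factor J, the vector (m, n) is replaced by its product with the matrix, and a
  matrix of determinant 1 permutes the integer pairs.\<close>

lemma lattice_sum_mobius:
  assumes "a * d - b * c = 1" "Im z > 0"
  shows "lattice_sum k (mobius a b c d z) = (of_int c * z + of_int d) ^ k * lattice_sum k z"
proof -
  define J where "J = of_int c * z + of_int d"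
  have J: "J \<noteq> 0" using mobius_denom_nonzero[OF assms] by (simp add: J_def)
  have "lattice_sum k (mobius a b c d z) =
      (\<Sum>\<^sub>\<infinity>(m, n)\<in>UNIV. J ^ k * inverse ((of_int (m * a + n * c) * z + of_int (m * b + n * d)) ^ k))"
    unfolding lattice_sum_def
  proof (rule infsum_cong, clarify)
    fix m n :: int
    have "of_int m * mobius a b c d z + of_int n =
        (of_int (m * a + n * c) * z + of_int (m * b + n * d)) / J"
      using J unfolding mobius_def J_def[symmetric] by (simp add: field_simps) (simp add: J_def algebra_simps)
    then show "inverse ((of_int m * mobius a b c d z + of_int n) ^ k) =
        J ^ k * inverse ((of_int (m * a + n * c) * z + of_int (m * b + n * d)) ^ k)"
      by (simp only: power_divide inverse_divide) (simp add: divide_inverse)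
  qed
  also have "\<dots> = J ^ k * (\<Sum>\<^sub>\<infinity>(m, n)\<in>UNIV. inverse ((of_int (m * a + n * c) * z + of_int (m * b + n * d)) ^ k))"
    by (simp add: case_prod_unfold infsum_cmult_right')
  also have "(\<Sum>\<^sub>\<infinity>(m, n)\<in>UNIV. inverse ((of_int (m * a + n * c) * z + of_int (m * b + n * d)) ^ k)) = lattice_sum k z"
    unfolding lattice_sum_def
  proof (rule infsum_reindex_bij_witness[where
        i = "\<lambda>(m, n). (m * d - n * c, n * a - m * b)" and j = "\<lambda>(m, n). (m * a + n * c, m * b + n * d)"])
    fix x :: "int \<times> int"
    obtain m n where x: "x = (m, n)" by fastforce
    have "(m * a + n * c) * d - (m * b + n * d) * c = m * (a * d - b * c)"
      "(m * b + n * d) * a - (m * a + n * c) * b = n * (a * d - b * c)" 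
      "(m * d - n * c) * a + (n * a - m * b) * c = m * (a * d - b * c)"
      "(m * d - n * c) * b + (n * a - m * b) * d = n * (a * d - b * c)"
      by algebra+
    then show "(case case x of (m, n) \<Rightarrow> (m * a + n * c, m * b + n * d) of (m, n) \<Rightarrow> (m * d - n * c, n * a - m * b)) = x"
      "(case case x of (m, n) \<Rightarrow> (m * d - n * c, n * a - m * b) of (m, n) \<Rightarrow> (m * a + n * c, m * b + n * d)) = x"
      unfolding assms(1) by (simp_all add: x)
  qed auto
  finally show ?thesis by (simp add: J_def)
qed

section \<open>The q-expansion of the lattice sums\<close>

lemma shifted_powers_summable:
  fixes z :: complex
  assumes "k \<ge> 2"
  shows "(\<lambda>n. norm (inverse ((z + of_int n) ^ k))) summable_on UNIV"
proof -
  have "norm (inverse ((z + of_int (- 1 - int n)) ^ k)) = norm (inverse ((1 - z + of_nat n) ^ k))" for n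
  proof -
    have "z + of_int (- 1 - int n) = - (1 - z + of_nat n)" by simp
    then show ?thesis by (metis norm_inverse norm_minus_cancel norm_power)
  qed
  then show ?thesis
    unfolding abs_summable_on_int_iff
    using norm_summable_inverse_shift_power[OF assms] by simp
qed

text \<open>For odd m the exponent is even, so the sign of the reflected half disappears and both
  halves are polygamma series with the same sign.\<close>

lemma sum_shifted_powers:
  fixes z :: complex
  assumes "z \<notin> \<int>" "odd m"
  shows "(\<Sum>\<^sub>\<infinity>n. inverse ((z + of_int n) ^ Suc m)) = refl_polygamma m z / fact m"
proof -
  have m: "m > 0" "Suc m \<ge> 2" using assms(2) by (auto elim: oddE)
  have "inverse ((z + of_int (- 1 - int n)) ^ Suc m) = inverse ((1 - z + of_nat n) ^ Suc m)" for n
  proof -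
    have "z + of_int (- 1 - int n) = - (1 - z + of_nat n)" by simp
    moreover have "even (Suc m)" using assms by simp
    ultimately show ?thesis by (metis power_minus_even)
  qed
  moreover have "(\<lambda>n. inverse ((z + of_int n) ^ Suc m)) summable_on UNIV"
    using abs_summable_summable[OF shifted_powers_summable[OF m(2)]] .
  ultimately have "(\<Sum>\<^sub>\<infinity>n. inverse ((z + of_int n) ^ Suc m)) =
      (\<Sum>n. inverse ((z + of_nat n) ^ Suc m)) + (\<Sum>n. inverse ((1 - z + of_nat n) ^ Suc m))"
    using infsum_int_split by simp
  then show ?thesis
    using assms m by (simp add: refl_polygamma_def Polygamma_def field_simps del: power_Suc)
qed

text \<open>The point 0 is a pole of the cotangent, so the value is obtained from 1/2 instead: the
  even integers reproduce 2^-(m+1) times the whole sum, the odd ones are the shifted sum at 1/2.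
  This evaluates 2 \<zeta>(m+1).\<close>

lemma sum_integer_powers:
  assumes "odd m"
  shows "(\<Sum>\<^sub>\<infinity>n. inverse ((of_int n :: complex) ^ Suc m)) =
    refl_polygamma m (1/2) / (fact m * (2 ^ Suc m - 1))"
proof -
  let ?f = "\<lambda>n. inverse ((of_int n :: complex) ^ Suc m)"
  have m: "Suc m \<ge> 2" using assms by (auto elim: oddE)
  have half: "(1/2 :: complex) \<notin> \<int>"
    using fraction_not_in_Ints[where 'a = complex, of 2 1] by simp
  have sum: "?f summable_on UNIV"
    using abs_summable_summable[OF shifted_powers_summable[OF m, of 0]] by simp
  have inj: "inj (\<lambda>n::int. 2 * n)" "inj (\<lambda>n::int. 2 * n + 1)" by (auto simp: inj_def)
  have split: "(UNIV :: int set) = range (\<lambda>n. 2 * n) \<union> range (\<lambda>n. 2 * n + 1)"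
    by (auto elim: evenE oddE) (metis evenE oddE rangeI)
  have dj: "range (\<lambda>n::int. 2 * n) \<inter> range (\<lambda>n. 2 * n + 1) = {}" by (auto; presburger)
  define Z where "Z = infsum ?f UNIV"
  have "Z = infsum ?f (range (\<lambda>n. 2 * n)) + infsum ?f (range (\<lambda>n. 2 * n + 1))"
    unfolding Z_def by (subst split, rule infsum_Un_disjoint)
      (use dj sum in \<open>auto elim: summable_on_subset_banach\<close>)
  also have "infsum ?f (range (\<lambda>n. 2 * n)) = infsum (\<lambda>n. inverse (2 ^ Suc m) * ?f n) UNIV"
    unfolding infsum_reindex[OF inj(1)] o_def of_int_mult of_int_numeral power_mult_distrib
      inverse_mult_distrib ..
  also have "\<dots> = Z / 2 ^ Suc m"
    unfolding Z_def infsum_cmult_right' divide_inverse by (rule mult.commute)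
  also have "infsum ?f (range (\<lambda>n. 2 * n + 1)) =
      infsum (\<lambda>n. inverse (2 ^ Suc m) * inverse ((1/2 + of_int n) ^ Suc m)) UNIV"
  proof -
    have "(of_int (2 * n + 1) :: complex) = 2 * (1/2 + of_int n)" for n by simp
    then show ?thesis
      unfolding infsum_reindex[OF inj(2)] o_def by (simp only: power_mult_distrib inverse_mult_distrib)
  qed
  also have "\<dots> = refl_polygamma m (1/2) / fact m / 2 ^ Suc m"
    unfolding infsum_cmult_right' sum_shifted_powers[OF half assms]
    by (subst divide_inverse[of _ "2 ^ Suc m"], rule mult.commute)
  finally have Z: "Z = Z / 2 ^ Suc m + refl_polygamma m (1/2) / fact m / 2 ^ Suc m" .
  define T :: complex where "T = 2 ^ Suc m"
  have "(2::nat) ^ Suc m > 1" by (rule one_less_power) auto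
  then have "(of_nat (2 ^ Suc m) :: complex) \<noteq> of_nat 1" by (metis less_irrefl of_nat_eq_iff)
  then have T: "T \<noteq> 1" "T \<noteq> 0" by (simp_all add: T_def)
  have "Z * (T - 1) = refl_polygamma m (1/2) / fact m"
    using Z T unfolding T_def[symmetric] by (simp add: field_simps)
  then show ?thesis
    using T unfolding Z_def[symmetric] T_def[symmetric] by (simp add: field_simps)
qed

text \<open>A double sum of m^k q^(m n) over m, n >= 1: summing over n first gives geometric series
  and hence the Lambert series, summing over m first gives power sums. Absolute convergence allows
  the exchange.\<close>

lemma sum_power_sum_eq_lambert:
  assumes "norm q < 1"
  shows "(\<lambda>n. power_sum k (q ^ Suc n)) sums (q * lambert k q)"
proof -
  define F where "F m n = of_nat (Suc m) ^ k * q ^ (Suc m * Suc n)" for m n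
  have nF: "norm (F m n) \<le> real (Suc m) ^ k * norm q ^ m * norm q ^ n" for m n
  proof -
    have "norm q ^ (Suc m * Suc n) \<le> norm q ^ (m + n)"
      using assms by (intro power_decreasing) auto
    then show ?thesis by (simp add: F_def norm_mult norm_power power_add mult.assoc mult_left_mono del: of_nat_Suc mult_Suc)
  qed
  have "(\<lambda>m. norm (real (Suc m) ^ k * norm q ^ m)) summable_on UNIV"
    using summable_power_mult_geometric[of "norm q" k] assms
    by (simp add: summable_on_UNIV_nonneg_real_iff)
  moreover have "(\<lambda>n. norm (norm q ^ n)) summable_on UNIV"
    using assms by (simp add: summable_on_UNIV_nonneg_real_iff summable_geometric)
  ultimately have b: "(\<lambda>(m, n). norm (real (Suc m) ^ k * norm q ^ m * norm q ^ n)) summable_on UNIV \<times> UNIV"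
    by (rule abs_summable_on_mult_Times)
  have abs: "(\<lambda>x. norm (case x of (m, n) \<Rightarrow> F m n)) summable_on UNIV \<times> UNIV"
    by (rule summable_on_comparison_test[OF b])
      (use nF in \<open>auto simp: case_prod_unfold intro: order_trans[OF _ abs_ge_self]\<close>)
  have s: "infsum f UNIV = suminf f" if "(\<lambda>n. norm (f n)) summable_on (UNIV :: nat set)" for f :: "nat \<Rightarrow> complex"
    using that by (intro infsumI norm_summable_imp_has_sum)
      (auto simp: summable_on_UNIV_nonneg_real_iff intro: summable_sums summable_norm_cancel)
  have q1: "norm (q ^ Suc n) < 1" for n
    unfolding norm_power using assms by (metis norm_ge_zero power_less_one_iff zero_less_Suc)
  have row: "(\<lambda>n. norm (F m n)) summable_on UNIV" for m
    using abs by (subst (asm) Infinite_Sum.abs_summable_on_Sigma_iff) auto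
  have col: "(\<lambda>m. norm (F m n)) summable_on UNIV" for n
    using norm_summable_power_sum[OF q1[of n], where k = k]
    by (simp add: summable_on_UNIV_nonneg_real_iff F_def power_mult[symmetric] mult.commute del: power_Suc mult_Suc of_nat_Suc)
  have abs': "(\<lambda>x. norm (case x of (n, m) \<Rightarrow> F m n)) summable_on UNIV \<times> UNIV"
    using summable_on_reindex_bij_betw[of prod.swap UNIV UNIV "\<lambda>x. norm (case x of (m, n) \<Rightarrow> F m n)"] abs
    by (simp add: case_prod_unfold o_def)
  have "(\<lambda>m. norm (infsum (\<lambda>n. norm (F m n)) UNIV)) summable_on UNIV"
    using abs by (subst (asm) Infinite_Sum.abs_summable_on_Sigma_iff) auto
  then have out: "(\<lambda>m. norm (infsum (F m) UNIV)) summable_on UNIV"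
    by (rule summable_on_comparison_test)
      (use norm_infsum_bound[OF row] in \<open>auto intro: order_trans[OF _ abs_ge_self]\<close>)
  have "(\<lambda>n. norm (infsum (\<lambda>m. norm (F m n)) UNIV)) summable_on UNIV"
    using abs' by (subst (asm) Infinite_Sum.abs_summable_on_Sigma_iff) auto
  then have out': "(\<lambda>n. norm (infsum (\<lambda>m. F m n) UNIV)) summable_on UNIV"
    by (rule summable_on_comparison_test)
      (use norm_infsum_bound[OF col] in \<open>auto intro: order_trans[OF _ abs_ge_self]\<close>)
  have ps: "power_sum k (q ^ Suc n) = infsum (\<lambda>m. F m n) UNIV" for n
    unfolding s[OF col] power_sum_def
    by (simp add: F_def power_mult[symmetric] mult.commute del: power_Suc mult_Suc of_nat_Suc)
  have summable: "summable (\<lambda>n. power_sum k (q ^ Suc n))"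
    using out' unfolding ps by (simp add: summable_on_UNIV_nonneg_real_iff summable_norm_cancel)
  have "(\<Sum>n. power_sum k (q ^ Suc n)) = (\<Sum>n. infsum (\<lambda>m. F m n) UNIV)"
    unfolding ps ..
  also have "\<dots> = infsum (\<lambda>n. infsum (\<lambda>m. F m n) UNIV) UNIV" by (rule s[OF out', symmetric])
  also have "\<dots> = infsum (\<lambda>m. infsum (F m) UNIV) UNIV"
    by (rule infsum_swap_banach[symmetric]) (rule abs_summable_summable[OF abs])
  also have "\<dots> = (\<Sum>m. infsum (F m) UNIV)" by (rule s[OF out])
  also have "\<dots> = (\<Sum>m. of_nat (Suc m) ^ k * q ^ Suc m / (1 - q ^ Suc m))"
  proof (rule suminf_cong)
    fix m
    have F: "F m n = of_nat (Suc m) ^ k * q ^ Suc m * (q ^ Suc m) ^ n" for n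
      unfolding F_def mult_Suc_right power_add power_mult by (simp only: mult.assoc)
    have "infsum (F m) UNIV = (\<Sum>n. of_nat (Suc m) ^ k * q ^ Suc m * (q ^ Suc m) ^ n)"
      unfolding s[OF row] F ..
    also have "\<dots> = of_nat (Suc m) ^ k * q ^ Suc m * (1 / (1 - q ^ Suc m))"
      unfolding suminf_mult[OF summable_geometric[OF q1]] suminf_geometric[OF q1] ..
    finally show "infsum (F m) UNIV = of_nat (Suc m) ^ k * q ^ Suc m / (1 - q ^ Suc m)" by simp
  qed
  finally have "(\<Sum>n. power_sum k (q ^ Suc n)) =
      (\<Sum>m. of_nat (Suc m) ^ k * q ^ Suc m / (1 - q ^ Suc m))" .
  with summable show ?thesis using lambert_mult[OF assms] by (simp add: sums_iff)
qed

text \<open>The lattice is summed row by row. Row 0 is the constant term, rows a and -a agree since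
  the exponent is even, and each row with a > 0 is Lipschitz's formula at a z, where the nome is
  q^a.\<close>

lemma lattice_sum_eq:
  assumes "Im z > 0" "odd m" "m \<ge> 3"
  shows "lattice_sum (Suc m) z = refl_polygamma m (1/2) / (fact m * (2 ^ Suc m - 1)) +
    2 * (2 * of_real pi * \<i>) ^ Suc m / fact m * (nome z * lambert m (nome z))"
proof -
  define R where "R = (\<lambda>a::int. \<Sum>\<^sub>\<infinity>n. inverse ((of_int a * z + of_int n) ^ Suc m))"
  have q: "norm (nome z) < 1" using assms by (simp add: norm_nome_less_1_iff)
  have "Suc m \<ge> 4" using assms(3) by simp
  from abs_summable_summable[of "\<lambda>(a, n). inverse ((of_int a * z + of_int n) ^ Suc m)"]
    lattice_summable[OF assms(1) this]
  have sum: "(\<lambda>(a, n). inverse ((of_int a * z + of_int n) ^ Suc m)) summable_on UNIV \<times> UNIV"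
    by (simp add: case_prod_unfold)
  have "lattice_sum (Suc m) z = infsum R UNIV"
    unfolding lattice_sum_def R_def using infsum_Sigma'_banach[OF sum] by simp
  also have "\<dots> = R 0 + 2 * (\<Sum>a. R (int (Suc a)))"
  proof (rule infsum_int_even)
    show "R summable_on UNIV"
      using summable_on_Sigma_banach[OF sum] by (simp add: R_def)
    show "R (- a) = R a" for a
      unfolding R_def
    proof (rule infsum_reindex_bij_witness[where i = uminus and j = uminus])
      fix n :: int
      have "of_int a * z + of_int (- n) = - (of_int (- a) * z + of_int n)" by simp
      moreover have "even (Suc m)" using assms by simp
      ultimately show "inverse ((of_int a * z + of_int (- n)) ^ Suc m) = inverse ((of_int (- a) * z + of_int n) ^ Suc m)"
        by (metis power_minus_even)
    qed auto
  qed
  also have "R 0 = refl_polygamma m (1/2) / (fact m * (2 ^ Suc m - 1))"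
    using sum_integer_powers[OF assms(2)] by (simp add: R_def)
  also have "(\<lambda>a. R (int (Suc a))) =
      (\<lambda>a. (2 * of_real pi * \<i>) ^ Suc m / fact m * power_sum m (nome z ^ Suc a))"
  proof
    fix a :: nat
    have I: "Im (of_nat (Suc a) * z) > 0" using assms by simp
    have n: "nome (of_nat (Suc a) * z) = nome z ^ Suc a"
      unfolding nome_def exp_of_nat_mult[symmetric] by (simp add: mult_ac)
    have "R (int (Suc a)) = refl_polygamma m (of_nat (Suc a) * z) / fact m"
      unfolding R_def using sum_shifted_powers[OF not_Ints_upper[OF I] assms(2)] by simp
    also have "refl_polygamma m (of_nat (Suc a) * z) = (2 * of_real pi * \<i>) ^ Suc m * power_sum m (nome z ^ Suc a)"
      using refl_polygamma_nome[OF I, of m] assms unfolding n by simp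
    finally show "R (int (Suc a)) = (2 * of_real pi * \<i>) ^ Suc m / fact m * power_sum m (nome z ^ Suc a)"
      by simp
  qed
  also have "(\<Sum>a. (2 * of_real pi * \<i>) ^ Suc m / fact m * power_sum m (nome z ^ Suc a)) =
      (2 * of_real pi * \<i>) ^ Suc m / fact m * (nome z * lambert m (nome z))"
    by (rule sums_unique[symmetric]) (rule sums_mult[OF sum_power_sum_eq_lambert[OF q]])
  finally show ?thesis by simp
qed

text \<open>The constants \<pi>^4 / 45 here and 2 \<pi>^6 / 945 in the next lemma are 2 \<zeta>(4)
  and 2 \<zeta>(6).\<close>

lemma lattice_sum_4: "Im z > 0 \<Longrightarrow> lattice_sum 4 z = of_real pi ^ 4 / 45 * E4 z"
  using lattice_sum_eq[of z 3] refl_polygamma_half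
  by (simp add: E4_eq_e4 e4_def fact_numeral power_mult_distrib field_simps del: power_Suc)

lemma lattice_sum_6: "Im z > 0 \<Longrightarrow> lattice_sum 6 z = 2 * of_real pi ^ 6 / 945 * E6 z"
  using lattice_sum_eq[of z 5] refl_polygamma_half
  by (simp add: E6_eq_e6 e6_def fact_numeral power_mult_distrib field_simps del: power_Suc)

lemma E4_mobius:
  assumes "a * d - b * c = 1" "Im z > 0"
  shows "E4 (mobius a b c d z) = (of_int c * z + of_int d) ^ 4 * E4 z"
  using lattice_sum_mobius[OF assms, of 4] lattice_sum_4[OF assms(2)] lattice_sum_4[OF Im_mobius_pos[OF assms]]
  by simp

lemma E6_mobius:
  assumes "a * d - b * c = 1" "Im z > 0"
  shows "E6 (mobius a b c d z) = (of_int c * z + of_int d) ^ 6 * E6 z"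
  using lattice_sum_mobius[OF assms, of 6] lattice_sum_6[OF assms(2)] lattice_sum_6[OF Im_mobius_pos[OF assms]]
  by simp

section \<open>Ramanujan's differential equations\<close>

lemma holomorphic_divide_ident:
  assumes "f holomorphic_on ball 0 r" "f 0 = 0" "r > 0"
  obtains g where "g holomorphic_on ball 0 r" "\<And>q. f q = q * g q" "g 0 = deriv f 0"
proof
  let ?g = "\<lambda>q. if q = 0 then deriv f 0 else f q / q"
  have "(\<lambda>q. if q = 0 then deriv f 0 else (f q - f 0) / (q - 0)) holomorphic_on ball 0 r"
    by (rule pole_lemma[OF assms(1)]) (use assms in auto)
  then show "?g holomorphic_on ball 0 r" using assms(2) by (simp cong: if_cong)
qed (use assms in auto)

lemma holomorphic_double_zero:
  assumes "f holomorphic_on ball 0 r" "f 0 = 0" "deriv f 0 = 0" "r > 0"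
  obtains g where "g holomorphic_on ball 0 r" "\<And>q. f q = q ^ 2 * g q"
proof -
  obtain g where g: "g holomorphic_on ball 0 r" "\<And>q. f q = q * g q" "g 0 = deriv f 0"
    using holomorphic_divide_ident[OF assms(1,2,4)] by blast
  obtain h where h: "h holomorphic_on ball 0 r" "\<And>q. g q = q * h q"
    using holomorphic_divide_ident[OF g(1) _ assms(4)] g(3) assms(3) by metis
  show ?thesis using that[OF h(1)] g h by (simp add: power2_eq_square mult.assoc)
qed

lemma exists_nome:
  assumes "q \<noteq> 0"
  shows "\<exists>z. nome z = q \<and> Im z = - ln (norm q) / (2 * pi)"
proof (intro exI conjI)
  let ?z = "Ln q / (2 * of_real pi * \<i>)"
  show "nome ?z = q" using assms by (simp add: nome_def)
  have "?z = - (\<i> * Ln q) / of_real (2 * pi)" by (simp add: field_simps)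
  then show "Im ?z = - ln (norm q) / (2 * pi)" using assms by (simp add: Im_divide_of_real)
qed

text \<open>For small y = Im z, Dirichlet's approximation theorem provides h / k with k at most
  about y^(-1/2) and |k Re z - h| <= y^(1/2). Then |k z - h|^2 <= y + 9/4 y <= 5 y, and a matrix
  with lower row (k, -h) lifts z to height at least 1/5. Any positive constant in place of 1/5 would
  serve to reach a fixed strip of finite width.\<close>

lemma exists_mobius_Im_ge:
  assumes "Im z > 0"
  obtains a b c d where "a * d - b * c = 1" "Im (mobius a b c d z) \<ge> 1/5"
proof (cases "Im z \<ge> 1/5")
  case True
  then show ?thesis using that[of 1 1 0 0] by (simp add: mobius_def)
next
  case False
  define y where "y = Im z"
  define t where "t = sqrt y"
  have y: "0 < y" "y < 1/5" using assms False by (simp_all add: y_def)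
  have t: "0 < t" "t ^ 2 = y" using y by (simp_all add: t_def)
  have t2: "t < 1/2"
  proof (rule ccontr)
    assume "\<not> t < 1/2"
    then have "(1/2) ^ 2 \<le> t ^ 2" by (intro power_mono) auto
    then show False using t y by (simp add: power2_eq_square)
  qed
  define N where "N = nat \<lceil>1 / t\<rceil>"
  have N: "1 / t \<le> real N" unfolding N_def by (rule real_nat_ceiling_ge)
  have "real N = of_int \<lceil>1 / t\<rceil>" using t by (simp add: N_def)
  then have "real N \<le> 1 / t + 1" by linarith
  moreover have "N > 0" using t by (simp add: N_def)
  ultimately have N: "1 / t \<le> real N" "real N \<le> 1 / t + 1" "N > 0" using N by simp_all
  obtain h k where hk: "coprime h k" "0 < k" "k \<le> int N" "\<bar>of_int k * Re z - of_int h\<bar> < 1 / N"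
    using Dirichlet_approx_coprime[OF N(3)] by metis
  obtain u v where uv: "u * h + v * k = 1"
    using bezout_int[of h k] hk(1) by (auto simp: coprime_iff_gcd_eq_1)
  define n where "n = norm (of_int k * z + of_int (- h)) ^ 2"
  have n0: "n > 0"
  proof -
    have "Im (of_int k * z + of_int (- h)) \<noteq> 0" using hk y by (simp add: y_def)
    then have "of_int k * z + of_int (- h) \<noteq> 0" by (metis zero_complex.sel(2))
    then show ?thesis by (simp add: n_def)
  qed
  have "(of_int k * Re z - of_int h) ^ 2 \<le> (1 / real N) ^ 2"
    using hk(4) by (metis abs_ge_zero less_imp_le power2_abs power_mono)
  also have "\<dots> \<le> t ^ 2"
    using N t by (intro power_mono) (auto simp: field_simps)
  finally have 1: "(of_int k * Re z - of_int h) ^ 2 \<le> y" using t by simp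
  have "real_of_int k \<le> 1 / t + 1" using hk N by linarith
  then have "real_of_int k * y \<le> (1 / t + 1) * y" using y by (intro mult_right_mono) auto
  also have "\<dots> = t + t ^ 2" using t by (simp add: power2_eq_square field_simps flip: t(2))
  also have "t ^ 2 \<le> t * (1/2)" unfolding power2_eq_square using t t2 by (intro mult_left_mono) auto
  also have "t + t * (1/2) = t * (3/2)" by simp
  finally have "(real_of_int k * y) ^ 2 \<le> (t * (3/2)) ^ 2" using hk y by (intro power_mono) auto
  then have 2: "(real_of_int k * y) ^ 2 \<le> y * (9/4)" using t by (simp add: power_mult_distrib power2_eq_square)
  have n: "n = (of_int k * Re z - of_int h) ^ 2 + (real_of_int k * y) ^ 2"
    unfolding n_def cmod_power2 by (simp add: y_def)
  then have "n \<le> 5 * y" using 1 2 y by simp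
  then have le: "1/5 \<le> y / n" using n0 by (simp add: field_simps)
  have det: "(- u) * (- h) - (- v) * k = 1" using uv by (simp add: algebra_simps)
  from Im_mobius[OF det assms] le have "Im (mobius (- u) (- v) k (- h) z) \<ge> 1/5"
    by (simp add: n_def y_def)
  with det show ?thesis using that by blast
qed

lemma fundamental_rectangle:
  assumes "Im z > 0"
  obtains a b c d where "a * d - b * c = 1" "Im (mobius a b c d z) \<ge> 1/5" "\<bar>Re (mobius a b c d z)\<bar> \<le> 1/2"
proof -
  obtain a b c d where *: "a * d - b * c = 1" "Im (mobius a b c d z) \<ge> 1/5"
    using exists_mobius_Im_ge[OF assms] by metis
  define n where "n = round (Re (mobius a b c d z))"
  have J: "of_int c * z + of_int d \<noteq> 0" using mobius_denom_nonzero[OF *(1) assms] .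
  have eq: "mobius (a - n * c) (b - n * d) c d z = mobius a b c d z - of_int n"
    using J by (simp add: mobius_def field_simps)
  have "(a - n * c) * d - (b - n * d) * c = 1" using *(1) by (simp add: algebra_simps)
  moreover have "\<bar>Re (mobius a b c d z) - of_int n\<bar> \<le> 1/2"
    unfolding n_def using of_int_round_abs_le[of "Re (mobius a b c d z)"] by (simp add: abs_minus_commute)
  ultimately show ?thesis using that[of "a - n * c" d "b - n * d" c] * by (simp add: eq)
qed

text \<open>The function \<open>\<bar>f z\<bar> (Im z)\<^sup>6\<close> is invariant and
  attains its maximum at a point \<open>z\<^sub>0\<close> with \<open>Im z\<^sub>0 \<ge> \<surd>3/2\<close>, and the maximum principle for
  \<open>f / q\<^sup>2\<close> on a slightly larger disc contradicts maximality.\<close>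

lemma weight_12_double_zero_vanishes:
  assumes hol: "f holomorphic_on upper_half_plane" and g: "g holomorphic_on ball 0 1"
    and mob: "\<And>a b c d z. a * d - b * c = 1 \<Longrightarrow> Im z > 0 \<Longrightarrow>
      f (mobius a b c d z) = (of_int c * z + of_int d) ^ 12 * f z"
    and fg: "\<And>z. Im z > 0 \<Longrightarrow> f z = nome z ^ 2 * g (nome z)"
    and z: "Im z > 0"
  shows "f z = 0"
proof (rule ccontr)
  assume fz: "f z \<noteq> 0"
  define M where "M z = norm (f z) * Im z ^ 6" for z
  have M_inv: "M (mobius a b c d w) = M w" if "a * d - b * c = 1" "Im w > 0" for a b c d w
  proof -
    define J where "J = norm (of_int c * w + of_int d)"
    have "J > 0" using mobius_denom_nonzero[OF that] by (simp add: J_def)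
    then show ?thesis
      unfolding M_def mob[OF that] Im_mobius[OF that]
      by (simp add: norm_mult norm_power J_def[symmetric] power_divide flip: power_mult)
  qed
  have cont: "continuous_on upper_half_plane M"
    unfolding M_def by (intro continuous_intros holomorphic_on_imp_continuous_on[OF hol])
  define K where "K = {w. \<bar>Re w\<bar> \<le> 1/2 \<and> Im w \<ge> 1/5}"
  obtain w1 where w1: "w1 \<in> K" "M w1 > 0"
  proof -
    obtain a b c d where *: "a * d - b * c = 1" "Im (mobius a b c d z) \<ge> 1/5" "\<bar>Re (mobius a b c d z)\<bar> \<le> 1/2"
      using fundamental_rectangle[OF z] by metis
    have "M (mobius a b c d z) > 0" unfolding M_inv[OF *(1) z] using fz z by (simp add: M_def)
    then show ?thesis using that[of "mobius a b c d z"] * by (simp add: K_def)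
  qed
  have "exp (- 2 * pi * (1/5)) < 1" by simp
  then have "cball 0 (exp (- 2 * pi * (1/5))) \<subseteq> ball (0::complex) 1"
    unfolding cball_subset_ball_iff by simp
  then have "compact (g ` cball 0 (exp (- 2 * pi * (1/5))))"
    by (intro compact_continuous_image holomorphic_on_imp_continuous_on holomorphic_on_subset[OF g]) auto
  then obtain B where B: "\<And>q. norm q \<le> exp (- 2 * pi * (1/5)) \<Longrightarrow> norm (g q) \<le> B"
    using compact_imp_bounded bounded_iff by (metis imageI mem_cball_0)
  have M_le: "M w \<le> exp (- 4 * pi * Im w) * B * Im w ^ 6" if "Im w \<ge> 1/5" for w
  proof -
    have "norm (nome w) \<le> exp (- 2 * pi * (1/5))"
      unfolding norm_nome using that by simp
    then have "norm (g (nome w)) \<le> B" by (rule B)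
    moreover have "norm (nome w) ^ 2 = exp (- 4 * pi * Im w)"
      unfolding norm_nome exp_of_nat_mult[symmetric] by simp
    ultimately have "norm (f w) \<le> exp (- 4 * pi * Im w) * B"
      using fg[of w] that by (simp add: norm_mult norm_power)
    then show ?thesis unfolding M_def using that by (intro mult_right_mono) auto
  qed
  \<comment> \<open>The double zero at the cusp makes M decay there, so the points of K where M is
    at least \<open>M w1\<close> stay in a compact rectangle.\<close>
  have "((\<lambda>y. exp (- 4 * pi * y) * B * y ^ 6) \<longlongrightarrow> 0) at_top" by real_asymp
  then have "\<forall>\<^sub>F y in at_top. exp (- 4 * pi * y) * B * y ^ 6 < M w1"
    using w1(2) by (rule order_tendstoD)
  then obtain Y where Y: "\<And>y. y \<ge> Y \<Longrightarrow> exp (- 4 * pi * y) * B * y ^ 6 < M w1"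
    by (auto simp: eventually_at_top_linorder)
  define K' where "K' = {w. \<bar>Re w\<bar> \<le> 1/2 \<and> 1/5 \<le> Im w \<and> Im w \<le> Y}"
  have K': "K' = cbox (Complex (-1/2) (1/5)) (Complex (1/2) Y)"
    by (auto simp: K'_def in_cbox_complex_iff)
  have comp: "compact K'" unfolding K' by (rule compact_cbox)
  have K'_sub: "K' \<subseteq> upper_half_plane" by (auto simp: K'_def)
  have big: "w \<in> K'" if "w \<in> K" "M w \<ge> M w1" for w
    using that Y[of "Im w"] M_le[of w] by (force simp: K_def K'_def)
  have "w1 \<in> K'" using big w1 by simp
  then obtain w2 where w2: "w2 \<in> K'" "\<And>w. w \<in> K' \<Longrightarrow> M w \<le> M w2"
    using continuous_attains_sup[OF comp _ continuous_on_subset[OF cont K'_sub]] by blast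
  have max: "M w \<le> M w2" if w: "Im w > 0" for w
  proof -
    obtain a b c d where *: "a * d - b * c = 1" "Im (mobius a b c d w) \<ge> 1/5" "\<bar>Re (mobius a b c d w)\<bar> \<le> 1/2"
      using fundamental_rectangle[OF w] by metis
    show ?thesis
    proof (rule ccontr)
      assume "\<not> ?thesis"
      then have "M (mobius a b c d w) > M w2" by (simp add: M_inv[OF *(1) w])
      moreover have "M w2 \<ge> M w1" using w2 \<open>w1 \<in> K'\<close> by simp
      ultimately have "mobius a b c d w \<in> K'" using * by (intro big) (auto simp: K_def)
      then show False using w2 \<open>M (mobius a b c d w) > M w2\<close> by fastforce
    qed
  qed
  \<comment> \<open>Among the maximum points in the rectangle one of greatest height is taken: if it
    lay inside the unit circle, z -> -1/z followed by a translation would give a higher one.\<close>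
  define K'' where "K'' = {w \<in> K'. M w \<in> {M w2}}"
  have "closedin (top_of_set K') K''"
    unfolding K''_def using continuous_closedin_preimage[OF continuous_on_subset[OF cont K'_sub], of "{M w2}"]
    by (simp add: vimage_def Int_def)
  then have "compact K''" using comp by (metis closedin_compact)
  moreover have "w2 \<in> K''" using w2 by (simp add: K''_def)
  ultimately obtain z0 where z0: "z0 \<in> K''" "\<And>w. w \<in> K'' \<Longrightarrow> Im w \<le> Im z0"
    using continuous_attains_sup[of K'' Im] continuous_on_Im[OF continuous_on_id] by (metis empty_iff)
  define y where "y = Im z0"
  have y: "y \<ge> 1/5" using z0 by (simp add: K''_def K'_def y_def)
  have Mz0: "M z0 = M w2" using z0 by (simp add: K''_def)
  have Mpos: "M z0 > 0" using Mz0 w2 \<open>w1 \<in> K'\<close> w1 by fastforce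
  have "norm z0 \<ge> 1"
  proof (rule ccontr)
    assume "\<not> norm z0 \<ge> 1"
    then have n1: "norm z0 < 1" by simp
    have d1: "0 * 0 - (-1) * 1 = (1::int)" by simp
    define s where "s = mobius 0 (-1) 1 0 z0"
    have I0: "Im z0 > 0" using y by (simp add: y_def)
    have z00: "norm z0 > 0" using I0 by auto
    have "Im s = y / norm z0 ^ 2"
      unfolding s_def using Im_mobius[OF d1 I0] by (simp add: y_def)
    moreover have "norm z0 ^ 2 < 1" using n1 z00 by (simp add: power_less_one_iff)
    moreover from this have "y * norm z0 ^ 2 < y * 1" using y by (intro mult_strict_left_mono) auto
    then have "y < y / norm z0 ^ 2" using z00 by (simp add: less_divide_eq)
    ultimately have Is: "Im s > y" by simp
    define n where "n = round (Re s)"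
    have d2: "1 * 1 - (- n) * 0 = (1::int)" by simp
    define w where "w = mobius 1 (- n) 0 1 s"
    have w: "w = s - of_int n" by (simp add: w_def mobius_def)
    have "M w = M w2"
      unfolding w_def using M_inv[OF d2, of s] M_inv[OF d1 I0] Mz0 Is y by (simp add: s_def)
    moreover have "\<bar>Re w\<bar> \<le> 1/2"
      unfolding w n_def using of_int_round_abs_le[of "Re s"] by (simp add: abs_minus_commute)
    moreover have "Im w > y" using Is by (simp add: w)
    ultimately have "w \<in> K'" using y w2 \<open>w1 \<in> K'\<close> by (intro big) (auto simp: K_def)
    then have "w \<in> K''" using \<open>M w = M w2\<close> by (simp add: K''_def)
    then show False using z0(2) \<open>Im w > y\<close> by (fastforce simp: y_def)
  qed
  then have "1 \<le> Re z0 ^ 2 + y ^ 2"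
    unfolding y_def using cmod_power2[of z0] by (metis one_le_power)
  moreover have "\<bar>Re z0\<bar> ^ 2 \<le> (1/2) ^ 2"
    using z0 by (intro power_mono) (auto simp: K''_def K'_def)
  ultimately have y34: "y ^ 2 \<ge> 3/4" by (simp add: power2_eq_square)
  have y45: "y \<ge> 4/5"
  proof (rule ccontr)
    assume "\<not> y \<ge> 4/5"
    then have "y ^ 2 \<le> (4/5) ^ 2" using y by (intro power_mono) auto
    then show False using y34 by (simp add: power2_eq_square)
  qed
  define y' where "y' = y - 1/100"
  have y': "y' > 0" using y45 by (simp add: y'_def)
  \<comment> \<open>F compares |q|^2 y^6 at the heights y and y' = y - 1/100. Its logarithmic
    derivative 6 / y - 4 \<pi> is negative for y > 3 / (2 \<pi>), which the bound y >= 4/5 ensures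
    with room for the step 1/100. The maximum principle then gives |g| <= F |g| at
    \<open>nome z0\<close>.\<close>
  define F where "F = exp (- (4 * pi / 100)) * (y / y') ^ 6"
  have F: "F < 1"
  proof -
    have "y / y' \<le> 1 + 2/100" using y45 by (simp add: y'_def field_simps)
    also have "\<dots> < 1 + 4 * pi / 600" using pi_gt3 by simp
    also have "\<dots> \<le> exp (4 * pi / 600)" by (rule exp_ge_add_one_self)
    finally have "(y / y') ^ 6 < exp (4 * pi / 600) ^ 6"
      using y' y45 by (intro power_strict_mono) auto
    also have "\<dots> = exp (4 * pi / 100)" by (simp flip: exp_of_nat_mult)
    finally have "F < exp (- (4 * pi / 100)) * exp (4 * pi / 100)"
      unfolding F_def by (rule mult_strict_left_mono) simp
    then show ?thesis by (simp flip: exp_add)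
  qed
  let ?r = "exp (- 2 * pi * y')"
  have "?r < 1" using y' by simp
  then have sub: "cball (0::complex) ?r \<subseteq> ball 0 1" unfolding cball_subset_ball_iff by simp
  have "norm (g (nome z0)) \<le> F * norm (g (nome z0))"
  proof (rule maximum_modulus_frontier[where f = g and \<xi> = "nome z0" and S = "cball 0 ?r"])
    show "g holomorphic_on interior (cball 0 ?r)"
      by (rule holomorphic_on_subset[OF g]) (use sub interior_subset in blast)
    show "continuous_on (closure (cball 0 ?r)) g"
      by (rule holomorphic_on_imp_continuous_on, rule holomorphic_on_subset[OF g]) (use sub in auto)
    show "nome z0 \<in> cball 0 ?r" by (simp add: norm_nome y'_def flip: y_def)
    fix q assume "q \<in> frontier (cball (0::complex) ?r)"
    then have q: "norm q = ?r" by (simp add: frontier_cball)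
    then have "q \<noteq> 0" by auto
    then obtain w where w: "nome w = q" "Im w = - ln (norm q) / (2 * pi)"
      using exists_nome by blast
    have Iw: "Im w = y'" unfolding w q by simp
    have sq: "norm (nome u) ^ 2 = exp (- 4 * pi * Im u)" for u
      unfolding norm_nome exp_of_nat_mult[symmetric] by simp
    have "M w \<le> M z0" using max[of w] Iw y' Mz0 by simp
    then have "exp (- 4 * pi * y') * norm (g q) * y' ^ 6 \<le> exp (- 4 * pi * y) * norm (g (nome z0)) * y ^ 6"
      unfolding M_def using fg[of w] fg[of z0] Iw y' y sq[of w] sq[of z0]
      by (simp add: y_def norm_mult norm_power w(1))
    moreover have "exp (- 4 * pi * y) = exp (- 4 * pi * y') * exp (- (4 * pi / 100))"
      by (simp add: y'_def algebra_simps flip: exp_add)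
    ultimately have "exp (- 4 * pi * y') * (norm (g q) * y' ^ 6) \<le>
        exp (- 4 * pi * y') * (exp (- (4 * pi / 100)) * y ^ 6 * norm (g (nome z0)))"
      by (simp add: mult_ac)
    then have "norm (g q) * y' ^ 6 \<le> exp (- (4 * pi / 100)) * y ^ 6 * norm (g (nome z0))" by simp
    then show "norm (g q) \<le> F * norm (g (nome z0))"
      unfolding F_def using y' by (simp add: power_divide field_simps)
  qed auto
  moreover have "norm (g (nome z0)) > 0"
    using Mpos fg[of z0] y by (auto simp: M_def y_def)
  ultimately show False using F by (simp add: mult_le_cancel_right2)
qed

section \<open>Derivatives of modular forms and their brackets\<close>

definition tpi :: complex where "tpi = 2 * of_real pi * \<i>"

lemma tpi_nonzero [simp]: "tpi \<noteq> 0" by (simp add: tpi_def)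

lemma tpi_square: "tpi ^ 2 = - 4 * of_real pi ^ 2"
  by (simp add: tpi_def power_mult_distrib)

lemma E4_holomorphic: "E4 holomorphic_on upper_half_plane"
proof -
  have "(\<lambda>z. e4 (nome z)) holomorphic_on upper_half_plane"
    by (rule holomorphic_on_compose_gen[unfolded o_def, where t = "ball 0 1" and f = nome])
      (auto intro!: holomorphic_intros simp: norm_nome_less_1_iff)
  then show ?thesis by (rule holomorphic_transform) (simp add: E4_eq_e4)
qed

lemma E6_holomorphic: "E6 holomorphic_on upper_half_plane"
proof -
  have "(\<lambda>z. e6 (nome z)) holomorphic_on upper_half_plane"
    by (rule holomorphic_on_compose_gen[unfolded o_def, where t = "ball 0 1" and f = nome])
      (auto intro!: holomorphic_intros simp: norm_nome_less_1_iff)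
  then show ?thesis by (rule holomorphic_transform) (simp add: E6_eq_e6)
qed

lemma has_deriv_upper:
  assumes "f holomorphic_on upper_half_plane" "Im z > 0"
  shows "(f has_field_derivative deriv f z) (at z)"
  using assms holomorphic_derivI[OF assms(1)] by simp

lemma deriv_holomorphic_upper:
  assumes "f holomorphic_on upper_half_plane"
  shows "deriv f holomorphic_on upper_half_plane"
  using assms by (intro holomorphic_deriv) auto

lemma mobius_derivative:
  assumes "a * d - b * c = 1" "Im z > 0"
  shows "(mobius a b c d has_field_derivative 1 / (of_int c * z + of_int d) ^ 2) (at z)"
proof -
  have J: "of_int c * z + of_int d \<noteq> 0" using mobius_denom_nonzero[OF assms] .
  have "(of_int a :: complex) * of_int d - of_int b * of_int c = of_int (a * d - b * c)" by simp
  then have "(of_int a :: complex) * of_int d - of_int b * of_int c = 1" using assms(1) by simp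
  then have eq: "of_int a * (of_int c * z + of_int d) - (of_int a * z + of_int b) * of_int c = 1"
    by algebra
  show ?thesis
    unfolding mobius_def using J eq
    by (auto intro!: derivative_eq_intros simp: power2_eq_square)
qed

lemma deriv_mobius_weight:
  assumes f: "f holomorphic_on upper_half_plane"
    and mob: "\<And>z. Im z > 0 \<Longrightarrow> f (mobius a b c d z) = (of_int c * z + of_int d) ^ k * f z"
    and det: "a * d - b * c = 1" and z: "Im z > 0"
  shows "deriv f (mobius a b c d z) = (of_int c * z + of_int d) ^ (k + 2) * deriv f z +
    of_nat k * of_int c * (of_int c * z + of_int d) ^ (k + 1) * f z"
proof -
  define J where "J = of_int c * z + of_int d"
  have J: "J \<noteq> 0" using mobius_denom_nonzero[OF det z] by (simp add: J_def)
  have "((\<lambda>z. f (mobius a b c d z)) has_field_derivative deriv f (mobius a b c d z) * (1 / J ^ 2)) (at z)"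
    using DERIV_chain2[OF has_deriv_upper[OF f Im_mobius_pos[OF det z]] mobius_derivative[OF det z]]
    by (simp add: J_def)
  moreover have "((\<lambda>z. f (mobius a b c d z)) has_field_derivative
      J ^ k * deriv f z + of_nat k * J ^ (k - 1) * of_int c * f z) (at z)"
  proof (rule has_field_derivative_transform_within_open[OF _ open_upper_half_plane])
    show "((\<lambda>z. (of_int c * z + of_int d) ^ k * f z) has_field_derivative
      J ^ k * deriv f z + of_nat k * J ^ (k - 1) * of_int c * f z) (at z)"
      by (auto intro!: derivative_eq_intros has_deriv_upper[OF f z] simp: J_def)
  qed (use z mob in auto)
  ultimately have "deriv f (mobius a b c d z) * (1 / J ^ 2) = J ^ k * deriv f z + of_nat k * J ^ (k - 1) * of_int c * f z"
    by (rule DERIV_unique)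
  then have "deriv f (mobius a b c d z) = J ^ 2 * (J ^ k * deriv f z + of_nat k * J ^ (k - 1) * of_int c * f z)"
    using J by (simp add: field_simps)
  then show ?thesis
    unfolding J_def[symmetric] by (cases k) (simp_all add: power2_eq_square algebra_simps)
qed

lemma deriv_through_nome:
  assumes F: "\<And>z. Im z > 0 \<Longrightarrow> F z = h (nome z)" and h: "h holomorphic_on ball 0 1" and z: "Im z > 0"
  shows "deriv F z = tpi * (nome z * deriv h (nome z))"
proof -
  have "nome z \<in> ball 0 1" using z by (simp add: norm_nome_less_1_iff)
  then have "(h has_field_derivative deriv h (nome z)) (at (nome z))"
    using holomorphic_derivI[OF h] by simp
  from DERIV_chain2[OF this nome_derivative]
  have "(F has_field_derivative deriv h (nome z) * (2 * of_real pi * \<i> * nome z)) (at z)"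
    by (rule has_field_derivative_transform_within_open[OF _ open_upper_half_plane]) (use z F in auto)
  then show ?thesis by (simp add: DERIV_imp_deriv tpi_def)
qed

text \<open>This is \<open>1728 \<Delta>\<close>.\<close>

definition discr :: "complex \<Rightarrow> complex" where "discr z = E4 z ^ 3 - E6 z ^ 2"

lemma discr_holomorphic: "discr holomorphic_on upper_half_plane"
  unfolding discr_def by (intro holomorphic_intros E4_holomorphic E6_holomorphic)

lemma discr_mobius:
  assumes "a * d - b * c = 1" "Im z > 0"
  shows "discr (mobius a b c d z) = (of_int c * z + of_int d) ^ 12 * discr z"
  unfolding discr_def E4_mobius[OF assms] E6_mobius[OF assms]
  by (simp add: power_mult_distrib right_diff_distrib flip: power_mult)

text \<open>The left-hand sides below are Rankin-Cohen brackets, hence modular of weight 12 although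
  derivatives of modular forms are not modular.\<close>

lemma bracket_E4_E6:
  assumes "Im z > 0"
  shows "4 * E4 z * deriv E6 z - 6 * E6 z * deriv E4 z = - 2 * tpi * discr z"
proof -
  define f where "f z = 4 * E4 z * deriv E6 z - 6 * E6 z * deriv E4 z + 2 * tpi * discr z" for z
  \<comment> \<open>\<open>tpi * h\<close> is f in the variable q. Its coefficient of q is 4 *
    (-504) - 6 * 240 + 2 * 1728 = 0, which fixes the multiple of \<open>discr\<close> to be
    added.\<close>
  define h where "h q = 4 * e4 q * (q * deriv e6 q) - 6 * e6 q * (q * deriv e4 q) + 2 * (e4 q ^ 3 - e6 q ^ 2)" for q
  have e: "e4 holomorphic_on ball 0 1" "e6 holomorphic_on ball 0 1"
    "deriv e4 holomorphic_on ball 0 1" "deriv e6 holomorphic_on ball 0 1"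
    by (auto intro!: holomorphic_intros)
  have d: "(e4 has_field_derivative 240) (at 0)" "(e6 has_field_derivative -504) (at 0)"
    "(deriv e4 has_field_derivative deriv (deriv e4) 0) (at 0)"
    "(deriv e6 has_field_derivative deriv (deriv e6) 0) (at 0)"
    using holomorphic_derivI[OF e(1), of 0] holomorphic_derivI[OF e(2), of 0]
      holomorphic_derivI[OF e(3), of 0] holomorphic_derivI[OF e(4), of 0]
    by (simp_all add: deriv_e4_0 deriv_e6_0)
  have "h holomorphic_on ball 0 1"
    unfolding h_def by (intro holomorphic_intros e)
  moreover have "h 0 = 0" by (simp add: h_def)
  moreover have "(h has_field_derivative 0) (at 0)"
    unfolding h_def[abs_def]
    by (auto intro!: derivative_eq_intros d simp: deriv_e4_0 deriv_e6_0)
  then have "deriv h 0 = 0" by (rule DERIV_imp_deriv)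
  ultimately obtain g where g: "g holomorphic_on ball 0 1" "\<And>q. h q = q ^ 2 * g q"
    using holomorphic_double_zero[of h 1] by auto
  have "f z = 0"
  proof (rule weight_12_double_zero_vanishes[of f "\<lambda>q. tpi * g q"])
    show "f holomorphic_on upper_half_plane"
      unfolding f_def by (intro holomorphic_intros E4_holomorphic E6_holomorphic discr_holomorphic
          deriv_holomorphic_upper)
    show "(\<lambda>q. tpi * g q) holomorphic_on ball 0 1" by (intro holomorphic_intros g)
    fix z :: complex assume z: "Im z > 0"
    have d4: "deriv E4 z = tpi * (nome z * deriv e4 (nome z))"
      by (rule deriv_through_nome[where h = e4 and F = E4, OF E4_eq_e4 e(1) z])
    have d6: "deriv E6 z = tpi * (nome z * deriv e6 (nome z))"
      by (rule deriv_through_nome[where h = e6 and F = E6, OF E6_eq_e6 e(2) z])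
    have "f z = tpi * h (nome z)"
      unfolding f_def h_def d4 d6 discr_def E4_eq_e4[OF z] E6_eq_e6[OF z]
      by (simp add: algebra_simps)
    then show "f z = nome z ^ 2 * (tpi * g (nome z))" using g(2) by simp
    fix a b c d :: int assume det: "a * d - b * c = 1"
    define J where "J = of_int c * z + of_int d"
    have d4: "deriv E4 (mobius a b c d z) = J ^ 6 * deriv E4 z + 4 * of_int c * J ^ 5 * E4 z"
      using deriv_mobius_weight[where f = E4 and k = 4, OF E4_holomorphic E4_mobius[OF det] det z]
      by (simp add: J_def)
    have d6: "deriv E6 (mobius a b c d z) = J ^ 8 * deriv E6 z + 6 * of_int c * J ^ 7 * E6 z"
      using deriv_mobius_weight[where f = E6 and k = 6, OF E6_holomorphic E6_mobius[OF det] det z]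
      by (simp add: J_def)
    show "f (mobius a b c d z) = (of_int c * z + of_int d) ^ 12 * f z"
      unfolding f_def d4 d6 E4_mobius[OF det z] E6_mobius[OF det z] discr_mobius[OF det z] J_def[symmetric]
      by (simp add: eval_nat_numeral algebra_simps)
  qed (use assms in auto)
  then show ?thesis by (simp add: f_def add_eq_0_iff)
qed

lemma deriv_deriv_mobius_weight:
  assumes f: "f holomorphic_on upper_half_plane"
    and mob: "\<And>z. Im z > 0 \<Longrightarrow> f (mobius a b c d z) = (of_int c * z + of_int d) ^ k * f z"
    and det: "a * d - b * c = 1" and z: "Im z > 0"
  shows "deriv (deriv f) (mobius a b c d z) = (of_int c * z + of_int d) ^ (k + 4) * deriv (deriv f) z +
    2 * of_nat (k + 1) * of_int c * (of_int c * z + of_int d) ^ (k + 3) * deriv f z +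
    of_nat k * of_nat (k + 1) * of_int c ^ 2 * (of_int c * z + of_int d) ^ (k + 2) * f z"
proof -
  define J where "J = of_int c * z + of_int d"
  have J: "J \<noteq> 0" using mobius_denom_nonzero[OF det z] by (simp add: J_def)
  note f' = deriv_holomorphic_upper[OF f]
  have "((\<lambda>z. deriv f (mobius a b c d z)) has_field_derivative deriv (deriv f) (mobius a b c d z) * (1 / J ^ 2)) (at z)"
    using DERIV_chain2[OF has_deriv_upper[OF f' Im_mobius_pos[OF det z]] mobius_derivative[OF det z]]
    by (simp add: J_def)
  moreover have "((\<lambda>z. deriv f (mobius a b c d z)) has_field_derivative
      J ^ (k + 2) * deriv (deriv f) z + of_nat (k + 2) * J ^ (k + 1) * of_int c * deriv f z +
      of_nat k * of_int c * (J ^ (k + 1) * deriv f z + of_nat (k + 1) * J ^ k * of_int c * f z)) (at z)"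
  proof (rule has_field_derivative_transform_within_open[OF _ open_upper_half_plane])
    show "((\<lambda>z. (of_int c * z + of_int d) ^ (k + 2) * deriv f z +
        of_nat k * of_int c * (of_int c * z + of_int d) ^ (k + 1) * f z) has_field_derivative
      J ^ (k + 2) * deriv (deriv f) z + of_nat (k + 2) * J ^ (k + 1) * of_int c * deriv f z +
      of_nat k * of_int c * (J ^ (k + 1) * deriv f z + of_nat (k + 1) * J ^ k * of_int c * f z)) (at z)"
      by (rule derivative_eq_intros has_deriv_upper[OF f z] has_deriv_upper[OF f' z] refl)+
        (simp add: J_def algebra_simps)
  qed (use z deriv_mobius_weight[OF f mob det] in auto)
  ultimately have "deriv (deriv f) (mobius a b c d z) * (1 / J ^ 2) =
      J ^ (k + 2) * deriv (deriv f) z + of_nat (k + 2) * J ^ (k + 1) * of_int c * deriv f z +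
      of_nat k * of_int c * (J ^ (k + 1) * deriv f z + of_nat (k + 1) * J ^ k * of_int c * f z)"
    by (rule DERIV_unique)
  then have "deriv (deriv f) (mobius a b c d z) = J ^ 2 *
      (J ^ (k + 2) * deriv (deriv f) z + of_nat (k + 2) * J ^ (k + 1) * of_int c * deriv f z +
      of_nat k * of_int c * (J ^ (k + 1) * deriv f z + of_nat (k + 1) * J ^ k * of_int c * f z))"
    using J by (simp add: field_simps)
  then show ?thesis
    unfolding J_def[symmetric] by (simp add: eval_nat_numeral power_add algebra_simps)
qed

lemma bracket_E4_E4:
  assumes "Im z > 0"
  shows "4 * E4 z * deriv (deriv E4) z - 5 * deriv E4 z ^ 2 = 5/9 * tpi ^ 2 * discr z"
proof -
  define f where "f z = 4 * E4 z * deriv (deriv E4) z - 5 * deriv E4 z ^ 2 - 5/9 * tpi ^ 2 * discr z" for z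
  define k where "k q = q * deriv e4 q" for q
  \<comment> \<open>Here the coefficient of q is 4 * 240 - 5/9 * 1728 = 0; this is the origin of
    5/9.\<close>
  define h where "h q = 4 * e4 q * (q * deriv k q) - 5 * k q ^ 2 - 5/9 * (e4 q ^ 3 - e6 q ^ 2)" for q
  have e: "e4 holomorphic_on ball 0 1" "e6 holomorphic_on ball 0 1" "deriv e4 holomorphic_on ball 0 1"
    by (auto intro!: holomorphic_intros)
  have k: "k holomorphic_on ball 0 1" unfolding k_def by (intro holomorphic_intros e)
  have k': "deriv k holomorphic_on ball 0 1" by (intro holomorphic_deriv k) auto
  have d: "(e4 has_field_derivative 240) (at 0)" "(e6 has_field_derivative -504) (at 0)"
    "(deriv e4 has_field_derivative deriv (deriv e4) 0) (at 0)"
    "(deriv k has_field_derivative deriv (deriv k) 0) (at 0)"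
    using holomorphic_derivI[OF e(1), of 0] holomorphic_derivI[OF e(2), of 0]
      holomorphic_derivI[OF e(3), of 0] holomorphic_derivI[OF k', of 0]
    by (simp_all add: deriv_e4_0 deriv_e6_0)
  have dk: "(k has_field_derivative 240) (at 0)"
    unfolding k_def[abs_def] by (auto intro!: derivative_eq_intros d simp: deriv_e4_0)
  then have k1: "deriv k 0 = 240" by (rule DERIV_imp_deriv)
  have k0: "k 0 = 0" by (simp add: k_def)
  have "h holomorphic_on ball 0 1"
    unfolding h_def by (intro holomorphic_intros e k k')
  moreover have "h 0 = 0" by (simp add: h_def k0)
  moreover have "(h has_field_derivative 0) (at 0)"
    unfolding h_def[abs_def]
    by (auto intro!: derivative_eq_intros d dk simp: k1 k0)
  then have "deriv h 0 = 0" by (rule DERIV_imp_deriv)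
  ultimately obtain g where g: "g holomorphic_on ball 0 1" "\<And>q. h q = q ^ 2 * g q"
    using holomorphic_double_zero[of h 1] by auto
  have "f z = 0"
  proof (rule weight_12_double_zero_vanishes[of f "\<lambda>q. tpi ^ 2 * g q"])
    show "f holomorphic_on upper_half_plane"
      unfolding f_def by (intro holomorphic_intros E4_holomorphic E6_holomorphic discr_holomorphic
          deriv_holomorphic_upper)
    show "(\<lambda>q. tpi ^ 2 * g q) holomorphic_on ball 0 1" by (intro holomorphic_intros g)
    fix z :: complex assume z: "Im z > 0"
    have d1: "deriv E4 w = tpi * k (nome w)" if "Im w > 0" for w
      unfolding k_def by (rule deriv_through_nome[OF E4_eq_e4 e(1) that])
    have d2: "deriv (deriv E4) z = tpi * (nome z * deriv (\<lambda>q. tpi * k q) (nome z))"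
      by (rule deriv_through_nome[where h = "\<lambda>q. tpi * k q" and F = "deriv E4", OF d1 _ z])
        (auto intro!: holomorphic_intros k)
    have "(k has_field_derivative deriv k (nome z)) (at (nome z))"
      using holomorphic_derivI[OF k, of "nome z"] z by (simp add: norm_nome_less_1_iff)
    then have "deriv (\<lambda>q. tpi * k q) (nome z) = tpi * deriv k (nome z)"
      by (intro DERIV_imp_deriv DERIV_cmult)
    then have "f z = tpi ^ 2 * h (nome z)"
      unfolding f_def h_def d2 d1[OF z] discr_def E4_eq_e4[OF z] E6_eq_e6[OF z]
      by (simp add: algebra_simps power2_eq_square)
    then show "f z = nome z ^ 2 * (tpi ^ 2 * g (nome z))" using g(2) by simp
    fix a b c d :: int assume det: "a * d - b * c = 1"
    define J where "J = of_int c * z + of_int d"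
    have d4: "deriv E4 (mobius a b c d z) = J ^ 6 * deriv E4 z + 4 * of_int c * J ^ 5 * E4 z"
      using deriv_mobius_weight[where f = E4 and k = 4, OF E4_holomorphic E4_mobius[OF det] det z]
      by (simp add: J_def)
    have d44: "deriv (deriv E4) (mobius a b c d z) =
        J ^ 8 * deriv (deriv E4) z + 10 * of_int c * J ^ 7 * deriv E4 z + 20 * of_int c ^ 2 * J ^ 6 * E4 z"
      using deriv_deriv_mobius_weight[where f = E4 and k = 4, OF E4_holomorphic E4_mobius[OF det] det z]
      by (simp add: J_def)
    show "f (mobius a b c d z) = (of_int c * z + of_int d) ^ 12 * f z"
      unfolding f_def d4 d44 E4_mobius[OF det z] discr_mobius[OF det z] J_def[symmetric]
      by (simp add: eval_nat_numeral algebra_simps)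
  qed (use assms in auto)
  then show ?thesis by (simp add: f_def)
qed

section \<open>Zeros of the discriminant\<close>

lemma connected_upper_half_plane: "connected upper_half_plane"
  by (simp add: convex_connected convex_upper_half_plane)

lemma discr_not_zero: obtains z where "Im z > 0" "discr z \<noteq> 0"
proof (rule ccontr)
  assume "\<not> thesis"
  then have 0: "discr z = 0" if "Im z > 0" for z using that \<open>\<And>z. 0 < Im z \<Longrightarrow> discr z \<noteq> 0 \<Longrightarrow> thesis\<close> by blast
  define h where "h q = e4 q ^ 3 - e6 q ^ 2" for q
  have h0: "h q = 0" if "q \<in> ball 0 1" for q
  proof (cases "q = 0")
    case False
    then obtain z where "nome z = q" using exists_nome by blast
    then show ?thesis
      using 0[of z] that E4_eq_e4[of z] E6_eq_e6[of z] norm_nome_less_1_iff[of z] by (simp add: discr_def h_def)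
  qed (simp add: h_def)
  have e: "e4 holomorphic_on ball 0 1" "e6 holomorphic_on ball 0 1"
    by (auto intro!: holomorphic_intros)
  have d: "(e4 has_field_derivative 240) (at 0)" "(e6 has_field_derivative -504) (at 0)"
    using holomorphic_derivI[OF e(1), of 0] holomorphic_derivI[OF e(2), of 0]
    by (simp_all add: deriv_e4_0 deriv_e6_0)
  \<comment> \<open>The coefficient of q is 1728 = 3 * 240 + 2 * 504.\<close>
  have "(h has_field_derivative 1728) (at 0)"
    unfolding h_def[abs_def] by (auto intro!: derivative_eq_intros d)
  moreover have "(h has_field_derivative 0) (at 0)"
    by (rule has_field_derivative_transform_within_open[where f = "\<lambda>_. 0" and S = "ball 0 1"])
      (use h0 in auto)
  ultimately have "1728 = (0::complex)" by (rule DERIV_unique)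
  then show False by simp
qed

lemma E4_not_zero: obtains z where "Im z > 0" "E4 z \<noteq> 0"
proof -
  obtain z where z: "Im z > 0" "discr z \<noteq> 0" using discr_not_zero .
  show ?thesis
  proof (rule ccontr)
    assume "\<not> thesis"
    then have 0: "E4 z = 0" if "Im z > 0" for z using \<open>\<And>z. 0 < Im z \<Longrightarrow> E4 z \<noteq> 0 \<Longrightarrow> thesis\<close> that by blast
    have "(E4 has_field_derivative 0) (at z)"
      by (rule has_field_derivative_transform_within_open[where f = "\<lambda>_. 0" and S = upper_half_plane])
        (use 0 z in auto)
    then have "deriv E4 z = 0" by (rule DERIV_imp_deriv)
    with bracket_E4_E6[OF z(1)] 0[OF z(1)] z show False by simp
  qed
qed

lemma deriv_discr:
  assumes "Im z > 0"
  shows "deriv discr z = 3 * E4 z ^ 2 * deriv E4 z - 2 * E6 z * deriv E6 z"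
  unfolding discr_def[abs_def]
  by (rule DERIV_imp_deriv)
    (auto intro!: derivative_eq_intros has_deriv_upper[OF E4_holomorphic assms] has_deriv_upper[OF E6_holomorphic assms])

text \<open>One derivative is eliminated between the bracket and the derivative of E4^3 - E6^2. Once
  \<open>E2\<close> is defined as a logarithmic derivative of \<open>discr\<close>, this and the
  next lemma are Ramanujan's equations for \<open>E4\<close> and \<open>E6\<close>, still free of
  denominators.\<close>

lemma E4_times_deriv_discr:
  assumes "Im z > 0"
  shows "E4 z * deriv discr z = discr z * (3 * deriv E4 z + tpi * E6 z)"
  using bracket_E4_E6[OF assms] unfolding deriv_discr[OF assms] discr_def by algebra

lemma E6_times_deriv_discr:
  assumes "Im z > 0"
  shows "E6 z * deriv discr z = discr z * (2 * deriv E6 z + tpi * E4 z ^ 2)"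
  using bracket_E4_E6[OF assms] unfolding deriv_discr[OF assms] discr_def by algebra

text \<open>This bracket of \<open>discr\<close> with itself has weight 28. It is derived, not
  compared with a cusp form: differentiating \<open>E4_times_deriv_discr\<close> and eliminating
  E4'' and E6' by the two earlier brackets gives E4^2 times the claim, and the identity theorem
  removes the factor.\<close>

lemma bracket_discr_discr:
  assumes "Im z > 0"
  shows "12 * discr z * deriv (deriv discr) z - 13 * deriv discr z ^ 2 + tpi ^ 2 * E4 z * discr z ^ 2 = 0"
proof -
  define F where "F z = 12 * discr z * deriv (deriv discr) z - 13 * deriv discr z ^ 2 + tpi ^ 2 * E4 z * discr z ^ 2" for z
  note holo = E4_holomorphic E6_holomorphic discr_holomorphic
  have F: "F holomorphic_on upper_half_plane"
    unfolding F_def by (intro holomorphic_intros holo deriv_holomorphic_upper)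
  have main: "F z = 0" if z: "Im z > 0" and nz: "E4 z \<noteq> 0" for z
  proof -
    have "((\<lambda>z. E4 z * deriv discr z) has_field_derivative
        deriv E4 z * deriv discr z + E4 z * deriv (deriv discr) z) (at z)"
      by (auto intro!: derivative_eq_intros has_deriv_upper holo deriv_holomorphic_upper z)
    moreover have "((\<lambda>z. E4 z * deriv discr z) has_field_derivative
        deriv discr z * (3 * deriv E4 z + tpi * E6 z) + discr z * (3 * deriv (deriv E4) z + tpi * deriv E6 z)) (at z)"
    proof (rule has_field_derivative_transform_within_open[OF _ open_upper_half_plane])
      show "((\<lambda>z. discr z * (3 * deriv E4 z + tpi * E6 z)) has_field_derivative
        deriv discr z * (3 * deriv E4 z + tpi * E6 z) + discr z * (3 * deriv (deriv E4) z + tpi * deriv E6 z)) (at z)"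
        by (auto intro!: derivative_eq_intros has_deriv_upper holo deriv_holomorphic_upper z)
    qed (use z E4_times_deriv_discr in auto)
    ultimately have eq: "deriv E4 z * deriv discr z + E4 z * deriv (deriv discr) z =
        deriv discr z * (3 * deriv E4 z + tpi * E6 z) + discr z * (3 * deriv (deriv E4) z + tpi * deriv E6 z)"
      by (rule DERIV_unique)
    have alg: "E ^ 2 * (12 * D * Y - 13 * X ^ 2 + t ^ 2 * E * D ^ 2) = 0"
      if "a * X + E * Y = X * (3 * a + t * G) + D * (3 * aa + t * b)" "E * X = D * (3 * a + t * G)"
        "4 * E * aa - 5 * a ^ 2 = 5/9 * t ^ 2 * D" "4 * E * b - 6 * G * a = - 2 * t * D" "D = E ^ 3 - G ^ 2"
      for a aa b t D E G X Y :: complex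
    proof -
      have "9 * (4 * E * aa - 5 * a ^ 2) = 5 * t ^ 2 * D" using that(3) by simp
      with that(1,2,4,5) show ?thesis by algebra
    qed
    have "E4 z ^ 2 * F z = 0"
      unfolding F_def by (rule alg[OF eq E4_times_deriv_discr[OF z] bracket_E4_E4[OF z] bracket_E4_E6[OF z] discr_def])
    then show ?thesis using nz by simp
  qed
  define S where "S = {z \<in> upper_half_plane. E4 z \<noteq> 0}"
  have "open S"
    unfolding S_def
    using continuous_open_preimage[OF holomorphic_on_imp_continuous_on[OF E4_holomorphic] open_upper_half_plane, of "- {0}"]
      open_Compl[OF closed_singleton, of "0::complex"]
    by (simp add: vimage_def Int_def)
  moreover have "S \<noteq> {}" using E4_not_zero by (auto simp: S_def)
  ultimately have "F z = 0"
    by (rule analytic_continuation_open[OF _ open_upper_half_plane _ connected_upper_half_plane _ F holomorphic_on_const])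
      (use assms main in \<open>auto simp: S_def\<close>)
  then show ?thesis by (simp add: F_def)
qed

text \<open>At a zero of order \<open>n > 0\<close> the leading coefficient of the left-hand side of
  \<open>bracket_discr_discr\<close> would be a non-zero multiple of \<open>12 n (n - 1) - 13 n\<^sup>2 = - n (n + 12)\<close>.\<close>

lemma discr_nonzero:
  assumes "Im p > 0"
  shows "discr p \<noteq> 0"
proof
  assume p0: "discr p = 0"
  have "\<not> discr constant_on upper_half_plane"
    using discr_not_zero p0 assms unfolding constant_on_def by (metis upper_half_plane_iff)
  then obtain g r n where *: "0 < n" "0 < r" "ball p r \<subseteq> upper_half_plane" "g holomorphic_on ball p r"
    "\<And>w. w \<in> ball p r \<Longrightarrow> discr w = (w - p) ^ n * g w" "\<And>w. w \<in> ball p r \<Longrightarrow> g w \<noteq> 0"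
    using holomorphic_factor_zero_nonconstant[OF discr_holomorphic open_upper_half_plane
        connected_upper_half_plane _ p0] assms by (metis upper_half_plane_iff)
  have g': "deriv g holomorphic_on ball p r" using *(4) open_ball by (rule holomorphic_deriv)
  have g'': "deriv (deriv g) holomorphic_on ball p r" using g' open_ball by (rule holomorphic_deriv)
  have dg: "(g has_field_derivative deriv g w) (at w)"
    "(deriv g has_field_derivative deriv (deriv g) w) (at w)" if "w \<in> ball p r" for w
    using holomorphic_derivI[OF *(4) open_ball that] holomorphic_derivI[OF g' open_ball that] by auto
  have D1: "(w - p) * deriv discr w = (w - p) ^ n * (of_nat n * g w + (w - p) * deriv g w)"
    if w: "w \<in> ball p r" for w
  proof -
    have "(discr has_field_derivative of_nat n * (w - p) ^ (n - 1) * g w + (w - p) ^ n * deriv g w) (at w)"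
      by (rule has_field_derivative_transform_within_open[OF _ open_ball w, where f = "\<lambda>w. (w - p) ^ n * g w"])
        (use *(5) in \<open>auto intro!: derivative_eq_intros dg w\<close>)
    then have "deriv discr w = of_nat n * (w - p) ^ (n - 1) * g w + (w - p) ^ n * deriv g w"
      by (rule DERIV_imp_deriv)
    then show ?thesis using *(1) by (cases n) (auto simp: distrib_left distrib_right mult_ac)
  qed
  have D2: "(w - p) ^ 2 * deriv (deriv discr) w + (w - p) * deriv discr w =
      (w - p) ^ n * (of_nat n * (of_nat n * g w + (w - p) * deriv g w) +
        (w - p) * (of_nat n * deriv g w + deriv g w + (w - p) * deriv (deriv g) w))"
    if w: "w \<in> ball p r" for w
  proof -
    have "((\<lambda>w. (w - p) * deriv discr w) has_field_derivative
        of_nat n * (w - p) ^ (n - 1) * (of_nat n * g w + (w - p) * deriv g w) +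
        (w - p) ^ n * (of_nat n * deriv g w + deriv g w + (w - p) * deriv (deriv g) w)) (at w)"
      by (rule has_field_derivative_transform_within_open[OF _ open_ball w,
            where f = "\<lambda>w. (w - p) ^ n * (of_nat n * g w + (w - p) * deriv g w)"])
        (use D1 in \<open>auto intro!: derivative_eq_intros dg w\<close>)
    moreover have "((\<lambda>w. (w - p) * deriv discr w) has_field_derivative
        deriv discr w + (w - p) * deriv (deriv discr) w) (at w)"
      using *(3) w by (auto intro!: derivative_eq_intros has_deriv_upper deriv_holomorphic_upper discr_holomorphic)
    ultimately have "deriv discr w + (w - p) * deriv (deriv discr) w =
        of_nat n * (w - p) ^ (n - 1) * (of_nat n * g w + (w - p) * deriv g w) +
        (w - p) ^ n * (of_nat n * deriv g w + deriv g w + (w - p) * deriv (deriv g) w)"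
      by (rule DERIV_unique[rotated])
    then have "(w - p) * (deriv discr w + (w - p) * deriv (deriv discr) w) =
        (w - p) * (of_nat n * (w - p) ^ (n - 1) * (of_nat n * g w + (w - p) * deriv g w) +
        (w - p) ^ n * (of_nat n * deriv g w + deriv g w + (w - p) * deriv (deriv g) w))" by simp
    then show ?thesis using *(1) by (cases n) (auto simp: algebra_simps power2_eq_square)
  qed
  \<comment> \<open>With \<theta> = (w - p) d/dw, the functions A and B are \<theta> discr and
    \<theta>^2 discr divided by (w - p)^n. So L is the bracket times (w - p)^2 / (w - p)^(2 n),
    continued to w = p, where A = N g and B = N^2 g.\<close>
  define N :: complex where "N = of_nat n"
  define A where "A w = N * g w + (w - p) * deriv g w" for w
  define B where "B w = N * A w + (w - p) * (N * deriv g w + deriv g w + (w - p) * deriv (deriv g) w)" for w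
  define L where "L w = 12 * g w * (B w - A w) - 13 * A w ^ 2 + tpi ^ 2 * E4 w * (w - p) ^ 2 * g w ^ 2" for w
  have L0: "L w = 0" if w: "w \<in> ball p r - {p}" for w
  proof -
    have wp: "w - p \<noteq> 0" "w \<in> ball p r" using w by auto
    then have Iw: "Im w > 0" using *(3) by auto
    define T where "T = (w - p) ^ n"
    have T: "T \<noteq> 0" using wp by (simp add: T_def)
    have d0: "discr w = T * g w" using *(5)[OF wp(2)] by (simp add: T_def)
    have d1: "(w - p) * deriv discr w = T * A w" using D1[OF wp(2)] by (simp add: T_def A_def N_def)
    have d2: "(w - p) ^ 2 * deriv (deriv discr) w + (w - p) * deriv discr w = T * B w"
      using D2[OF wp(2)] by (simp add: T_def A_def B_def N_def)
    have "T ^ 2 * L w = (w - p) ^ 2 * (12 * discr w * deriv (deriv discr) w - 13 * deriv discr w ^ 2 + tpi ^ 2 * E4 w * discr w ^ 2)"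
      using d0 d1 d2 unfolding L_def by algebra
    then show ?thesis using bracket_discr_discr[OF Iw] T by simp
  qed
  have hE: "E4 holomorphic_on ball p r" using E4_holomorphic *(3) by (rule holomorphic_on_subset)
  have "L holomorphic_on ball p r"
    unfolding L_def B_def A_def by (intro holomorphic_intros *(4) g' g'' hE)
  then have "continuous_on (ball p r) L" by (rule holomorphic_on_imp_continuous_on)
  then have "isCont L p" using *(2) by (simp add: continuous_on_eq_continuous_at)
  then have "(L \<longlongrightarrow> L p) (at p)" by (simp add: isCont_def)
  moreover have "\<forall>\<^sub>F w in at p. L w = 0"
    using *(2) L0 by (auto simp: eventually_at intro!: exI[of _ r] simp: dist_commute)
  then have "(L \<longlongrightarrow> 0) (at p)" by (rule tendsto_eventually)
  ultimately have "L p = 0" using tendsto_unique[OF at_neq_bot] by blast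
  then have "- N * (N + 12) * g p ^ 2 = 0"
    unfolding L_def B_def A_def by (simp add: power2_eq_square algebra_simps)
  moreover have "N \<noteq> 0" using *(1) by (simp add: N_def)
  moreover have "N + 12 = of_nat (n + 12)" by (simp add: N_def)
  then have "N + 12 \<noteq> 0" by (metis of_nat_eq_0_iff add_is_0 zero_neq_numeral)
  ultimately show False using *(6)[of p] *(2) by simp
qed

text \<open>The quasimodular Eisenstein series of weight 2, introduced as \<open>q \<Delta>' / \<Delta>\<close>.\<close>

definition E2 :: "complex \<Rightarrow> complex" where "E2 z = deriv discr z / (tpi * discr z)"

lemma discr_has_derivative:
  assumes "Im z > 0"
  shows "(discr has_field_derivative tpi * (E2 z * discr z)) (at z)"
  using has_deriv_upper[OF discr_holomorphic assms] discr_nonzero[OF assms] by (simp add: E2_def)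

lemma E4_has_derivative:
  assumes "Im z > 0"
  shows "(E4 has_field_derivative tpi * (E2 z * E4 z - E6 z) / 3) (at z)"
proof -
  have "deriv E4 z = tpi * (E2 z * E4 z - E6 z) / 3"
    using E4_times_deriv_discr[OF assms] discr_nonzero[OF assms] by (simp add: E2_def field_simps)
  then show ?thesis using has_deriv_upper[OF E4_holomorphic assms] by (simp only:)
qed

lemma E6_has_derivative:
  assumes "Im z > 0"
  shows "(E6 has_field_derivative tpi * (E2 z * E6 z - E4 z ^ 2) / 2) (at z)"
proof -
  have "deriv E6 z = tpi * (E2 z * E6 z - E4 z ^ 2) / 2"
    using E6_times_deriv_discr[OF assms] discr_nonzero[OF assms] by (simp add: E2_def field_simps)
  then show ?thesis using has_deriv_upper[OF E6_holomorphic assms] by (simp only:)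
qed

text \<open>Ramanujan's third equation: \<open>bracket_discr_discr\<close> with its denominators
  restored, which is legitimate everywhere because \<open>discr\<close> has no zeros.\<close>

lemma E2_has_derivative:
  assumes "Im z > 0"
  shows "(E2 has_field_derivative tpi * (E2 z ^ 2 - E4 z) / 12) (at z)"
proof -
  have nz: "tpi * discr z \<noteq> 0" using discr_nonzero[OF assms] by simp
  have "(E2 has_field_derivative (deriv (deriv discr) z * (tpi * discr z) - deriv discr z * (tpi * deriv discr z)) / ((tpi * discr z) * (tpi * discr z))) (at z)"
    unfolding E2_def[abs_def]
    using nz by (auto intro!: derivative_eq_intros has_deriv_upper deriv_holomorphic_upper discr_holomorphic assms)
  also have "(deriv (deriv discr) z * (tpi * discr z) - deriv discr z * (tpi * deriv discr z)) / ((tpi * discr z) * (tpi * discr z)) =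
      tpi * (E2 z ^ 2 - E4 z) / 12"
  proof -
    have alg: "(Y * (t * D) - X * (t * X)) / ((t * D) * (t * D)) = t * ((X / (t * D)) ^ 2 - E) / 12"
      if "12 * D * Y - 13 * X ^ 2 + t ^ 2 * E * D ^ 2 = 0" "t \<noteq> 0" "D \<noteq> 0" for X Y t D E :: complex
    proof -
      have "12 * (D * Y) - 13 * X ^ 2 + t ^ 2 * E * D ^ 2 = 0" using that(1) by (simp add: mult.assoc)
      then have Y: "D * Y = (13 * X ^ 2 - t ^ 2 * E * D ^ 2) / 12" by (simp add: field_simps)
      have "(Y * (t * D) - X * (t * X)) / ((t * D) * (t * D)) = (D * Y - X ^ 2) / (t * D ^ 2)"
        using that by (simp add: field_simps power2_eq_square)
      also have "\<dots> = t * ((X / (t * D)) ^ 2 - E) / 12"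
        unfolding Y using that by (simp add: field_simps power2_eq_square)
      finally show ?thesis .
    qed
    show ?thesis unfolding E2_def by (rule alg[OF bracket_discr_discr[OF assms]]) (use nz in auto)
  qed
  finally show ?thesis .
qed

text \<open>At a point fixed by an element of the modular group a form vanishes unless the
  automorphy factor is 1. For z -> (z - 1) / z at \<open>rho\<close> the factor is rho^4 = - rho;
  for z -> -1/z at \<open>\<i>\<close>, in the next lemma, it is i^6 = -1.\<close>

lemma E4_rho: "E4 rho = 0" and Im_rho: "Im rho > 0"
proof -
  show I: "Im rho > 0" by (simp add: rho_def)
  have r2: "rho ^ 2 = rho - 1"
    by (simp add: rho_def power2_eq_square complex_eq_iff field_simps)
  have r0: "rho \<noteq> 0" using I by auto
  have "mobius 1 (-1) 1 0 rho = rho"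
    using r2 r0 by (simp add: mobius_def field_simps power2_eq_square)
  then have "E4 rho = rho ^ 4 * E4 rho"
    using E4_mobius[of 1 0 "-1" 1 rho] I by simp
  moreover have "rho ^ 4 = - rho"
    using r2 by algebra
  ultimately have "E4 rho = - (rho * E4 rho)" by simp
  then have "E4 rho + rho * E4 rho = 0" by (rule eq_neg_iff_add_eq_0[THEN iffD1])
  then have "E4 rho * (1 + rho) = 0" by (simp add: distrib_left mult.commute)
  moreover have "1 + rho \<noteq> 0" using I by (auto simp: complex_eq_iff)
  ultimately show "E4 rho = 0" by simp
qed

lemma E6_ii: "E6 \<i> = 0"
proof -
  have "mobius 0 (-1) 1 0 \<i> = \<i>" by (simp add: mobius_def)
  then have "E6 \<i> = \<i> ^ 6 * E6 \<i>"
    using E6_mobius[of 0 0 "-1" 1 \<i>] by simp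
  moreover have "\<i> ^ 6 = (-1::complex)" by (simp add: eval_nat_numeral)
  ultimately show ?thesis by simp
qed

lemma E4_E6_not_both_zero: "Im z > 0 \<Longrightarrow> E4 z = 0 \<Longrightarrow> E6 z \<noteq> 0"
  using discr_nonzero[of z] by (auto simp: discr_def)

section \<open>Pull-back of the hypergeometric equation\<close>

text \<open>\<open>fst (log_coeffs k)\<close> and \<open>snd (log_coeffs k)\<close> are the Taylor coefficients of \<open>A\<close> and \<open>B\<close> for a
  solution \<open>A + B log \<xi>\<close> of the hypergeometric equation with exponents \<open>0\<close> and \<open>n\<close> at \<open>0\<close>; at the
  resonant index \<open>n\<close> the obstruction in the recursion for \<open>A\<close> is absorbed by \<open>B\<close>.\<close>

context
  fixes n :: nat and m P :: real
begin

text \<open>This is (k + a) (k + b) for the hypergeometric parameters with a + b = 1 - n - m and a b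
  = P. It is the numerator in the coefficient recursion, so a zero at some k < n ends the series
  with exponent 0 before the resonance at n.\<close>

definition ind_poly :: "nat \<Rightarrow> real" where
  "ind_poly k = real k ^ 2 + (1 - real n - m) * real k + P"

primrec log_coeffs :: "nat \<Rightarrow> real \<times> real" where
  "log_coeffs 0 = (if n = 0 then (0, 1) else (1, 0))"
| "log_coeffs (Suc k) =
     (let a = fst (log_coeffs k); b = snd (log_coeffs k); D = (real k + 1) * (real k + 1 - real n);
        b' = ind_poly k * b / D in
      if Suc k = n then (0, ind_poly k * a / real n)
      else ((ind_poly k * a - (2 * (real k + 1) - real n) * b' + (2 * real k + 1 - real n - m) * b) / D, b'))"

lemmas log_coeffs_Suc = log_coeffs.simps(2)

declare log_coeffs.simps(2) [simp del]

lemma snd_log_coeffs_below: "k < n \<Longrightarrow> snd (log_coeffs k) = 0"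
  by (induction k) (auto simp: Let_def log_coeffs_Suc)

lemma log_coeffs_rec1:
  "(real k + 1) * (real k + 1 - real n) * snd (log_coeffs (Suc k)) = ind_poly k * snd (log_coeffs k)"
  using snd_log_coeffs_below[of k] by (cases "Suc k = n") (auto simp: Let_def log_coeffs_Suc)

lemma log_coeffs_rec2:
  "(real k + 1) * (real k + 1 - real n) * fst (log_coeffs (Suc k)) =
    ind_poly k * fst (log_coeffs k) - (2 * (real k + 1) - real n) * snd (log_coeffs (Suc k)) +
    (2 * real k + 1 - real n - m) * snd (log_coeffs k)"
proof (cases "Suc k = n")
  case True
  then have "real n = real k + 1" by auto
  with True snd_log_coeffs_below[of k] show ?thesis by (auto simp: Let_def log_coeffs_Suc)
next
  case False
  then have "real k + 1 - real n \<noteq> 0" by linarith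
  with False show ?thesis by (auto simp: Let_def log_coeffs_Suc)
qed

lemma fst_log_coeffs_nonzero:
  assumes "\<And>k. k < n \<Longrightarrow> ind_poly k \<noteq> 0"
  shows "k < n \<Longrightarrow> fst (log_coeffs k) \<noteq> 0"
proof (induction k)
  case (Suc k)
  then have "(real k + 1 - real n) \<noteq> 0" "real k + 1 \<noteq> 0" by linarith+
  with Suc assms[of k] snd_log_coeffs_below[of k] show ?case
    by (auto simp: Let_def log_coeffs_Suc)
qed simp

text \<open>Up to non-zero factors this coefficient is the product of all \<open>ind_poly k\<close>
  with k < n. For n = 0 the exponents coincide and the logarithm is present from the start, with
  coefficient 1.\<close>

lemma snd_log_coeffs_nonzero:
  assumes "\<And>k. k < n \<Longrightarrow> ind_poly k \<noteq> 0"
  shows "snd (log_coeffs n) \<noteq> 0"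
proof (cases n)
  case (Suc k)
  have "snd (log_coeffs (Suc k)) = ind_poly k * fst (log_coeffs k) / real n"
    unfolding log_coeffs_Suc by (simp add: Let_def Suc[symmetric])
  then show ?thesis
    using fst_log_coeffs_nonzero[OF assms, of k] assms[of k] by (simp add: Suc[symmetric]) (simp add: Suc)
next
  case 0
  have "snd (log_coeffs 0) \<noteq> 0" unfolding log_coeffs.simps(1) using 0 by simp
  then show ?thesis unfolding arg_cong[OF 0, of log_coeffs] .
qed

text \<open>The recursion matrix tends to the identity, so every growth factor above 1 is eventually
  a bound; a positive radius of convergence is all that is wanted.\<close>

lemma log_coeffs_growth:
  "\<forall>\<^sub>F k in sequentially. \<bar>fst (log_coeffs (Suc k))\<bar> + \<bar>snd (log_coeffs (Suc k))\<bar> \<le>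
     2 * (\<bar>fst (log_coeffs k)\<bar> + \<bar>snd (log_coeffs k)\<bar>)"
proof -
  define D where "D k = (real k + 1) * (real k + 1 - real n)" for k
  have "(\<lambda>k. ind_poly k / D k) \<longlonglongrightarrow> 1" unfolding ind_poly_def D_def by real_asymp
  then have 1: "\<forall>\<^sub>F k in sequentially. dist (ind_poly k / D k) 1 < 1/4" by (rule tendstoD) simp
  have "(\<lambda>k. (2 * (real k + 1) - real n) / D k) \<longlonglongrightarrow> 0" unfolding D_def by real_asymp
  then have 2: "\<forall>\<^sub>F k in sequentially. dist ((2 * (real k + 1) - real n) / D k) 0 < 1/8" by (rule tendstoD) simp
  have "(\<lambda>k. (2 * real k + 1 - real n - m) / D k) \<longlonglongrightarrow> 0" unfolding D_def by real_asymp
  then have 3: "\<forall>\<^sub>F k in sequentially. dist ((2 * real k + 1 - real n - m) / D k) 0 < 1/8" by (rule tendstoD) simp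
  from 1 2 3 eventually_gt_at_top[of n] show ?thesis
  proof eventually_elim
    case (elim k)
    define \<alpha> \<beta> \<gamma> where "\<alpha> = ind_poly k / D k" "\<beta> = (2 * (real k + 1) - real n) / D k"
      "\<gamma> = (2 * real k + 1 - real n - m) / D k"
    have alg: "(I * a - \<beta>1 * x + \<gamma>1 * b) / d = I / d * a - \<beta>1 / d * x + \<gamma>1 / d * b"
      for I a \<beta>1 x \<gamma>1 b d :: real by (simp add: diff_divide_distrib add_divide_distrib)
    define a b where "a = fst (log_coeffs k)" "b = snd (log_coeffs k)"
    have "real k + 1 - real n > 0" using elim by simp
    then have D: "D k \<noteq> 0" by (simp add: D_def)
    have b': "snd (log_coeffs (Suc k)) = \<alpha> * b"
      using log_coeffs_rec1[of k] D unfolding D_def[symmetric] \<alpha>_\<beta>_\<gamma>_def a_b_def by (simp add: field_simps)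
    have "fst (log_coeffs (Suc k)) = (ind_poly k * a - (2 * (real k + 1) - real n) * (\<alpha> * b) +
        (2 * real k + 1 - real n - m) * b) / D k"
      using log_coeffs_rec2[of k] D unfolding D_def[symmetric] b' a_b_def[symmetric]
      by (simp add: eq_divide_eq mult.commute)
    also have "\<dots> = ind_poly k / D k * a - (2 * (real k + 1) - real n) / D k * (\<alpha> * b) +
        (2 * real k + 1 - real n - m) / D k * b"
      by (rule alg)
    finally have a': "fst (log_coeffs (Suc k)) = \<alpha> * a - \<beta> * (\<alpha> * b) + \<gamma> * b"
      unfolding \<alpha>_\<beta>_\<gamma>_def .
    have bd: "\<bar>\<alpha>\<bar> \<le> 5/4" "\<bar>\<beta>\<bar> \<le> 1/8" "\<bar>\<gamma>\<bar> \<le> 1/8"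
    proof -
      have "\<bar>\<alpha> - 1\<bar> < 1/4" "\<bar>\<beta>\<bar> < 1/8" "\<bar>\<gamma>\<bar> < 1/8"
        using elim(1-3) unfolding dist_real_def \<alpha>_\<beta>_\<gamma>_def diff_0_right by (simp_all only:)
      then show "\<bar>\<alpha>\<bar> \<le> 5/4" "\<bar>\<beta>\<bar> \<le> 1/8" "\<bar>\<gamma>\<bar> \<le> 1/8" by linarith+
    qed
    have 1: "\<bar>\<alpha> * a\<bar> \<le> 5/4 * \<bar>a\<bar>" "\<bar>\<alpha> * b\<bar> \<le> 5/4 * \<bar>b\<bar>" "\<bar>\<gamma> * b\<bar> \<le> 1/8 * \<bar>b\<bar>"
      unfolding abs_mult by (intro mult_right_mono bd abs_ge_zero)+
    have "\<bar>\<beta> * (\<alpha> * b)\<bar> \<le> 1/8 * (5/4 * \<bar>b\<bar>)"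
      unfolding abs_mult[of \<beta>] using bd 1 by (intro mult_mono) auto
    moreover have "\<bar>x - y + w\<bar> + \<bar>v\<bar> \<le> 2 * (p + q)" if "\<bar>x\<bar> \<le> 5/4 * p" "\<bar>v\<bar> \<le> 5/4 * q"
      "\<bar>w\<bar> \<le> 1/8 * q" "\<bar>y\<bar> \<le> 1/8 * (5/4 * q)" "0 \<le> p" "0 \<le> q" for x y w v p q :: real
    proof -
      have lin: "k1 + v' \<le> 2 * (p + q)" if "k1 \<le> k2 + w'" "k2 \<le> x' + y'" "x' \<le> 5/4 * p" "v' \<le> 5/4 * q"
        "w' \<le> 1/8 * q" "y' \<le> 1/8 * (5/4 * q)" "0 \<le> p" "0 \<le> q" for k1 k2 x' y' w' v' p q :: real
        using that by simp
      show ?thesis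
        by (rule lin[OF abs_triangle_ineq abs_triangle_ineq4 that])
    qed
    ultimately show ?case unfolding a' b' a_b_def[symmetric] using 1 by simp
  qed
qed

lemma log_coeffs_conv_radius:
  "conv_radius (\<lambda>k. complex_of_real (fst (log_coeffs k))) \<ge> ereal (1/4)"
  "conv_radius (\<lambda>k. complex_of_real (snd (log_coeffs k))) \<ge> ereal (1/4)"
proof -
  define w where "w k = \<bar>fst (log_coeffs k)\<bar> + \<bar>snd (log_coeffs k)\<bar>" for k
  obtain K where K: "\<And>k. k \<ge> K \<Longrightarrow> w (Suc k) \<le> 2 * w k"
    using log_coeffs_growth unfolding w_def eventually_sequentially by blast
  have w0: "w k \<ge> 0" for k by (simp add: w_def)
  have "summable (\<lambda>k. w k * (1/4) ^ k)"
  proof (rule summable_ratio_test[where c = "1/2" and N = K])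
    fix k assume "k \<ge> K"
    from K[OF this] show "norm (w (Suc k) * (1 / 4) ^ Suc k) \<le> 1/2 * norm (w k * (1 / 4) ^ k)"
      using w0 by (simp add: abs_mult)
  qed simp
  then have s: "summable (\<lambda>k. of_real (f k) * (1/4 :: complex) ^ k)" if "\<And>k. \<bar>f k\<bar> \<le> w k" for f
    by (rule summable_comparison_test'[where N = 0])
      (use that in \<open>auto simp: norm_mult norm_power norm_divide intro!: mult_right_mono\<close>)
  have "conv_radius (\<lambda>k. complex_of_real (f k)) \<ge> ereal (1/4)" if "\<And>k. \<bar>f k\<bar> \<le> w k" for f
    using conv_radius_geI[OF s[OF that]] by (simp add: norm_divide)
  from this[of "\<lambda>k. fst (log_coeffs k)"] this[of "\<lambda>k. snd (log_coeffs k)"]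
  show "conv_radius (\<lambda>k. complex_of_real (fst (log_coeffs k))) \<ge> ereal (1/4)"
    "conv_radius (\<lambda>k. complex_of_real (snd (log_coeffs k))) \<ge> ereal (1/4)"
    by (simp_all add: w_def)
qed

text \<open>The two differential equations are the coefficient of log \<xi> and the rest after
  inserting A + B log \<xi>. Kept apart, they mention no branch of the logarithm. Shrinking the disc
  makes B zero-free off the centre, so the logarithm really occurs.\<close>

lemma hypergeometric_log_solution:
  assumes "\<And>k. k < n \<Longrightarrow> ind_poly k \<noteq> 0"
  obtains \<rho> A B where "\<rho> > 0" "A holomorphic_on ball 0 \<rho>" "B holomorphic_on ball 0 \<rho>"
    "\<And>\<xi>. \<xi> \<in> ball 0 \<rho> - {0} \<Longrightarrow> B \<xi> \<noteq> 0"
    "\<And>\<xi>. \<xi> \<in> ball 0 \<rho> - {0} \<Longrightarrow> \<xi> * (1 - \<xi>) * deriv (deriv B) \<xi> +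
       (1 - of_nat n - (2 - of_nat n - of_real m) * \<xi>) * deriv B \<xi> - of_real P * B \<xi> = 0"
    "\<And>\<xi>. \<xi> \<in> ball 0 \<rho> - {0} \<Longrightarrow> \<xi> * (1 - \<xi>) * (deriv (deriv A) \<xi> + 2 * deriv B \<xi> / \<xi> - B \<xi> / \<xi> ^ 2) +
       (1 - of_nat n - (2 - of_nat n - of_real m) * \<xi>) * (deriv A \<xi> + B \<xi> / \<xi>) - of_real P * A \<xi> = 0"
proof -
  define FA FB where "FA = Abs_fps (\<lambda>k. complex_of_real (fst (log_coeffs k)))"
    "FB = Abs_fps (\<lambda>k. complex_of_real (snd (log_coeffs k)))"
  define A B where "A = eval_fps FA" "B = eval_fps FB"
  have rad: "fps_conv_radius FA \<ge> ereal (1/4)" "fps_conv_radius FB \<ge> ereal (1/4)"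
    using log_coeffs_conv_radius by (simp_all add: fps_conv_radius_def FA_FB_def)
  have exp: "A has_fps_expansion FA" "B has_fps_expansion FB"
    unfolding A_B_def using rad
    by (auto intro!: eval_fps_has_fps_expansion intro: less_le_trans[of 0 "ereal (1/4)"])
  have hol: "A holomorphic_on ball 0 (1/4)" "B holomorphic_on ball 0 (1/4)"
    unfolding A_B_def by (rule holomorphic_on_eval_fps; use rad in \<open>force simp: eball_def elim: less_le_trans[rotated]\<close>)+
  define c where "c = (1 - of_nat n :: complex)"
  define e where "e = (2 - of_nat n - of_real m :: complex)"
  have 1: "fps_X * (1 - fps_X) * fps_deriv (fps_deriv FB) +
      (fps_const c - fps_const e * fps_X) * fps_deriv FB - fps_const (of_real P) * FB = 0" (is "?E1 = 0")
  proof (rule fps_ext)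
    fix k
    have "fps_nth ?E1 k = of_real ((real k + 1) * (real k + 1 - real n) * snd (log_coeffs (Suc k)) - ind_poly k * snd (log_coeffs k))"
      by (cases k; cases "k - 1")
        (auto simp: ring_distribs mult.assoc FA_FB_def ind_poly_def c_def e_def power2_eq_square algebra_simps numeral_fps_const)
    then show "fps_nth ?E1 k = fps_nth 0 k" unfolding log_coeffs_rec1 by simp
  qed
  \<comment> \<open>Multiplication by \<xi> clears the terms with B / \<xi> and B / \<xi>^2, so that
    the equation for A becomes an identity of formal power series.\<close>
  have 2: "fps_X * (fps_X * (1 - fps_X) * fps_deriv (fps_deriv FA) +
      (fps_const c - fps_const e * fps_X) * fps_deriv FA - fps_const (of_real P) * FA) +
      2 * (fps_X * (1 - fps_X) * fps_deriv FB) - fps_const (of_nat n) * FB +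
      fps_const (of_nat n + of_real m - 1) * (fps_X * FB) = 0" (is "?E2 = 0")
  proof (rule fps_ext)
    fix k
    show "fps_nth ?E2 k = fps_nth 0 k"
    proof (cases k)
      case 0
      then show ?thesis using snd_log_coeffs_below[of 0] by (auto simp: FA_FB_def)
    next
      case (Suc j)
      have "fps_nth ?E2 (Suc j) = of_real ((real j + 1) * (real j + 1 - real n) * fst (log_coeffs (Suc j)) -
          (ind_poly j * fst (log_coeffs j) - (2 * (real j + 1) - real n) * snd (log_coeffs (Suc j)) +
           (2 * real j + 1 - real n - m) * snd (log_coeffs j)))"
        by (cases j; cases "j - 1")
          (auto simp: ring_distribs mult.assoc FA_FB_def ind_poly_def c_def e_def power2_eq_square algebra_simps numeral_fps_const)
      then show ?thesis unfolding log_coeffs_rec2 Suc by simp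
    qed
  qed
  have "(\<lambda>\<xi>. \<xi> * (1 - \<xi>) * deriv (deriv B) \<xi> + (c - e * \<xi>) * deriv B \<xi> - of_real P * B \<xi>) has_fps_expansion 0"
    unfolding 1[symmetric] by (intro fps_expansion_intros exp)
  then have 1: "\<forall>\<^sub>F \<xi> in nhds 0. \<xi> * (1 - \<xi>) * deriv (deriv B) \<xi> + (c - e * \<xi>) * deriv B \<xi> - of_real P * B \<xi> = 0"
    by (simp add: has_fps_expansion_0_iff)
  have "(\<lambda>\<xi>. \<xi> * (\<xi> * (1 - \<xi>) * deriv (deriv A) \<xi> + (c - e * \<xi>) * deriv A \<xi> - of_real P * A \<xi>) +
      2 * (\<xi> * (1 - \<xi>) * deriv B \<xi>) - of_nat n * B \<xi> + (of_nat n + of_real m - 1) * (\<xi> * B \<xi>)) has_fps_expansion 0"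
    unfolding 2[symmetric] by (intro fps_expansion_intros exp)
  then have 2: "\<forall>\<^sub>F \<xi> in nhds 0. \<xi> * (\<xi> * (1 - \<xi>) * deriv (deriv A) \<xi> + (c - e * \<xi>) * deriv A \<xi> - of_real P * A \<xi>) +
      2 * (\<xi> * (1 - \<xi>) * deriv B \<xi>) - of_nat n * B \<xi> + (of_nat n + of_real m - 1) * (\<xi> * B \<xi>) = 0"
    by (simp add: has_fps_expansion_0_iff)
  have "FB \<noteq> 0"
    using snd_log_coeffs_nonzero[OF assms] by (auto simp: FA_FB_def fps_eq_iff)
  then have 3: "\<forall>\<^sub>F \<xi> in at 0. B \<xi> \<noteq> 0"
    using has_laurent_expansion_eventually_nonzero_iff'[OF has_laurent_expansion_fps[OF exp(2)]] by simp
  obtain r1 where r1: "r1 > 0"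
    "\<And>\<xi>. dist \<xi> 0 < r1 \<Longrightarrow> \<xi> * (1 - \<xi>) * deriv (deriv B) \<xi> + (c - e * \<xi>) * deriv B \<xi> - of_real P * B \<xi> = 0"
    using 1 unfolding eventually_nhds_metric by blast
  obtain r2 where r2: "r2 > 0"
    "\<And>\<xi>. dist \<xi> 0 < r2 \<Longrightarrow> \<xi> * (\<xi> * (1 - \<xi>) * deriv (deriv A) \<xi> + (c - e * \<xi>) * deriv A \<xi> - of_real P * A \<xi>) +
      2 * (\<xi> * (1 - \<xi>) * deriv B \<xi>) - of_nat n * B \<xi> + (of_nat n + of_real m - 1) * (\<xi> * B \<xi>) = 0"
    using 2 unfolding eventually_nhds_metric by blast
  obtain r3 where r3: "r3 > 0" "\<And>\<xi>. \<xi> \<noteq> 0 \<Longrightarrow> dist \<xi> 0 < r3 \<Longrightarrow> B \<xi> \<noteq> 0"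
    using 3 unfolding eventually_at by blast
  define \<rho> where "\<rho> = min (1/4) (min r1 (min r2 r3))"
  have sub: "ball 0 \<rho> \<subseteq> ball (0::complex) (1/4)" by (auto simp: \<rho>_def)
  show ?thesis
  proof (rule that)
    show "\<rho> > 0" using r1 r2 r3 by (simp add: \<rho>_def)
    show "A holomorphic_on ball 0 \<rho>" "B holomorphic_on ball 0 \<rho>"
      using hol sub by (auto intro: holomorphic_on_subset)
    fix \<xi> :: complex assume \<xi>: "\<xi> \<in> ball 0 \<rho> - {0}"
    show "B \<xi> \<noteq> 0" using r3(2)[of \<xi>] \<xi> by (simp add: \<rho>_def)
    show "\<xi> * (1 - \<xi>) * deriv (deriv B) \<xi> +
       (1 - of_nat n - (2 - of_nat n - of_real m) * \<xi>) * deriv B \<xi> - of_real P * B \<xi> = 0"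
      using r1(2)[of \<xi>] \<xi> by (simp add: \<rho>_def c_def e_def)
    have alg: "x * (1 - x) * (a2 + 2 * b1 / x - b / x ^ 2) + (1 - N - (2 - N - M) * x) * (a1 + b / x) - p * a = 0"
      if "x * (x * (1 - x) * a2 + (1 - N - (2 - N - M) * x) * a1 - p * a) + 2 * (x * (1 - x) * b1) - N * b + (N + M - 1) * (x * b) = 0"
        "x \<noteq> 0" for x a2 a1 a b1 b N M p :: complex
    proof -
      have "x * (x * (1 - x) * (a2 + 2 * b1 / x - b / x ^ 2) + (1 - N - (2 - N - M) * x) * (a1 + b / x) - p * a) =
          x * (x * (1 - x) * a2 + (1 - N - (2 - N - M) * x) * a1 - p * a) + 2 * (x * (1 - x) * b1) - N * b + (N + M - 1) * (x * b)"
        using that(2) by (simp add: field_simps power2_eq_square)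
      with that show ?thesis by simp
    qed
    show "\<xi> * (1 - \<xi>) * (deriv (deriv A) \<xi> + 2 * deriv B \<xi> / \<xi> - B \<xi> / \<xi> ^ 2) +
       (1 - of_nat n - (2 - of_nat n - of_real m) * \<xi>) * (deriv A \<xi> + B \<xi> / \<xi>) - of_real P * A \<xi> = 0"
      by (rule alg) (use r2(2)[of \<xi>] \<xi> in \<open>simp_all add: \<rho>_def c_def e_def\<close>)
  qed
qed

end

text \<open>This is \<open>1728 / j\<close>, which vanishes at the cusp and equals 1 at \<open>\<i>\<close>.\<close>

definition inv_j :: "complex \<Rightarrow> complex" where "inv_j z = discr z / E4 z ^ 3"

text \<open>With \<theta> = q d/dq this is \<theta> x / x for x = \<open>inv_j\<close>.\<close>

definition psi :: "complex \<Rightarrow> complex" where "psi z = E6 z / E4 z"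

section \<open>The change of variables x = 1728 / j\<close>

lemma inv_j_has_derivative:
  assumes "Im z > 0" "E4 z \<noteq> 0"
  shows "(inv_j has_field_derivative tpi * (inv_j z * psi z)) (at z)"
  unfolding inv_j_def[abs_def] psi_def
  using assms
  by (auto intro!: derivative_eq_intros discr_has_derivative E4_has_derivative
      simp: field_simps power_numeral_reduce)

lemma one_minus_inv_j:
  assumes "E4 z \<noteq> 0"
  shows "1 - inv_j z = E6 z ^ 2 / E4 z ^ 3"
  using assms by (simp add: inv_j_def discr_def field_simps)

lemma log_derivative:
  assumes "open V" "l holomorphic_on V" "\<And>z. z \<in> V \<Longrightarrow> f z = exp (l z)"
    "(f has_field_derivative D) (at z)" "z \<in> V"
  shows "(l has_field_derivative D / f z) (at z)"
proof -
  have l: "(l has_field_derivative deriv l z) (at z)"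
    using assms by (intro holomorphic_derivI)
  have "(f has_field_derivative exp (l z) * deriv l z) (at z)"
    by (rule has_field_derivative_transform_within_open[where f = "\<lambda>z. exp (l z)" and S = V])
      (use assms l in \<open>auto intro!: derivative_eq_intros\<close>)
  then have "D = exp (l z) * deriv l z" using assms(4) DERIV_unique by blast
  with l assms(3,5) show ?thesis by simp
qed

text \<open>The substitution \<open>y = E4\<^sup>e E6\<^bsup>1/2-n\<^sub>i\<^esup> discr\<^bsup>-n\<^sub>f/2\<^esup> u(x)\<close> with \<open>x = discr / E4\<^sup>3\<close> turns the equation into
  the hypergeometric equation with exponent differences \<open>n\<^sub>f\<close>, \<open>n\<^sub>i\<close>, \<open>n\<^sub>r\<close> at \<open>x = 0, 1, \<infinity>\<close>, that is,
  at the cusp, at the zeros of \<open>E6\<close> and at the zeros of \<open>E4\<close>; the exponents of the prefactor are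
  chosen to have weight \<open>-1\<close> and so that \<open>0\<close> is an exponent at \<open>x = 0\<close> and \<open>x = 1\<close>.\<close>

locale pulled_back =
  fixes ni nr nf :: real and r s t :: complex
  assumes s: "s = (1 - 9 * of_real nr ^ 2) / 9"
    and t: "t = (1 - 4 * of_real ni ^ 2) / 4"
    and rst: "r + s + t = - (of_real nf ^ 2)"
begin

text \<open>The product of the hypergeometric parameters (1 - ni - nf +- nr) / 2.\<close>

definition ab :: real where "ab = ((1 - ni - nf) ^ 2 - nr ^ 2) / 4"

text \<open>The solution of 4 ee + 6 (1/2 - ni) - 12 nf / 2 = -1, the condition that the prefactor
  has weight -1.\<close>

definition ee :: real where "ee = - 1 + 3 / 2 * (ni + nf)"

text \<open>The real powers depend on branches of three logarithms. They are arguments, since a slit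
  disc, a half-plane at the cusp and a disc without zeros each come with their own.\<close>

definition prefactor :: "(complex \<Rightarrow> complex) \<Rightarrow> (complex \<Rightarrow> complex) \<Rightarrow> (complex \<Rightarrow> complex) \<Rightarrow> complex \<Rightarrow> complex" where
  "prefactor l4 l6 lD z = exp (of_real ee * l4 z + of_real (1/2 - ni) * l6 z - of_real (nf / 2) * lD z)"

text \<open>The algebraic core. P, Q, R stand for \<open>E2\<close>, \<open>E4\<close>,
  \<open>psi\<close>, and L, DL, Dp for the logarithmic derivative of the prefactor, its derivative
  and that of \<open>psi\<close>, all in units of \<open>tpi\<close>. In terms of W = Q / R, which
  is E4^2 / E6, everything is polynomial in P, R and W: the hypergeometric equation removes u2, then
  the coefficient of u1 cancels and that of u0 is the given equation. The factor 4 comes from tpi^2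
  = -4 \<pi>^2.\<close>

lemma solution_identity:
  fixes P Q R u0 u1 u2 x L DL Dp :: complex
  assumes Q: "Q \<noteq> 0" and R: "R \<noteq> 0" and x: "x = 1 - R ^ 2 / Q"
    and hyp: "x * (1 - x) * u2 + (1 - of_real nf - (2 - of_real ni - of_real nf) * x) * u1 - of_real ab * u0 = 0"
    and L: "L = - P / 12 - of_real ee * R / 3 - (1/2 - of_real ni) * Q / (2 * R)"
    and Dp: "Dp = R * P / 6 - Q / 2 + R ^ 2 / 3"
    and DL: "DL = - (P ^ 2 - Q) / 144 - of_real ee * Dp / 3 -
      (1/2 - of_real ni) / 2 * (P * Q / (6 * R) + Q ^ 2 / (2 * R ^ 2) - 2 * Q / 3)"
  shows "4 * (L * (L * u0 + x * R * u1) + (DL * u0 + L * (x * R * u1) + (x * R * R + x * Dp) * u1 + x * R * (x * R * u2))) =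
    - (r * Q + s * R ^ 2 + t * Q ^ 2 / R ^ 2) * u0"
proof -
  define W where "W = Q / R"
  have QW: "Q = W * R" and W: "W \<noteq> 0" using Q R by (simp_all add: W_def)
  have x': "x * W = W - R" unfolding x QW using W R by (simp add: field_simps power2_eq_square)
  have "x * R * (x * R * u2) = x * W * R * (x * (1 - x) * u2)"
    unfolding x QW using W R by (simp add: field_simps power2_eq_square)
  also have "\<dots> = x * W * R * (of_real ab * u0 - (1 - of_real nf - (2 - of_real ni - of_real nf) * x) * u1)"
  proof -
    have "x * (1 - x) * u2 = of_real ab * u0 - (1 - of_real nf - (2 - of_real ni - of_real nf) * x) * u1"
      using hyp by algebra
    then show ?thesis by simp
  qed
  also have "\<dots> = (W - R) * R * (of_real ab * u0) - x * R * ((1 - of_real nf) * W - (2 - of_real ni - of_real nf) * (W - R)) * u1"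
    unfolding x'[symmetric] by (simp add: algebra_simps)
  finally have u2: "x * R * (x * R * u2) = \<dots>" .
  define N F K where "N = (of_real ni :: complex)" "F = (of_real nf :: complex)" "K = (of_real nr :: complex)"
  have c: "of_real ab = ((1 - N - F) ^ 2 - K ^ 2) / 4" "of_real ee = - 1 + 3 / 2 * (N + F)"
    "(of_real ni :: complex) = N" "(of_real nf :: complex) = F"
    by (simp_all add: N_F_K_def ab_def ee_def)
  have L': "L = - P / 12 - (- 1 + 3 / 2 * (N + F)) * R / 3 - (1/2 - N) * W / 2"
    unfolding L c W_def using R by (simp add: field_simps)
  have Dp': "Dp = R * P / 6 - W * R / 2 + R ^ 2 / 3" unfolding Dp QW ..
  have DL': "DL = - (P ^ 2 - W * R) / 144 - (- 1 + 3 / 2 * (N + F)) * Dp / 3 -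
      (1/2 - N) / 2 * (P * W / 6 + W ^ 2 / 2 - 2 * (W * R) / 3)"
    unfolding DL c QW using R W by (simp add: field_simps power2_eq_square)
  have r': "r = - (F ^ 2) - (1 - 9 * K ^ 2) / 9 - (1 - 4 * N ^ 2) / 4"
    using rst unfolding s t N_F_K_def by (simp add: algebra_simps)
  have tq: "t * Q ^ 2 / R ^ 2 = t * W ^ 2" unfolding QW using R by (simp add: power_mult_distrib)
  have U1: "L + L + R + (R * P / 6 - W * R / 2 + R ^ 2 / 3) / R = (1 - F) * W - (2 - N - F) * (W - R)"
    unfolding L' using R by (simp add: field_simps power2_eq_square)
  have U1': "L * R + L * R + R * R + Dp = R * ((1 - F) * W - (2 - N - F) * (W - R))"
    unfolding Dp' U1[symmetric] using R by (simp add: field_simps power2_eq_square)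
  have U0: "4 * (L * L + DL + (W - R) * R * (((1 - N - F) ^ 2 - K ^ 2) / 4)) = - (r * (W * R) + s * R ^ 2 + t * W ^ 2)"
    unfolding L' DL' Dp' r' s t N_F_K_def(3)[symmetric] N_F_K_def(1)[symmetric]
    by (simp add: field_simps power2_eq_square)
  have "4 * (L * (L * u0 + x * R * u1) + (DL * u0 + L * (x * R * u1) + (x * R * R + x * Dp) * u1 + x * R * (x * R * u2))) =
     4 * (L * L + DL + (W - R) * R * (((1 - N - F) ^ 2 - K ^ 2) / 4)) * u0 +
     4 * x * u1 * ((L * R + L * R + R * R + Dp) - R * ((1 - F) * W - (2 - N - F) * (W - R)))"
    unfolding u2 c by (simp add: algebra_simps)
  also have "\<dots> = - (r * (W * R) + s * R ^ 2 + t * W ^ 2) * u0" unfolding U0 U1' by simp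
  finally show ?thesis unfolding tq unfolding QW .
qed

text \<open>\<open>Ua\<close>, \<open>Ub\<close>, \<open>Uc\<close> are u, u', u'' at
  \<open>inv_j\<close>, but given as functions of z that obey the chain rule. In this way u may be
  multivalued in x, as the logarithmic solutions are.\<close>

lemma pullback_solution:
  assumes V: "open V" "V \<subseteq> upper_half_plane"
    and l: "l4 holomorphic_on V" "l6 holomorphic_on V" "lD holomorphic_on V"
      "\<And>z. z \<in> V \<Longrightarrow> E4 z = exp (l4 z)" "\<And>z. z \<in> V \<Longrightarrow> E6 z = exp (l6 z)" "\<And>z. z \<in> V \<Longrightarrow> discr z = exp (lD z)"
    and U: "\<And>z. z \<in> V \<Longrightarrow> (Ua has_field_derivative tpi * (inv_j z * psi z * Ub z)) (at z)"
      "\<And>z. z \<in> V \<Longrightarrow> (Ub has_field_derivative tpi * (inv_j z * psi z * Uc z)) (at z)"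
      "\<And>z. z \<in> V \<Longrightarrow> inv_j z * (1 - inv_j z) * Uc z +
         (1 - of_real nf - (2 - of_real ni - of_real nf) * inv_j z) * Ub z - of_real ab * Ua z = 0"
  shows "solution_on (ode_coeff r s t) V (\<lambda>z. prefactor l4 l6 lD z * Ua z)"
    and "z \<in> V \<Longrightarrow> prefactor l4 l6 lD z \<noteq> 0"
proof -
  define \<Phi> where "\<Phi> = prefactor l4 l6 lD"
  define G where "G z = E4 z ^ 2 / E6 z" for z
  define L where "L z = - E2 z / 12 - of_real ee * psi z / 3 - (1/2 - of_real ni) / 2 * G z" for z
  define K where "K z = E2 z * E4 z / (6 * psi z) + E4 z ^ 2 / (2 * psi z ^ 2) - 2 * E4 z / 3" for z
  define DL where "DL z = - (E2 z ^ 2 - E4 z) / 144 - of_real ee * (psi z * E2 z / 6 - E4 z / 2 + psi z ^ 2 / 3) / 3 -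
      (1/2 - of_real ni) / 2 * K z" for z
  define Y1 where "Y1 z = L z * Ua z + inv_j z * psi z * Ub z" for z
  define y where "y z = \<Phi> z * Ua z" for z
  have nz: "E4 z \<noteq> 0" "E6 z \<noteq> 0" "Im z > 0" if "z \<in> V" for z
    using l(4,5)[OF that] V that by auto
  have dl4: "(l4 has_field_derivative tpi * (E2 z * E4 z - E6 z) / 3 / E4 z) (at z)" if "z \<in> V" for z
    by (rule log_derivative[OF V(1) l(1,4) E4_has_derivative that]) (use nz that in auto)
  have dl6: "(l6 has_field_derivative tpi * (E2 z * E6 z - E4 z ^ 2) / 2 / E6 z) (at z)" if "z \<in> V" for z
    by (rule log_derivative[OF V(1) l(2,5) E6_has_derivative that]) (use nz that in auto)
  have dlD: "(lD has_field_derivative tpi * (E2 z * discr z) / discr z) (at z)" if "z \<in> V" for z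
    by (rule log_derivative[OF V(1) l(3,6) discr_has_derivative that]) (use nz that in auto)
  have d\<Phi>: "(\<Phi> has_field_derivative tpi * (L z * \<Phi> z)) (at z)" if z: "z \<in> V" for z
  proof -
    have D: "discr z \<noteq> 0" using discr_nonzero nz(3)[OF z] by simp
    have "(\<Phi> has_field_derivative (of_real ee * (tpi * (E2 z * E4 z - E6 z) / 3 / E4 z) +
        of_real (1/2 - ni) * (tpi * (E2 z * E6 z - E4 z ^ 2) / 2 / E6 z) -
        of_real (nf / 2) * (tpi * (E2 z * discr z) / discr z)) * \<Phi> z) (at z)"
      unfolding \<Phi>_def prefactor_def[abs_def]
      by (auto intro!: derivative_eq_intros dl4 dl6 dlD z simp: mult_ac)
    also have "of_real ee * (tpi * (E2 z * E4 z - E6 z) / 3 / E4 z) +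
        of_real (1/2 - ni) * (tpi * (E2 z * E6 z - E4 z ^ 2) / 2 / E6 z) -
        of_real (nf / 2) * (tpi * (E2 z * discr z) / discr z) = tpi * L z"
      unfolding L_def G_def psi_def ee_def using D nz[OF z] by (simp add: field_simps)
    finally show ?thesis by (simp add: mult.assoc)
  qed
  have dpsi: "(psi has_field_derivative tpi * (psi z * E2 z / 6 - E4 z / 2 + psi z ^ 2 / 3)) (at z)" if z: "z \<in> V" for z
    unfolding psi_def[abs_def] using nz[OF z]
    by (auto intro!: derivative_eq_intros E4_has_derivative E6_has_derivative simp: field_simps power2_eq_square)
  have dL: "(L has_field_derivative tpi * DL z) (at z)" if z: "z \<in> V" for z
  proof -
    have "(G has_field_derivative tpi * K z) (at z)"
      unfolding psi_def G_def[abs_def] K_def using nz[OF z]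
      by (auto intro!: derivative_eq_intros E4_has_derivative E6_has_derivative simp: field_simps power2_eq_square)
    then show ?thesis
      unfolding L_def[abs_def] DL_def
      by (auto intro!: derivative_eq_intros dpsi z E2_has_derivative nz simp: field_simps)
  qed
  have dy: "(y has_field_derivative tpi * (\<Phi> z * Y1 z)) (at z)" if z: "z \<in> V" for z
    unfolding y_def[abs_def] Y1_def
    by (auto intro!: derivative_eq_intros d\<Phi> U z simp: algebra_simps)
  have ddy: "((\<lambda>z. tpi * (\<Phi> z * Y1 z)) has_field_derivative ode_coeff r s t z * y z) (at z)" if z: "z \<in> V" for z
  proof -
    define Dp where "Dp = psi z * E2 z / 6 - E4 z / 2 + psi z ^ 2 / 3"
    have p0: "psi z \<noteq> 0" using nz[OF z] by (simp add: psi_def)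
    have xp: "inv_j z = 1 - psi z ^ 2 / E4 z"
      using one_minus_inv_j[of z] nz[OF z] by (simp add: psi_def field_simps power_numeral_reduce)
    have q: "E4 z ^ 2 / E6 z = E4 z / psi z" using nz[OF z] by (simp add: psi_def field_simps power2_eq_square)
    have "((\<lambda>z. tpi * (\<Phi> z * Y1 z)) has_field_derivative
        tpi ^ 2 * (\<Phi> z * (L z * (L z * Ua z + inv_j z * psi z * Ub z) + (DL z * Ua z + L z * (inv_j z * psi z * Ub z) +
          (inv_j z * psi z * psi z + inv_j z * Dp) * Ub z + inv_j z * psi z * (inv_j z * psi z * Uc z))))) (at z)"
      unfolding Y1_def[abs_def]
      by (auto intro!: derivative_eq_intros d\<Phi> dL dpsi inv_j_has_derivative nz U z
          simp: algebra_simps power2_eq_square Dp_def)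
    also have "tpi ^ 2 * (\<Phi> z * (L z * (L z * Ua z + inv_j z * psi z * Ub z) + (DL z * Ua z + L z * (inv_j z * psi z * Ub z) +
          (inv_j z * psi z * psi z + inv_j z * Dp) * Ub z + inv_j z * psi z * (inv_j z * psi z * Uc z)))) =
        - (of_real pi ^ 2) * \<Phi> z * (4 * (L z * (L z * Ua z + inv_j z * psi z * Ub z) + (DL z * Ua z + L z * (inv_j z * psi z * Ub z) +
          (inv_j z * psi z * psi z + inv_j z * Dp) * Ub z + inv_j z * psi z * (inv_j z * psi z * Uc z))))"
      unfolding tpi_square by (simp add: mult_ac)
    also have "\<dots> = - (of_real pi ^ 2) * \<Phi> z * (- (r * E4 z + s * psi z ^ 2 + t * E4 z ^ 2 / psi z ^ 2) * Ua z)"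
      by (subst solution_identity[OF nz(1)[OF z] p0 xp U(3)[OF z], where P = "E2 z"])
        (simp_all add: L_def G_def DL_def K_def Dp_def q)
    also have "\<dots> = ode_coeff r s t z * y z"
    proof -
      have "E4 z ^ 2 / psi z ^ 2 = E4 z ^ 4 / E6 z ^ 2"
        using nz[OF z] by (simp add: psi_def field_simps power_numeral_reduce)
      then have "t * E4 z ^ 2 / psi z ^ 2 = t * (E4 z ^ 4 / E6 z ^ 2)" by (metis times_divide_eq_right)
      moreover have "psi z ^ 2 = E6 z ^ 2 / E4 z ^ 2" by (simp add: psi_def power_divide)
      ultimately have E: "r * E4 z + s * psi z ^ 2 + t * E4 z ^ 2 / psi z ^ 2 =
          r * E4 z + s * (E6 z ^ 2 / E4 z ^ 2) + t * (E4 z ^ 4 / E6 z ^ 2)" by simp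
      have "- p * f * (- T * u) = p * T * (f * u)" for p f T u :: complex by simp
      then show ?thesis unfolding ode_coeff_def y_def E .
    qed
    finally show ?thesis .
  qed
  have "y holomorphic_on V"
    using dy V(1) by (auto simp: holomorphic_on_open)
  moreover have "(deriv ^^ 2) y z = ode_coeff r s t z * y z" if z: "z \<in> V" for z
  proof -
    have "(deriv y has_field_derivative ode_coeff r s t z * y z) (at z)"
      by (rule has_field_derivative_transform_within_open[OF ddy[OF z] V(1) z])
        (use dy in \<open>auto intro!: DERIV_imp_deriv[symmetric]\<close>)
    then show ?thesis by (simp add: numeral_2_eq_2 DERIV_imp_deriv)
  qed
  ultimately show "solution_on (ode_coeff r s t) V (\<lambda>z. prefactor l4 l6 lD z * Ua z)"
    unfolding solution_on_def y_def[abs_def] \<Phi>_def by blast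
  show "z \<in> V \<Longrightarrow> prefactor l4 l6 lD z \<noteq> 0" by (simp add: prefactor_def)
qed

lemma pullback_poly_solution:
  assumes V: "open V" "V \<subseteq> upper_half_plane"
    and l: "l4 holomorphic_on V" "l6 holomorphic_on V" "lD holomorphic_on V"
      "\<And>z. z \<in> V \<Longrightarrow> E4 z = exp (l4 z)" "\<And>z. z \<in> V \<Longrightarrow> E6 z = exp (l6 z)" "\<And>z. z \<in> V \<Longrightarrow> discr z = exp (lD z)"
    and u: "[:0, 1, -1:] * pderiv (pderiv u) + [:1 - of_real nf, - (2 - of_real ni - of_real nf):] * pderiv u -
       smult (of_real ab) u = 0"
  shows "solution_on (ode_coeff r s t) V (\<lambda>z. prefactor l4 l6 lD z * poly u (inv_j z))"
proof (rule pullback_solution(1)[OF V l, where Uc = "\<lambda>z. poly (pderiv (pderiv u)) (inv_j z)" and Ub = "\<lambda>z. poly (pderiv u) (inv_j z)"])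
  have D: "((\<lambda>z. poly v (inv_j z)) has_field_derivative tpi * (inv_j z * psi z * poly (pderiv v) (inv_j z))) (at z)" if "z \<in> V" for v z
    using DERIV_chain2[OF poly_DERIV inv_j_has_derivative, of z v] l(4)[OF that] V that by (auto simp: mult_ac)
  fix z assume "z \<in> V"
  then show "((\<lambda>z. poly u (inv_j z)) has_field_derivative tpi * (inv_j z * psi z * poly (pderiv u) (inv_j z))) (at z)"
    "((\<lambda>z. poly (pderiv u) (inv_j z)) has_field_derivative tpi * (inv_j z * psi z * poly (pderiv (pderiv u)) (inv_j z))) (at z)"
    by (auto intro: D)
  show "inv_j z * (1 - inv_j z) * poly (pderiv (pderiv u)) (inv_j z) + (1 - of_real nf - (2 - of_real ni - of_real nf) * inv_j z) * poly (pderiv u) (inv_j z) -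
      of_real ab * poly u (inv_j z) = 0"
    using arg_cong[OF u, of "\<lambda>p. poly p (inv_j z)"] by (simp add: algebra_simps)
qed

text \<open>The hypergeometric equation is symmetric under x -> 1 - x with exchange of nf and ni, so
  one lemma serves the cusp (\<sigma> = 1, \<xi> = x) and the zeros of \<open>E6\<close> (\<sigma> =
  -1, \<xi> = 1 - x); \<sigma> is the sign in the chain rule.\<close>

lemma pullback_log_solution:
  fixes \<sigma> :: real
  assumes V: "open V" "V \<subseteq> upper_half_plane"
    and l: "l4 holomorphic_on V" "l6 holomorphic_on V" "lD holomorphic_on V"
      "\<And>z. z \<in> V \<Longrightarrow> E4 z = exp (l4 z)" "\<And>z. z \<in> V \<Longrightarrow> E6 z = exp (l6 z)" "\<And>z. z \<in> V \<Longrightarrow> discr z = exp (lD z)"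
    and \<xi>: "\<sigma> = 1 \<and> n = nf \<and> (\<forall>z\<in>V. \<xi> z = inv_j z) \<and> m = ni \<or> \<sigma> = -1 \<and> n = ni \<and> (\<forall>z\<in>V. \<xi> z = 1 - inv_j z) \<and> m = nf"
    and \<ll>: "\<ll> holomorphic_on V" "\<And>z. z \<in> V \<Longrightarrow> \<xi> z = exp (\<ll> z)"
    and in_ball: "\<And>z. z \<in> V \<Longrightarrow> \<xi> z \<in> ball 0 \<rho>"
    and AB: "A holomorphic_on ball 0 \<rho>" "B holomorphic_on ball 0 \<rho>"
    "\<And>\<xi>. \<xi> \<in> ball 0 \<rho> - {0} \<Longrightarrow> \<xi> * (1 - \<xi>) * deriv (deriv B) \<xi> +
       (1 - of_real n - (2 - of_real n - of_real m) * \<xi>) * deriv B \<xi> - of_real ab * B \<xi> = 0"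
    "\<And>\<xi>. \<xi> \<in> ball 0 \<rho> - {0} \<Longrightarrow> \<xi> * (1 - \<xi>) * (deriv (deriv A) \<xi> + 2 * deriv B \<xi> / \<xi> - B \<xi> / \<xi> ^ 2) +
       (1 - of_real n - (2 - of_real n - of_real m) * \<xi>) * (deriv A \<xi> + B \<xi> / \<xi>) - of_real ab * A \<xi> = 0"
  shows "solution_on (ode_coeff r s t) V (\<lambda>z. prefactor l4 l6 lD z * (A (\<xi> z) + B (\<xi> z) * \<ll> z))"
proof -
  define sg :: complex where "sg = (if \<sigma> = 1 then 1 else -1)"
  have sg2: "sg * sg = 1" by (simp add: sg_def)
  define T1 where "T1 z = deriv A (\<xi> z) + deriv B (\<xi> z) * \<ll> z + B (\<xi> z) / \<xi> z" for z
  define T2 where "T2 z = deriv (deriv A) (\<xi> z) + deriv (deriv B) (\<xi> z) * \<ll> z + 2 * deriv B (\<xi> z) / \<xi> z - B (\<xi> z) / \<xi> z ^ 2" for z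
  have nz: "E4 z \<noteq> 0" "Im z > 0" "\<xi> z \<noteq> 0" if "z \<in> V" for z
    using l(4)[OF that] \<ll>(2)[OF that] V that by auto
  have d\<xi>: "(\<xi> has_field_derivative tpi * (inv_j z * psi z * sg)) (at z)" if z: "z \<in> V" for z
  proof (cases "\<sigma> = 1")
    case True
    have "(inv_j has_field_derivative tpi * (inv_j z * psi z * sg)) (at z)"
      using inv_j_has_derivative[OF nz(2)[OF z] nz(1)[OF z]] True by (simp add: sg_def)
    then show ?thesis
      by (rule has_field_derivative_transform_within_open[OF _ V(1) z]) (use \<xi> True in auto)
  next
    case False
    have "((\<lambda>z. 1 - inv_j z) has_field_derivative tpi * (inv_j z * psi z * sg)) (at z)"
      using DERIV_diff[OF DERIV_const[of 1] inv_j_has_derivative[OF nz(2)[OF z] nz(1)[OF z]]] False by (simp add: sg_def)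
    then show ?thesis
      by (rule has_field_derivative_transform_within_open[OF _ V(1) z]) (use \<xi> False in auto)
  qed
  have d\<ll>: "(\<ll> has_field_derivative tpi * (inv_j z * psi z * sg) / \<xi> z) (at z)" if z: "z \<in> V" for z
    by (rule log_derivative[OF V(1) \<ll> d\<xi>[OF z] z])
  have dC: "((\<lambda>z. C (\<xi> z)) has_field_derivative tpi * (inv_j z * psi z * sg) * deriv C (\<xi> z)) (at z)"
    if "C holomorphic_on ball 0 \<rho>" "z \<in> V" for C z
    using DERIV_chain2[OF holomorphic_derivI[OF that(1) open_ball in_ball[OF that(2)]] d\<xi>[OF that(2)]]
    by (simp add: mult.commute)
  have AB': "deriv A holomorphic_on ball 0 \<rho>" "deriv B holomorphic_on ball 0 \<rho>"
    using AB(1,2) open_ball by (auto intro: holomorphic_deriv)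
  show ?thesis
  proof (rule pullback_solution(1)[OF V l, where Ub = "\<lambda>z. sg * T1 z" and Uc = T2])
    fix z assume z: "z \<in> V"
    show "((\<lambda>z. A (\<xi> z) + B (\<xi> z) * \<ll> z) has_field_derivative tpi * (inv_j z * psi z * (sg * T1 z))) (at z)"
      unfolding T1_def using nz[OF z]
      by (auto intro!: derivative_eq_intros dC d\<ll> AB z simp: algebra_simps)
    have dT1: "(T1 has_field_derivative tpi * (inv_j z * psi z * sg) * T2 z) (at z)"
      unfolding T1_def[abs_def] T2_def using nz[OF z]
      by (auto intro!: derivative_eq_intros dC d\<ll> d\<xi> AB AB' z simp: field_simps power2_eq_square)
    have "tpi * (inv_j z * psi z * T2 z) = sg * (tpi * (inv_j z * psi z * sg) * T2 z)"
      using sg2 by algebra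
    then show "((\<lambda>z. sg * T1 z) has_field_derivative tpi * (inv_j z * psi z * T2 z)) (at z)"
      using DERIV_cmult[OF dT1, of sg] by (simp only:)
    define X where "X = \<xi> z"
    have X: "X \<in> ball 0 \<rho> - {0}" using in_ball[OF z] nz[OF z] by (simp add: X_def)
    have "X * (1 - X) * T2 z + (1 - of_real n - (2 - of_real n - of_real m) * X) * T1 z - of_real ab * (A X + B X * \<ll> z) =
        (X * (1 - X) * (deriv (deriv A) X + 2 * deriv B X / X - B X / X ^ 2) +
         (1 - of_real n - (2 - of_real n - of_real m) * X) * (deriv A X + B X / X) - of_real ab * A X) +
        \<ll> z * (X * (1 - X) * deriv (deriv B) X + (1 - of_real n - (2 - of_real n - of_real m) * X) * deriv B X - of_real ab * B X)"
      unfolding T1_def T2_def X_def[symmetric] by (simp add: algebra_simps)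
    then have eq: "X * (1 - X) * T2 z + (1 - of_real n - (2 - of_real n - of_real m) * X) * T1 z - of_real ab * (A X + B X * \<ll> z) = 0"
      unfolding AB(3)[OF X] AB(4)[OF X] by simp
    show "inv_j z * (1 - inv_j z) * T2 z + (1 - of_real nf - (2 - of_real ni - of_real nf) * inv_j z) * (sg * T1 z) -
        of_real ab * (A (\<xi> z) + B (\<xi> z) * \<ll> z) = 0"
      using \<xi>
    proof
      assume "\<sigma> = 1 \<and> n = nf \<and> (\<forall>z\<in>V. \<xi> z = inv_j z) \<and> m = ni"
      then show ?thesis using eq z by (simp add: X_def sg_def algebra_simps)
    next
      assume *: "\<sigma> = -1 \<and> n = ni \<and> (\<forall>z\<in>V. \<xi> z = 1 - inv_j z) \<and> m = nf"
      then have xX: "inv_j z = 1 - X" and sg1: "sg = - 1" using z by (simp_all add: X_def sg_def)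
      have "n = ni" "m = nf" using * by simp_all
      moreover have "(1 - X) * (1 - (1 - X)) * T + (1 - M - (2 - N - M) * (1 - X)) * (- 1 * T') - C = 0"
        if "X * (1 - X) * T + (1 - N - (2 - N - M) * X) * T' - C = 0" for X T T' N M C :: complex
        using that by algebra
      ultimately show ?thesis using eq unfolding X_def[symmetric] xX sg1 by blast
    qed
  qed
qed

end

section \<open>Local solutions at the zeros of \<open>E4\<close> and \<open>E6\<close> and at the cusp\<close>

lemma holomorphic_log_near:
  fixes f :: "complex \<Rightarrow> complex"
  assumes "f holomorphic_on S" "open S" "p \<in> S" "f p \<noteq> 0"
  obtains R k where "R > 0" "ball p R \<subseteq> S" "k holomorphic_on ball p R" "\<And>z. z \<in> ball p R \<Longrightarrow> f z = exp (k z)"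
proof -
  have "continuous_on S f" using assms(1) by (rule holomorphic_on_imp_continuous_on)
  then have "open (S \<inter> f -` (- {0}))" using assms(2) by (intro continuous_open_preimage) auto
  then obtain R where R: "R > 0" "ball p R \<subseteq> S \<inter> f -` (- {0})"
    using assms(3,4) openE[of "S \<inter> f -` (- {0})" p] by auto
  have "f holomorphic_on ball p R" using assms(1) R(2) by (auto intro: holomorphic_on_subset)
  moreover have "contractible (ball p R)" by (rule convex_imp_contractible[OF convex_ball])
  ultimately obtain k where "k holomorphic_on ball p R" "\<And>z. z \<in> ball p R \<Longrightarrow> f z = exp (k z)"
    using contractible_imp_holomorphic_log[of f "ball p R"] R by blast
  then show ?thesis using that[of R k] R by blast
qed

lemma holomorphic_simple_zero_log:
  fixes f :: "complex \<Rightarrow> complex"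
  assumes "f holomorphic_on S" "open S" "p \<in> S" "f p = 0" "deriv f p \<noteq> 0"
  obtains R k where "R > 0" "ball p R \<subseteq> S" "k holomorphic_on ball p R"
    "\<And>z. z \<in> ball p R \<Longrightarrow> f z = (z - p) * exp (k z)"
proof -
  define g where "g z = (if z = p then deriv f p else (f z - f p) / (z - p))" for z
  have "g holomorphic_on S"
    unfolding g_def by (rule pole_lemma[OF assms(1)]) (use assms in \<open>auto simp: interior_open\<close>)
  moreover have "g p \<noteq> 0" using assms by (simp add: g_def)
  ultimately obtain R k where *: "R > 0" "ball p R \<subseteq> S" "k holomorphic_on ball p R" "\<And>z. z \<in> ball p R \<Longrightarrow> g z = exp (k z)"
    using holomorphic_log_near[OF _ assms(2,3)] by blast
  show ?thesis
  proof (rule that[OF *(1-3)])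
    show "f z = (z - p) * exp (k z)" if "z \<in> ball p R" for z
      using *(4)[OF that] assms(4) by (auto simp: g_def divide_eq_eq mult.commute split: if_splits)
  qed
qed

lemma deriv_E4_at_zero: "Im p > 0 \<Longrightarrow> E4 p = 0 \<Longrightarrow> deriv E4 p = - tpi * E6 p / 3"
  using DERIV_imp_deriv[OF E4_has_derivative[of p]] by simp

lemma deriv_E6_at_zero: "Im p > 0 \<Longrightarrow> E6 p = 0 \<Longrightarrow> deriv E6 p = - tpi * E4 p ^ 2 / 2"
  using DERIV_imp_deriv[OF E6_has_derivative[of p]] by simp

text \<open>Zeros of \<open>E4\<close> and \<open>E6\<close> are simple: by Ramanujan's equations
  the derivative at a zero is a non-zero multiple of a power of the other form, and both cannot
  vanish at once because \<open>discr\<close> does not.\<close>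

lemma local_factorization:
  assumes p: "Im p > 0"
  obtains R k4 k6 kD where "R > 0" "ball p R \<subseteq> upper_half_plane"
    "k4 holomorphic_on ball p R" "k6 holomorphic_on ball p R" "kD holomorphic_on ball p R"
    "\<And>z. z \<in> ball p R \<Longrightarrow> E4 z = (z - p) ^ of_bool (E4 p = 0) * exp (k4 z)"
    "\<And>z. z \<in> ball p R \<Longrightarrow> E6 z = (z - p) ^ of_bool (E6 p = 0) * exp (k6 z)"
    "\<And>z. z \<in> ball p R \<Longrightarrow> discr z = exp (kD z)"
proof -
  have pU: "p \<in> upper_half_plane" using p by simp
  obtain R1 k4 where 1: "R1 > 0" "ball p R1 \<subseteq> upper_half_plane" "k4 holomorphic_on ball p R1"
    "\<And>z. z \<in> ball p R1 \<Longrightarrow> E4 z = (z - p) ^ of_bool (E4 p = 0) * exp (k4 z)"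
  proof (cases "E4 p = 0")
    case True
    then have "deriv E4 p \<noteq> 0"
      using deriv_E4_at_zero[OF p] E4_E6_not_both_zero[OF p] by simp
    then obtain R k where "R > 0" "ball p R \<subseteq> upper_half_plane" "k holomorphic_on ball p R"
      "\<And>z. z \<in> ball p R \<Longrightarrow> E4 z = (z - p) * exp (k z)"
      by (rule holomorphic_simple_zero_log[OF E4_holomorphic open_upper_half_plane pU True]) (rule that)
    then show ?thesis using that[of R k] True by simp
  next
    case False
    then obtain R k where "R > 0" "ball p R \<subseteq> upper_half_plane" "k holomorphic_on ball p R"
      "\<And>z. z \<in> ball p R \<Longrightarrow> E4 z = exp (k z)"
      by (rule holomorphic_log_near[OF E4_holomorphic open_upper_half_plane pU]) (rule that)
    then show ?thesis using that[of R k] False by simp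
  qed
  obtain R2 k6 where 2: "R2 > 0" "ball p R2 \<subseteq> upper_half_plane" "k6 holomorphic_on ball p R2"
    "\<And>z. z \<in> ball p R2 \<Longrightarrow> E6 z = (z - p) ^ of_bool (E6 p = 0) * exp (k6 z)"
  proof (cases "E6 p = 0")
    case True
    then have "deriv E6 p \<noteq> 0"
      using deriv_E6_at_zero[OF p] E4_E6_not_both_zero[OF p] by auto
    then obtain R k where "R > 0" "ball p R \<subseteq> upper_half_plane" "k holomorphic_on ball p R"
      "\<And>z. z \<in> ball p R \<Longrightarrow> E6 z = (z - p) * exp (k z)"
      by (rule holomorphic_simple_zero_log[OF E6_holomorphic open_upper_half_plane pU True]) (rule that)
    then show ?thesis using that[of R k] True by simp
  next
    case False
    then obtain R k where "R > 0" "ball p R \<subseteq> upper_half_plane" "k holomorphic_on ball p R"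
      "\<And>z. z \<in> ball p R \<Longrightarrow> E6 z = exp (k z)"
      by (rule holomorphic_log_near[OF E6_holomorphic open_upper_half_plane pU]) (rule that)
    then show ?thesis using that[of R k] False by simp
  qed
  obtain R3 kD where 3: "R3 > 0" "ball p R3 \<subseteq> upper_half_plane" "kD holomorphic_on ball p R3"
    "\<And>z. z \<in> ball p R3 \<Longrightarrow> discr z = exp (kD z)"
    by (rule holomorphic_log_near[OF discr_holomorphic open_upper_half_plane pU discr_nonzero[OF p]]) (rule that)
  define R where "R = min R1 (min R2 R3)"
  have sub: "ball p R \<subseteq> ball p R1" "ball p R \<subseteq> ball p R2" "ball p R \<subseteq> ball p R3"
    by (auto simp: R_def)
  show ?thesis
  proof (rule that)
    show "R > 0" using 1 2 3 by (simp add: R_def)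
    show "ball p R \<subseteq> upper_half_plane" using sub(1) 1(2) by blast
    show "k4 holomorphic_on ball p R" "k6 holomorphic_on ball p R" "kD holomorphic_on ball p R"
      using 1(3) 2(3) 3(3) sub by (auto intro: holomorphic_on_subset)
  qed (use 1(4) 2(4) 3(4) sub in blast)+
qed

lemma cusp_factorization:
  obtains R k4 k6 kD where "0 < R" "R < 1"
    "k4 holomorphic_on ball 0 R" "k6 holomorphic_on ball 0 R" "kD holomorphic_on ball 0 R"
    "\<And>q. q \<in> ball 0 R \<Longrightarrow> e4 q = exp (k4 q)"
    "\<And>q. q \<in> ball 0 R \<Longrightarrow> e6 q = exp (k6 q)"
    "\<And>q. q \<in> ball 0 R \<Longrightarrow> e4 q ^ 3 - e6 q ^ 2 = q * exp (kD q)"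
proof -
  have e: "e4 holomorphic_on ball 0 1" "e6 holomorphic_on ball 0 1"
    by (auto intro!: holomorphic_intros)
  have d: "(e4 has_field_derivative 240) (at 0)" "(e6 has_field_derivative -504) (at 0)"
    using holomorphic_derivI[OF e(1), of 0] holomorphic_derivI[OF e(2), of 0]
    by (simp_all add: deriv_e4_0 deriv_e6_0)
  have 0: "(0::complex) \<in> ball 0 1" by simp
  have e0: "e4 0 \<noteq> 0" "e6 0 \<noteq> 0" by simp_all
  obtain R1 k4 where 1: "R1 > 0" "ball 0 R1 \<subseteq> ball (0::complex) 1" "k4 holomorphic_on ball 0 R1" "\<And>q. q \<in> ball 0 R1 \<Longrightarrow> e4 q = exp (k4 q)"
    by (rule holomorphic_log_near[OF e(1) open_ball 0 e0(1)]) (rule that)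
  obtain R2 k6 where 2: "R2 > 0" "ball 0 R2 \<subseteq> ball (0::complex) 1" "k6 holomorphic_on ball 0 R2" "\<And>q. q \<in> ball 0 R2 \<Longrightarrow> e6 q = exp (k6 q)"
    by (rule holomorphic_log_near[OF e(2) open_ball 0 e0(2)]) (rule that)
  have "((\<lambda>q. e4 q ^ 3 - e6 q ^ 2) has_field_derivative 1728) (at 0)"
    by (auto intro!: derivative_eq_intros d)
  then have D: "deriv (\<lambda>q. e4 q ^ 3 - e6 q ^ 2) 0 \<noteq> 0" by (simp add: DERIV_imp_deriv)
  obtain R3 kD where 3: "R3 > 0" "kD holomorphic_on ball 0 R3"
    "\<And>q. q \<in> ball 0 R3 \<Longrightarrow> e4 q ^ 3 - e6 q ^ 2 = q * exp (kD q)"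
  proof -
    have h: "(\<lambda>q. e4 q ^ 3 - e6 q ^ 2) holomorphic_on ball 0 1" by (intro holomorphic_intros) auto
    have h0: "e4 0 ^ 3 - e6 0 ^ 2 = 0" by simp
    obtain R k where "R > 0" "ball 0 R \<subseteq> ball (0::complex) 1" "k holomorphic_on ball 0 R" "\<And>q. q \<in> ball 0 R \<Longrightarrow> e4 q ^ 3 - e6 q ^ 2 = (q - 0) * exp (k q)"
      by (rule holomorphic_simple_zero_log[OF h open_ball 0 h0 D]) (rule that)
    then show ?thesis using that[of R k] by simp
  qed
  define R where "R = min (1/2) (min R1 (min R2 R3))"
  have sub: "ball 0 R \<subseteq> ball (0::complex) R1" "ball 0 R \<subseteq> ball (0::complex) R2" "ball 0 R \<subseteq> ball (0::complex) R3"
    by (auto simp: R_def)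
  show ?thesis
  proof (rule that)
    show "R > 0" "R < 1" using 1 2 3 by (simp_all add: R_def)
    show "k4 holomorphic_on ball 0 R" "k6 holomorphic_on ball 0 R" "kD holomorphic_on ball 0 R"
      using 1(3) 2(3) 3(2) sub by (auto intro: holomorphic_on_subset)
  qed (use 1(4) 2(4) 3(3) sub in blast)+
qed

section \<open>Slit discs and monodromy\<close>

lemma open_slit_ball: "open (slit_ball p R)"
proof -
  have "open ((\<lambda>z. z - p) -` (- \<real>\<^sub>\<le>\<^sub>0))"
    by (intro continuous_open_vimage open_Compl closed_nonpos_Reals_complex) (auto intro!: continuous_intros)
  then have "open (ball p R \<inter> (\<lambda>z. z - p) -` (- \<real>\<^sub>\<le>\<^sub>0))" by (intro open_Int) auto
  then show ?thesis by (simp add: slit_ball_def vimage_def Int_def)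
qed

text \<open>The slit disc is star-shaped about a point on the ray opposite to the slit.\<close>

lemma connected_slit_ball: "connected (slit_ball p R)"
proof (cases "R > 0")
  case True
  have "starlike (slit_ball p R)"
    unfolding starlike_def
  proof (intro bexI ballI subsetI)
    let ?a = "p + of_real (R / 2)"
    show a: "?a \<in> slit_ball p R" using True by (auto simp: slit_ball_def dist_norm complex_nonpos_Reals_iff)
    fix z w assume z: "z \<in> slit_ball p R" and w: "w \<in> closed_segment ?a z"
    have "closed_segment ?a z \<subseteq> ball p R"
      using a z by (intro closed_segment_subset convex_ball) (auto simp: slit_ball_def)
    then have wb: "w \<in> ball p R" using w by blast
    obtain u where u: "0 \<le> u" "u \<le> 1" "w = (1 - u) *\<^sub>R ?a + u *\<^sub>R z"
      using w by (auto simp: in_segment)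
    have wp: "w - p = of_real ((1 - u) * (R / 2)) + of_real u * (z - p)"
      unfolding u(3) by (simp add: scaleR_conv_of_real algebra_simps)
    have zp: "z - p \<notin> \<real>\<^sub>\<le>\<^sub>0" using z by (simp add: slit_ball_def)
    have "w - p \<notin> \<real>\<^sub>\<le>\<^sub>0"
    proof
      assume *: "w - p \<in> \<real>\<^sub>\<le>\<^sub>0"
      then have I: "u * Im (z - p) = 0" and Re: "(1 - u) * (R / 2) + u * Re (z - p) \<le> 0"
        unfolding wp complex_nonpos_Reals_iff by auto
      show False
      proof (cases "u = 0")
        case True
        then show ?thesis using Re \<open>R > 0\<close> by simp
      next
        case False
        then have "Im (z - p) = 0" using I by simp
        then have "Re (z - p) > 0" using zp by (auto simp: complex_nonpos_Reals_iff)
        then have "u * Re (z - p) > 0" using False u by simp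
        moreover have "(1 - u) * (R / 2) \<ge> 0" using u True by simp
        ultimately show ?thesis using Re by linarith
      qed
    qed
    then show "w \<in> slit_ball p R" using wb by (simp add: slit_ball_def)
  qed
  then show ?thesis by (rule starlike_imp_connected)
next
  case False
  then have "ball p R = {}" by simp
  then have "slit_ball p R = {}" unfolding slit_ball_def by blast
  then show ?thesis by simp
qed

lemma slit_ball_subset: "slit_ball p R \<subseteq> ball p R - {p}"
  by (auto simp: slit_ball_def)

lemma slit_ball_mono: "R \<le> R' \<Longrightarrow> slit_ball p R \<subseteq> slit_ball p R'"
  by (auto simp: slit_ball_def)

lemma Ln_slit_ball_holomorphic: "(\<lambda>z. Ln (z - p)) holomorphic_on slit_ball p R"
  by (intro holomorphic_intros) (auto simp: slit_ball_def)

text \<open>Going around the singularity, that is replacing \<open>w\<close> by \<open>w + 2 \<pi> \<i>\<close>, multiplies the right-hand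
  side by a constant, which a logarithmic term does not allow.\<close>

lemma no_logarithm:
  fixes g h M :: "complex \<Rightarrow> complex"
  assumes R: "R > 0" and gh: "g holomorphic_on ball 0 R" "h holomorphic_on ball 0 R"
    and M: "M holomorphic_on ball 0 R - {0}"
    and eq: "\<And>w. Re w < ln R \<Longrightarrow> \<bar>Im w\<bar> < pi \<Longrightarrow>
      exp (\<alpha> * w) * (g (exp w) + h (exp w) * w) = exp (\<beta> * w) * M (exp w)"
    and \<zeta>: "\<zeta> \<in> ball 0 R"
  shows "h \<zeta> = 0"
proof -
  define S where "S = {w. Re w < ln R}"
  have S: "open S" "connected S"
    unfolding S_def by (simp_all add: open_halfspace_Re_lt convex_connected convex_halfspace_Re_lt)
  have expS: "exp w \<in> ball 0 R - {0}" if "w \<in> S" for w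
  proof -
    have "exp (Re w) < exp (ln R)" using that unfolding S_def by simp
    then show ?thesis using R by (simp add: norm_exp_eq_Re)
  qed
  define F where "F w = exp (\<alpha> * w) * (g (exp w) + h (exp w) * w) - exp (\<beta> * w) * M (exp w)" for w
  have comp: "(\<lambda>w. f (exp w)) holomorphic_on S" if "f holomorphic_on ball 0 R - {0}" for f
    by (rule holomorphic_on_compose_gen[unfolded o_def, where f = exp and t = "ball 0 R - {0}"])
      (use expS that in \<open>auto intro!: holomorphic_intros\<close>)
  have gh': "g holomorphic_on ball 0 R - {0}" "h holomorphic_on ball 0 R - {0}"
    using gh by (auto intro: holomorphic_on_subset)
  have F: "F holomorphic_on S"
    unfolding F_def by (intro holomorphic_intros comp gh' M)
  define T where "T = S \<inter> {w. \<bar>Im w\<bar> < pi}"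
  have T: "open T"
  proof -
    have "{w. \<bar>Im w\<bar> < pi} = {w. Im w < pi} \<inter> {w. Im w > - pi}" by auto
    then show ?thesis
      unfolding T_def using S(1) by (auto intro!: open_Int open_halfspace_Im_lt open_halfspace_Im_gt)
  qed
  have "of_real (ln R - 1) \<in> T" by (simp add: T_def S_def)
  then have T0: "T \<noteq> {}" by blast
  \<comment> \<open>Only |Im w| < \<pi> is given, the range of the principal branch. Both sides are
    holomorphic in w on the whole half-plane, so the identity persists there and w may turn around
    the singularity.\<close>
  have F0: "F w = 0" if "w \<in> S" for w
    by (rule analytic_continuation_open[OF T S(1) T0 S(2) _ F holomorphic_on_const _ that])
      (auto simp: T_def S_def F_def eq)
  define \<mu> where "\<mu> = exp ((\<alpha> - \<beta>) * (2 * of_real pi * \<i>))"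
  have shift: "w + 2 * of_real pi * \<i> \<in> S" if "w \<in> S" for w using that by (simp add: S_def)
  have per: "exp (w + 2 * of_real pi * \<i>) = exp w" for w by (simp add: exp_add)
  have step: "(\<mu> - 1) * (g (exp w) + h (exp w) * w) + \<mu> * (2 * of_real pi * \<i>) * h (exp w) = 0" if w: "w \<in> S" for w
  proof -
    define c where "c = 2 * of_real pi * \<i>"
    have 1: "exp (\<alpha> * w) * (g (exp w) + h (exp w) * w) = exp (\<beta> * w) * M (exp w)"
      using F0[OF w] by (simp add: F_def)
    have "exp (\<alpha> * (w + c)) * (g (exp w) + h (exp w) * (w + c)) = exp (\<beta> * (w + c)) * M (exp w)"
      using F0[OF shift[OF w]] by (simp add: F_def per c_def)
    then have "exp (\<alpha> * w) * exp (\<alpha> * c) * (g (exp w) + h (exp w) * (w + c)) = exp (\<beta> * c) * (exp (\<beta> * w) * M (exp w))"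
      by (simp add: distrib_left exp_add mult_ac)
    also have "\<dots> = exp (\<beta> * c) * (exp (\<alpha> * w) * (g (exp w) + h (exp w) * w))" using 1 by simp
    finally have 2: "exp (\<alpha> * c) * (g (exp w) + h (exp w) * (w + c)) = exp (\<beta> * c) * (g (exp w) + h (exp w) * w)"
      by (simp add: mult_ac)
    have "exp (\<alpha> * c) = \<mu> * exp (\<beta> * c)"
      by (simp add: \<mu>_def c_def exp_add[symmetric] algebra_simps)
    with 2 have "\<mu> * (g (exp w) + h (exp w) * (w + c)) = g (exp w) + h (exp w) * w"
      by (simp add: mult_ac)
    then show ?thesis unfolding c_def[symmetric] by (simp add: algebra_simps)
  qed
  \<comment> \<open>Subtracting \<open>step\<close> at w from \<open>step\<close> at w + 2 \<pi> i
    leaves (\<mu> - 1) h = 0 up to a non-zero factor. If \<mu> = 1, then \<open>step\<close> itself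
    is a non-zero multiple of h.\<close>
  have hexp: "h (exp w) = 0" if w: "w \<in> S" for w
  proof -
    have "(\<mu> - 1) * (g (exp w) + h (exp w) * (w + 2 * of_real pi * \<i>)) + \<mu> * (2 * of_real pi * \<i>) * h (exp w) = 0"
      using step[OF shift[OF w]] unfolding per .
    with step[OF w] have "(\<mu> - 1) * (h (exp w) * (2 * of_real pi * \<i>)) = 0" by algebra
    then have "\<mu> = 1 \<or> h (exp w) = 0" by simp
    then show ?thesis using step[OF w] by auto
  qed
  have h0: "h z = 0" if "z \<in> ball 0 R - {0}" for z
  proof -
    have "Ln z \<in> S" using that R by (simp add: S_def)
    from hexp[OF this] show ?thesis using that by simp
  qed
  show ?thesis
  proof (rule analytic_continuation_open[of "ball 0 R - {0}" "ball 0 R" h "\<lambda>_. 0"])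
    have "of_real (R / 2) \<in> ball (0::complex) R - {0}" using R by simp
    then show "ball (0::complex) R - {0} \<noteq> {}" by blast
  qed (use gh h0 \<zeta> in auto)
qed

section \<open>Wronskians and polynomial solutions\<close>

lemma solution_on_derivatives:
  assumes "solution_on Q V y" "open V" "z \<in> V"
  shows "(y has_field_derivative deriv y z) (at z)" "(deriv y has_field_derivative Q z * y z) (at z)"
proof -
  have y: "y holomorphic_on V" using assms(1) by (simp add: solution_on_def)
  then show "(y has_field_derivative deriv y z) (at z)" using assms by (intro holomorphic_derivI)
  have "(deriv y has_field_derivative deriv (deriv y) z) (at z)"
    using holomorphic_derivI[OF holomorphic_deriv[OF y assms(2)] assms(2,3)] .
  moreover have "deriv (deriv y) z = Q z * y z"
    using assms(1,3) by (simp add: solution_on_def numeral_2_eq_2)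
  ultimately show "(deriv y has_field_derivative Q z * y z) (at z)" by simp
qed

lemma solution_on_subset: "solution_on Q V y \<Longrightarrow> W \<subseteq> V \<Longrightarrow> solution_on Q W y"
  unfolding solution_on_def by (auto intro: holomorphic_on_subset)

lemma wronskian_constant:
  assumes V: "open V" "connected V" and y: "solution_on Q V y1" "solution_on Q V y2"
  shows "\<exists>c. \<forall>z\<in>V. y1 z * deriv y2 z - deriv y1 z * y2 z = c"
proof -
  let ?W = "\<lambda>z. y1 z * deriv y2 z - deriv y1 z * y2 z"
  have "(?W has_field_derivative 0) (at z)" if z: "z \<in> V" for z
    by (auto intro!: derivative_eq_intros solution_on_derivatives[OF y(1) V(1) z]
        solution_on_derivatives[OF y(2) V(1) z])
  then show ?thesis
    using has_field_derivative_0_imp_constant_on[OF _ V(2,1), of ?W] unfolding constant_on_def by blast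
qed

text \<open>Cramer's rule, with coefficients that are quotients of Wronskians and hence
  constant.\<close>

lemma solution_combination:
  assumes V: "open V" "connected V" and y: "solution_on Q V y" "solution_on Q V y1" "solution_on Q V y2"
    and W: "\<exists>z\<in>V. y1 z * deriv y2 z - deriv y1 z * y2 z \<noteq> 0"
  obtains c1 c2 where "\<And>z. z \<in> V \<Longrightarrow> y z = c1 * y1 z + c2 * y2 z"
proof -
  obtain w a b where w: "\<And>z. z \<in> V \<Longrightarrow> y1 z * deriv y2 z - deriv y1 z * y2 z = w"
    and a: "\<And>z. z \<in> V \<Longrightarrow> y z * deriv y2 z - deriv y z * y2 z = a"
    and b: "\<And>z. z \<in> V \<Longrightarrow> y1 z * deriv y z - deriv y1 z * y z = b"
    using wronskian_constant[OF V y(2,3)] wronskian_constant[OF V y(1,3)] wronskian_constant[OF V y(2,1)] by blast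
  have w0: "w \<noteq> 0" using W w by auto
  have "y z = a / w * y1 z + b / w * y2 z" if z: "z \<in> V" for z
  proof -
    have "w * y z = a * y1 z + b * y2 z"
      unfolding w[OF z, symmetric] a[OF z, symmetric] b[OF z, symmetric] by algebra
    then show ?thesis using w0 by (simp add: field_simps)
  qed
  then show ?thesis using that by blast
qed

text \<open>By the chain rule the derivative of the polynomial vanishes on the image too, which
  reduces the degree down to that of a constant.\<close>

lemma poly_vanishes_on_image:
  fixes p :: "complex poly"
  assumes V: "open V" "V \<noteq> {}" and x: "\<And>z. z \<in> V \<Longrightarrow> (x has_field_derivative x' z) (at z)" "\<And>z. z \<in> V \<Longrightarrow> x' z \<noteq> 0"
  shows "(\<And>z. z \<in> V \<Longrightarrow> poly p (x z) = 0) \<Longrightarrow> p = 0"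
proof (induction "degree p" arbitrary: p)
  case 0
  then obtain c where "p = [:c:]" by (metis degree_eq_zeroE)
  then show ?case using 0 V by auto
next
  case (Suc n)
  have "poly (pderiv p) (x z) = 0" if z: "z \<in> V" for z
  proof -
    have "((\<lambda>z. poly p (x z)) has_field_derivative poly (pderiv p) (x z) * x' z) (at z)"
      by (rule DERIV_chain2[OF poly_DERIV x(1)[OF z]])
    moreover have "((\<lambda>z. poly p (x z)) has_field_derivative 0) (at z)"
      by (rule has_field_derivative_transform_within_open[where f = "\<lambda>_. 0" and S = V])
        (use Suc.prems V z in auto)
    ultimately have "poly (pderiv p) (x z) * x' z = 0" by (rule DERIV_unique)
    then show ?thesis using x(2)[OF z] by simp
  qed
  moreover have "n = degree (pderiv p)" using Suc.hyps(2) by (simp add: degree_pderiv)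
  ultimately have "pderiv p = 0" using Suc.hyps(1) by blast
  then show ?case using Suc.hyps(2) by (simp add: pderiv_eq_0_iff)
qed

lemma hypergeometric_polynomial:
  fixes \<gamma> \<epsilon> P :: complex and c :: "nat \<Rightarrow> complex"
  assumes rec: "\<And>k. (of_nat k + 1) * (of_nat k + \<gamma>) * c (Suc k) =
      (of_nat k * (of_nat k - 1) + \<epsilon> * of_nat k + P) * c k"
    and zero: "\<And>k. k > N \<Longrightarrow> c k = 0"
  obtains p where "\<And>k. coeff p k = c k"
    "[:0, 1, -1:] * pderiv (pderiv p) + [:\<gamma>, - \<epsilon>:] * pderiv p - smult P p = 0"
proof
  define p where "p = (\<Sum>k\<le>N. monom (c k) k)"
  show coeff: "coeff p k = c k" for k
    using zero[of k] by (simp add: p_def coeff_sum)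
  show "[:0, 1, -1:] * pderiv (pderiv p) + [:\<gamma>, - \<epsilon>:] * pderiv p - smult P p = 0" (is "?E = 0")
  proof (rule poly_eqI)
    fix k
    have "coeff ?E k = (of_nat k + 1) * (of_nat k + \<gamma>) * c (Suc k) -
        (of_nat k * (of_nat k - 1) + \<epsilon> * of_nat k + P) * c k"
      by (cases k; cases "k - 1")
        (auto simp: coeff coeff_pderiv coeff_pCons algebra_simps split: nat.splits)
    then show "coeff ?E k = coeff 0 k" using rec[of k] by simp
  qed
qed

text \<open>Under the triangle and parity conditions the hypergeometric series with exponents \<open>0\<close> and
  \<open>n\<^sub>f\<close> at \<open>0\<close> both terminate, in degrees \<open>M = (n\<^sub>i + n\<^sub>f - n\<^sub>r - 1) / 2 < n\<^sub>f\<close> and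
  \<open>N = (n\<^sub>i + n\<^sub>f + n\<^sub>r - 1) / 2 \<ge> n\<^sub>f\<close>.\<close>

lemma two_polynomial_solutions:
  fixes ni nr nf :: nat
  assumes pos: "nf > 0" and odd: "odd (ni + nr + nf)"
    and tri: "ni + nr > nf" "ni + nf > nr" "nr + nf > ni"
  defines "P \<equiv> ((1 - of_nat ni - of_nat nf) ^ 2 - of_nat nr ^ 2) / 4 :: complex"
  obtains u v where
    "[:0, 1, -1:] * pderiv (pderiv u) + [:1 - of_nat nf, - (2 - of_nat ni - of_nat nf):] * pderiv u - smult P u = 0"
    "[:0, 1, -1:] * pderiv (pderiv v) + [:1 - of_nat nf, - (2 - of_nat ni - of_nat nf):] * pderiv v - smult P v = 0"
    "u * pderiv v - pderiv u * v \<noteq> 0"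
proof -
  obtain M where M: "ni + nf = nr + 1 + 2 * M"
  proof -
    obtain j where "ni + nr + nf = 2 * j + 1" using odd by (elim oddE)
    then show ?thesis using that[of "j - nr"] tri by simp
  qed
  define N where "N = M + nr"
  have N: "ni + nf + nr = 2 * N + 1" using M by (simp add: N_def)
  have MN: "M < nf" "nf \<le> N" using M N tri by linarith+
  define I :: "nat \<Rightarrow> complex" where "I k = of_nat k * (of_nat k - 1) + (2 - of_nat ni - of_nat nf) * of_nat k + P" for k
  have I: "I k = (of_nat k - of_nat M) * (of_nat k - of_nat N)" for k
  proof -
    have 1: "(of_nat ni :: complex) = of_nat nr + 1 + 2 * of_nat M - of_nat nf"
      using arg_cong[OF M, of "of_nat :: nat \<Rightarrow> complex"] by (simp add: algebra_simps)
    have 2: "(of_nat N :: complex) = of_nat M + of_nat nr" by (simp add: N_def)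
    show ?thesis unfolding I_def P_def 1 2 by (simp add: field_simps power2_eq_square)
  qed
  define D :: "nat \<Rightarrow> complex" where "D k = (of_nat k + 1) * (of_nat k + (1 - of_nat nf))" for k
  have D0: "D k = 0 \<longleftrightarrow> Suc k = nf" for k
  proof -
    have "(of_nat k + 1 :: complex) = of_nat (Suc k)" by simp
    moreover have "of_nat k + (1 - of_nat nf) = (of_nat (Suc k) - of_nat nf :: complex)" by simp
    ultimately show ?thesis unfolding D_def by (metis eq_iff_diff_eq_0 mult_eq_0_iff nat.distinct(1) of_nat_eq_0_iff of_nat_eq_iff)
  qed
  \<comment> \<open>The series starts with 1 at index s. The only zero of D is at k = nf - 1: for s
    = nf it is never divided by, and for s = 0 the factor I M = 0 with M < nf makes both sides of
    the recursion vanish there.\<close>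
  define a :: "nat \<Rightarrow> nat \<Rightarrow> complex" where "a s k = (if k < s then 0 else \<Prod>j\<in>{s..<k}. I j / D j)" for s k
  have a_zero: "a s k = 0" if "K < k" "s \<le> K" "I K = 0" for s k K
    using that by (auto simp: a_def)
  have IM: "I M = 0" and IN: "I N = 0" by (simp_all add: I)
  have rec: "D k * a s (Suc k) = I k * a s k" if "s = 0 \<or> s = nf" for s k
  proof (cases "Suc k < s")
    case True
    then show ?thesis by (simp add: a_def)
  next
    case False
    show ?thesis
    proof (cases "Suc k = s")
      case True
      then have "s = nf" using that by auto
      then have "D k = 0" using True D0 by simp
      then show ?thesis using True by (simp add: a_def)
    next
      case neq: False
      then have ks: "s \<le> k" using False by simp
      have r: "a s (Suc k) = a s k * (I k / D k)" using ks by (simp add: a_def)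
      show ?thesis
      proof (cases "D k = 0")
        case True
        then have kn: "Suc k = nf" using D0 by simp
        then have "s = 0" using that ks by auto
        moreover have "I k * a 0 k = 0"
          using IM a_zero[of M k 0] kn MN(1) by (cases "k = M") auto
        ultimately show ?thesis using True by simp
      next
        case False
        then show ?thesis using r by simp
      qed
    qed
  qed
  have rec': "(of_nat k + 1) * (of_nat k + (1 - of_nat nf)) * a s (Suc k) =
      (of_nat k * (of_nat k - 1) + (2 - of_nat ni - of_nat nf) * of_nat k + P) * a s k" if "s = 0 \<or> s = nf" for s k
    using rec[OF that, of k] by (simp add: D_def I_def)
  obtain u where u: "\<And>k. coeff u k = a 0 k"
    "[:0, 1, -1:] * pderiv (pderiv u) + [:1 - of_nat nf, - (2 - of_nat ni - of_nat nf):] * pderiv u - smult P u = 0"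
    using hypergeometric_polynomial[of "1 - of_nat nf" "a 0" "2 - of_nat ni - of_nat nf" P M] rec'[of 0] a_zero[of M _ 0] IM
    by blast
  obtain v where v: "\<And>k. coeff v k = a nf k"
    "[:0, 1, -1:] * pderiv (pderiv v) + [:1 - of_nat nf, - (2 - of_nat ni - of_nat nf):] * pderiv v - smult P v = 0"
    using hypergeometric_polynomial[of "1 - of_nat nf" "a nf" "2 - of_nat ni - of_nat nf" P N] rec'[of nf] a_zero[of N _ nf] IN MN(2)
    by blast
  \<comment> \<open>u begins with 1 and v with x^nf, so the lowest term of the Wronskian is nf *
    x^(nf - 1). This coefficient is computed.\<close>
  obtain n where n: "nf = Suc n" using pos by (cases nf) auto
  have "coeff (u * pderiv v) n = (\<Sum>i\<le>n. if i = 0 then of_nat nf else 0)"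
    unfolding coeff_mult by (rule sum.cong) (auto simp: coeff_pderiv u v a_def n)
  also have "\<dots> = of_nat nf" by simp
  finally have 1: "coeff (u * pderiv v) n = of_nat nf" .
  have 2: "coeff (pderiv u * v) n = 0"
    unfolding coeff_mult by (rule sum.neutral) (auto simp: v a_def n)
  have "coeff (u * pderiv v - pderiv u * v) n \<noteq> 0" using 1 2 pos by simp
  then have "u * pderiv v - pderiv u * v \<noteq> 0" by auto
  with u(2) v(2) show ?thesis using that by blast
qed

section \<open>Local exponents and poles of the equation\<close>

lemma exponents_poly_iff:
  fixes \<kappa> a :: complex
  shows "[:- a, -1, 1:] = [:- (1/2 + \<kappa>), 1:] * [:- (1/2 - \<kappa>), 1:] \<longleftrightarrow> a = \<kappa> ^ 2 - 1/4"
proof -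
  have "[:- (1/2 + \<kappa>), 1:] * [:- (1/2 - \<kappa>), 1:] = [:1/4 - \<kappa> ^ 2, -1, 1:]"
    by (simp add: algebra_simps power2_eq_square)
  moreover have "- a = 1/4 - \<kappa> ^ 2 \<longleftrightarrow> a = \<kappa> ^ 2 - 1/4"
    by (metis minus_diff_eq neg_equal_iff_equal)
  ultimately show ?thesis by simp
qed

text \<open>\<open>A p\<close> is the limit of (z - p)^2 Q z, so the function A hidden in the
  definition may be replaced by any concrete one.\<close>

lemma local_exponents_at_iff:
  fixes \<kappa> :: complex
  assumes R: "R > 0" and A: "A holomorphic_on ball p R"
    and Q: "\<And>z. z \<in> ball p R - {p} \<Longrightarrow> Q z = A z / (z - p) ^ 2"
  shows "local_exponents_at Q p (1/2 + \<kappa>) (1/2 - \<kappa>) \<longleftrightarrow> A p = \<kappa> ^ 2 - 1/4"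
proof
  assume "A p = \<kappa> ^ 2 - 1/4"
  then show "local_exponents_at Q p (1/2 + \<kappa>) (1/2 - \<kappa>)"
    unfolding local_exponents_at_def exponents_poly_iff using R A Q by blast
next
  assume "local_exponents_at Q p (1/2 + \<kappa>) (1/2 - \<kappa>)"
  then obtain R' A' where *: "R' > 0" "A' holomorphic_on ball p R'"
    "\<And>z. z \<in> ball p R' - {p} \<Longrightarrow> Q z = A' z / (z - p) ^ 2" "A' p = \<kappa> ^ 2 - 1/4"
    unfolding local_exponents_at_def exponents_poly_iff by blast
  have "isCont A p" "isCont A' p"
    using A *(2) R *(1) by (auto intro!: continuous_on_interior[OF holomorphic_on_imp_continuous_on])
  then have lim: "A \<midarrow>p\<rightarrow> A p" "A' \<midarrow>p\<rightarrow> A' p" by (auto simp: isCont_def)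
  have "\<forall>\<^sub>F z in at p. z \<in> ball p (min R R') - {p}"
    using R *(1) by (intro eventually_at_in_open) auto
  then have "\<forall>\<^sub>F z in at p. A z = A' z"
  proof eventually_elim
    case (elim z)
    then show ?case using Q[of z] *(3)[of z] by auto
  qed
  then have "A' \<midarrow>p\<rightarrow> A p" using lim(1) by (rule Lim_transform_eventually[rotated])
  from LIM_unique[OF this lim(2)] show "A p = \<kappa> ^ 2 - 1/4" using *(4) by simp
qed

lemma exponents_infinity_poly_iff:
  fixes \<kappa> a :: complex
  shows "[:a / (4 * of_real pi ^ 2), 0, 1:] = [:- \<kappa>, 1:] * [:- (- \<kappa>), 1:] \<longleftrightarrow> a = - (4 * of_real pi ^ 2 * \<kappa> ^ 2)"
  by (auto simp: field_simps power2_eq_square)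

lemma local_exponents_infinity_iff:
  fixes \<kappa> :: complex
  assumes R: "R > 0" and G: "G holomorphic_on ball 0 R"
    and Q: "\<And>z. nome z \<in> ball 0 R \<Longrightarrow> Q z = G (nome z)"
  shows "local_exponents_infinity Q \<kappa> (- \<kappa>) \<longleftrightarrow> G 0 = - (4 * of_real pi ^ 2 * \<kappa> ^ 2)"
proof
  assume "G 0 = - (4 * of_real pi ^ 2 * \<kappa> ^ 2)"
  then show "local_exponents_infinity Q \<kappa> (- \<kappa>)"
    unfolding local_exponents_infinity_def exponents_infinity_poly_iff using R G Q by blast
next
  assume "local_exponents_infinity Q \<kappa> (- \<kappa>)"
  then obtain R' G' where *: "R' > 0" "G' holomorphic_on ball 0 R'"
    "\<And>z. nome z \<in> ball 0 R' \<Longrightarrow> Q z = G' (nome z)" "G' 0 = - (4 * of_real pi ^ 2 * \<kappa> ^ 2)"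
    unfolding local_exponents_infinity_def exponents_infinity_poly_iff by blast
  have "isCont G 0" "isCont G' 0"
    using G *(2) R *(1) by (auto intro!: continuous_on_interior[OF holomorphic_on_imp_continuous_on])
  then have lim: "G \<midarrow>0\<rightarrow> G 0" "G' \<midarrow>0\<rightarrow> G' 0" by (auto simp: isCont_def)
  have "\<forall>\<^sub>F q in at 0. q \<in> ball 0 (min R R') - {0}"
    using R *(1) by (intro eventually_at_in_open) auto
  then have "\<forall>\<^sub>F q in at 0. G q = G' q"
  proof eventually_elim
    case (elim q)
    then obtain z where "nome z = q" using exists_nome[of q] by auto
    then show ?case using Q[of z] *(3)[of z] elim by auto
  qed
  then have "G' \<midarrow>0\<rightarrow> G 0" using lim(1) by (rule Lim_transform_eventually[rotated])
  from LIM_unique[OF this lim(2)] show "G 0 = - (4 * of_real pi ^ 2 * \<kappa> ^ 2)" using *(4) by simp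
qed

lemma deriv_at_factored_zero:
  fixes f :: "complex \<Rightarrow> complex"
  assumes "R > 0" "k holomorphic_on ball p R" "\<And>z. z \<in> ball p R \<Longrightarrow> f z = (z - p) * exp (k z)"
  shows "deriv f p = exp (k p)"
proof -
  have k: "(k has_field_derivative deriv k p) (at p)" using assms by (intro holomorphic_derivI) auto
  have "(f has_field_derivative exp (k p)) (at p)"
    by (rule has_field_derivative_transform_within_open[where f = "\<lambda>z. (z - p) * exp (k z)" and S = "ball p R"])
      (use assms in \<open>auto intro!: derivative_eq_intros k\<close>)
  then show ?thesis by (rule DERIV_imp_deriv)
qed

text \<open>At the zero E4' = - tpi E6 / 3, hence E6^2 / E4^2 has leading coefficient 9 / tpi^2 = -
  9 / (4 \<pi>^2). At a zero of \<open>E6\<close> the same computation with E6' = - tpi E4^2 / 2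
  gives - t.\<close>

lemma ode_coeff_at_E4_zero:
  assumes p: "Im p > 0" and 0: "E4 p = 0"
  obtains R A where "R > 0" "A holomorphic_on ball p R"
    "\<And>z. z \<in> ball p R - {p} \<Longrightarrow> ode_coeff r s t z = A z / (z - p) ^ 2" "A p = - (9 * s / 4)"
proof -
  have n6: "E6 p \<noteq> 0" using E4_E6_not_both_zero[OF p 0] .
  obtain R k4 k6 where *: "R > 0" "ball p R \<subseteq> upper_half_plane"
    "k4 holomorphic_on ball p R" "k6 holomorphic_on ball p R"
    "\<And>z. z \<in> ball p R \<Longrightarrow> E4 z = (z - p) ^ of_bool (E4 p = 0) * exp (k4 z)"
    "\<And>z. z \<in> ball p R \<Longrightarrow> E6 z = (z - p) ^ of_bool (E6 p = 0) * exp (k6 z)"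
    using local_factorization[OF p] by metis
  have E: "E4 z = (z - p) * exp (k4 z)" "E6 z = exp (k6 z)" if "z \<in> ball p R" for z
    using *(5,6)[OF that] 0 n6 by simp_all
  have hE: "E4 holomorphic_on ball p R" "E6 holomorphic_on ball p R"
    using E4_holomorphic E6_holomorphic *(2) by (auto intro: holomorphic_on_subset)
  define A where "A z = of_real pi ^ 2 * (r * E4 z * (z - p) ^ 2 + s * (E6 z ^ 2 / exp (k4 z) ^ 2) +
    t * (E4 z ^ 4 * (z - p) ^ 2 / E6 z ^ 2))" for z
  show ?thesis
  proof (rule that[OF *(1)])
    show "A holomorphic_on ball p R"
      unfolding A_def by (intro holomorphic_intros hE *(3)) (auto simp: E(2))
    show "ode_coeff r s t z = A z / (z - p) ^ 2" if z: "z \<in> ball p R - {p}" for z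
    proof -
      have alg: "c * (r * a + s * (b ^ 2 / a ^ 2) + t * (a ^ 4 / b ^ 2)) =
          c * (r * a * v ^ 2 + s * (b ^ 2 / e ^ 2) + t * (a ^ 4 * v ^ 2 / b ^ 2)) / v ^ 2"
        if "a = v * e" "v \<noteq> 0" "e \<noteq> 0" "b \<noteq> 0" for a b c v e :: complex
        using that by (simp add: field_simps power_mult_distrib) (simp add: eval_nat_numeral)
      show ?thesis
        unfolding A_def ode_coeff_def by (rule alg) (use E[of z] z in auto)
    qed
    have "exp (k4 p) = - tpi * E6 p / 3"
      using deriv_at_factored_zero[OF *(1,3) E(1)] deriv_E4_at_zero[OF p 0] by simp
    then have "exp (k4 p) ^ 2 = tpi ^ 2 * E6 p ^ 2 / 9" by (simp add: power_mult_distrib power_divide)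
    then show "A p = - (9 * s / 4)"
      unfolding A_def using n6 0 by (simp add: tpi_square)
  qed
qed

lemma ode_coeff_at_E6_zero:
  assumes p: "Im p > 0" and 0: "E6 p = 0"
  obtains R A where "R > 0" "A holomorphic_on ball p R"
    "\<And>z. z \<in> ball p R - {p} \<Longrightarrow> ode_coeff r s t z = A z / (z - p) ^ 2" "A p = - t"
proof -
  have n4: "E4 p \<noteq> 0" using E4_E6_not_both_zero[OF p] 0 by auto
  obtain R k4 k6 where *: "R > 0" "ball p R \<subseteq> upper_half_plane"
    "k4 holomorphic_on ball p R" "k6 holomorphic_on ball p R"
    "\<And>z. z \<in> ball p R \<Longrightarrow> E4 z = (z - p) ^ of_bool (E4 p = 0) * exp (k4 z)"
    "\<And>z. z \<in> ball p R \<Longrightarrow> E6 z = (z - p) ^ of_bool (E6 p = 0) * exp (k6 z)"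
    using local_factorization[OF p] by metis
  have E: "E6 z = (z - p) * exp (k6 z)" "E4 z = exp (k4 z)" if "z \<in> ball p R" for z
    using *(5,6)[OF that] 0 n4 by simp_all
  have hE: "E4 holomorphic_on ball p R" "E6 holomorphic_on ball p R"
    using E4_holomorphic E6_holomorphic *(2) by (auto intro: holomorphic_on_subset)
  define A where "A z = of_real pi ^ 2 * (r * E4 z * (z - p) ^ 2 + s * (E6 z ^ 2 * (z - p) ^ 2 / E4 z ^ 2) +
    t * (E4 z ^ 4 / exp (k6 z) ^ 2))" for z
  show ?thesis
  proof (rule that[OF *(1)])
    show "A holomorphic_on ball p R"
      unfolding A_def by (intro holomorphic_intros hE *(4)) (auto simp: E(2))
    show "ode_coeff r s t z = A z / (z - p) ^ 2" if z: "z \<in> ball p R - {p}" for z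
    proof -
      have alg: "c * (r * a + s * (b ^ 2 / a ^ 2) + t * (a ^ 4 / b ^ 2)) =
          c * (r * a * v ^ 2 + s * (b ^ 2 * v ^ 2 / a ^ 2) + t * (a ^ 4 / e ^ 2)) / v ^ 2"
        if "b = v * e" "v \<noteq> 0" "e \<noteq> 0" "a \<noteq> 0" for a b c v e :: complex
        using that by (simp add: field_simps power_mult_distrib)
      show ?thesis
        unfolding A_def ode_coeff_def by (rule alg) (use E[of z] z in auto)
    qed
    have "exp (k6 p) = - tpi * E4 p ^ 2 / 2"
      using deriv_at_factored_zero[OF *(1,4) E(1)] deriv_E6_at_zero[OF p 0] by simp
    then have "exp (k6 p) ^ 2 = tpi ^ 2 * E4 p ^ 4 / 4"
      by (simp add: power_mult_distrib power_divide flip: power_mult)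
    then show "A p = - t"
      unfolding A_def using n4 0 by (simp add: tpi_square)
  qed
qed

lemma ode_coeff_at_cusp:
  obtains R G where "0 < R" "R < 1" "G holomorphic_on ball 0 R"
    "\<And>z. nome z \<in> ball 0 R \<Longrightarrow> ode_coeff r s t z = G (nome z)" "G 0 = of_real pi ^ 2 * (r + s + t)"
    "\<And>z. nome z \<in> ball 0 R \<Longrightarrow> E4 z \<noteq> 0 \<and> E6 z \<noteq> 0"
proof -
  obtain R k4 k6 where *: "0 < R" "R < 1"
    "\<And>q. q \<in> ball 0 R \<Longrightarrow> e4 q = exp (k4 q)" "\<And>q. q \<in> ball 0 R \<Longrightarrow> e6 q = exp (k6 q)"
    using cusp_factorization by metis
  define G where "G q = of_real pi ^ 2 * (r * e4 q + s * (e6 q ^ 2 / e4 q ^ 2) + t * (e4 q ^ 4 / e6 q ^ 2))" for q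
  have I: "Im z > 0" if "nome z \<in> ball 0 R" for z
    using that *(2) norm_nome_less_1_iff[of z] by simp
  show ?thesis
  proof (rule that[OF *(1,2)])
    show "G holomorphic_on ball 0 R"
      unfolding G_def using *(2) by (intro holomorphic_intros) (auto simp: *(3,4))
    show "ode_coeff r s t z = G (nome z)" if "nome z \<in> ball 0 R" for z
      unfolding ode_coeff_def G_def E4_eq_e4[OF I[OF that]] E6_eq_e6[OF I[OF that]] ..
    show "G 0 = of_real pi ^ 2 * (r + s + t)" by (simp add: G_def)
    show "E4 z \<noteq> 0 \<and> E6 z \<noteq> 0" if "nome z \<in> ball 0 R" for z
      using *(3,4)[OF that] I[OF that] by (simp add: E4_eq_e4 E6_eq_e6)
  qed
qed

lemma ode_coeff_holomorphic:
  assumes "V \<subseteq> upper_half_plane" "\<And>z. z \<in> V \<Longrightarrow> E4 z \<noteq> 0" "\<And>z. z \<in> V \<Longrightarrow> E6 z \<noteq> 0"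
  shows "ode_coeff r s t holomorphic_on V"
  unfolding ode_coeff_def
  by (intro holomorphic_intros holomorphic_on_subset[OF E4_holomorphic] holomorphic_on_subset[OF E6_holomorphic])
    (use assms in auto)

lemma open_regular_points: "open {z \<in> upper_half_plane. E4 z \<noteq> 0 \<and> E6 z \<noteq> 0}"
proof -
  have "(\<lambda>z. E4 z * E6 z) holomorphic_on upper_half_plane"
    by (intro holomorphic_intros E4_holomorphic E6_holomorphic)
  then have "open (upper_half_plane \<inter> (\<lambda>z. E4 z * E6 z) -` (- {0}))"
    by (intro continuous_open_preimage holomorphic_on_imp_continuous_on) auto
  then show ?thesis by (simp add: vimage_def Int_def)
qed

lemma pole_imp_zero:
  assumes "Im p > 0" "is_pole (ode_coeff r s t) p"
  shows "E4 p = 0 \<or> E6 p = 0"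
proof (rule ccontr)
  assume *: "\<not> ?thesis"
  have "ode_coeff r s t holomorphic_on {z \<in> upper_half_plane. E4 z \<noteq> 0 \<and> E6 z \<noteq> 0}"
    by (rule ode_coeff_holomorphic) auto
  then have "\<not> is_pole (ode_coeff r s t) p"
    using open_regular_points assms(1) * by (intro not_is_pole_holomorphic) auto
  then show False using assms(2) by simp
qed

lemma is_pole_double:
  fixes A :: "complex \<Rightarrow> complex"
  assumes "R > 0" "A holomorphic_on ball p R" "\<And>z. z \<in> ball p R - {p} \<Longrightarrow> Q z = A z / (z - p) ^ 2" "A p \<noteq> 0"
  shows "is_pole Q p"
proof -
  have A: "isCont A p"
    using assms(1,2) by (auto intro!: continuous_on_interior[OF holomorphic_on_imp_continuous_on])
  have "filterlim (\<lambda>z. (z - p) ^ 2) (at 0) (at p)"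
    by (auto simp: filterlim_at eventually_at intro!: tendsto_eq_intros exI[of _ 1])
  then have "is_pole (\<lambda>z. A z / (z - p) ^ 2) p"
    using A assms(4) by (intro is_pole_divide)
  moreover have "\<forall>\<^sub>F z in at p. z \<in> ball p R - {p}"
    using assms(1) by (intro eventually_at_in_open) auto
  then have "\<forall>\<^sub>F z in at p. Q z = A z / (z - p) ^ 2"
    by (rule eventually_mono) (rule assms(3))
  from is_pole_cong[OF this refl] have "is_pole Q p \<longleftrightarrow> is_pole (\<lambda>z. A z / (z - p) ^ 2) p" .
  ultimately show ?thesis by simp
qed

section \<open>Logarithmic solutions pulled back to the upper half-plane\<close>

context pulled_back begin

text \<open>\<open>m4\<close> and \<open>m6\<close> stand for the orders of \<open>E4\<close> and
  \<open>E6\<close> at p. All multivaluedness is collected in the first factor, a power of z - p;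
  the second one is holomorphic at p along with k4, k6 and kD.\<close>

lemma prefactor_slit:
  "prefactor (\<lambda>z. of_real m4 * Ln (z - p) + k4 z) (\<lambda>z. of_real m6 * Ln (z - p) + k6 z) kD z =
    exp (of_real (ee * m4 + (1/2 - ni) * m6) * Ln (z - p)) *
    exp (of_real ee * k4 z + of_real (1/2 - ni) * k6 z - of_real (nf / 2) * kD z)"
  unfolding prefactor_def exp_add[symmetric] by (simp add: algebra_simps)

lemma exp_Ln_slit:
  assumes "z \<in> slit_ball p R" "m \<in> {0, 1}"
  shows "exp (of_real m * Ln (z - p)) = (z - p) ^ of_bool (m = 1)"
proof -
  have "z - p \<noteq> 0" using assms slit_ball_subset by fastforce
  then show ?thesis using assms(2) by auto
qed

text \<open>The logarithmic solution at x = 1 is pulled back. As 1 - x = E6^2 / E4^3 has a double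
  zero at p, its logarithm is 2 log (z - p) plus a holomorphic function, and the logarithm survives;
  hence the factor 2 in h.\<close>

lemma log_solution_at_E6_zero:
  assumes p: "Im p > 0" and E6: "E6 p = 0" and n: "ni = real n"
    and ind: "\<And>k. k < n \<Longrightarrow> ind_poly n nf ab k \<noteq> 0"
  shows "\<exists>y. log_solution_at (ode_coeff r s t) p y"
proof -
  have n4: "E4 p \<noteq> 0" using E4_E6_not_both_zero[OF p] E6 by auto
  obtain R0 k4 k6 kD where loc: "R0 > 0" "ball p R0 \<subseteq> upper_half_plane"
    "k4 holomorphic_on ball p R0" "k6 holomorphic_on ball p R0" "kD holomorphic_on ball p R0"
    "\<And>z. z \<in> ball p R0 \<Longrightarrow> E4 z = (z - p) ^ of_bool (E4 p = 0) * exp (k4 z)"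
    "\<And>z. z \<in> ball p R0 \<Longrightarrow> E6 z = (z - p) ^ of_bool (E6 p = 0) * exp (k6 z)"
    "\<And>z. z \<in> ball p R0 \<Longrightarrow> discr z = exp (kD z)"
    using local_factorization[OF p] by blast
  have E: "E4 z = exp (k4 z)" "E6 z = (z - p) * exp (k6 z)" if "z \<in> ball p R0" for z
    using loc(6,7)[OF that] E6 n4 by simp_all
  obtain \<rho> A B where AB: "\<rho> > 0" "A holomorphic_on ball 0 \<rho>" "B holomorphic_on ball 0 \<rho>"
    "\<And>\<xi>. \<xi> \<in> ball 0 \<rho> - {0} \<Longrightarrow> B \<xi> \<noteq> 0"
    "\<And>\<xi>. \<xi> \<in> ball 0 \<rho> - {0} \<Longrightarrow> \<xi> * (1 - \<xi>) * deriv (deriv B) \<xi> +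
       (1 - of_nat n - (2 - of_nat n - of_real nf) * \<xi>) * deriv B \<xi> - of_real ab * B \<xi> = 0"
    "\<And>\<xi>. \<xi> \<in> ball 0 \<rho> - {0} \<Longrightarrow> \<xi> * (1 - \<xi>) * (deriv (deriv A) \<xi> + 2 * deriv B \<xi> / \<xi> - B \<xi> / \<xi> ^ 2) +
       (1 - of_nat n - (2 - of_nat n - of_real nf) * \<xi>) * (deriv A \<xi> + B \<xi> / \<xi>) - of_real ab * A \<xi> = 0"
    using hypergeometric_log_solution[OF ind] by blast
  define X where "X z = (z - p) ^ 2 * exp (2 * k6 z - 3 * k4 z)" for z
  have X: "X holomorphic_on ball p R0" unfolding X_def by (intro holomorphic_intros loc)
  have X_eq: "X z = 1 - inv_j z" if "z \<in> ball p R0" for z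
  proof -
    have "E4 z \<noteq> 0" using E[OF that] by simp
    then show ?thesis
      unfolding one_minus_inv_j[OF \<open>E4 z \<noteq> 0\<close>] E[OF that] X_def
      by (simp add: exp_diff exp_of_nat_mult[symmetric] power_mult_distrib)
  qed
  have "isCont X p"
    using X loc(1) by (auto intro!: continuous_on_interior[OF holomorphic_on_imp_continuous_on])
  then have "\<exists>d>0. \<forall>z. dist z p < d \<longrightarrow> dist (X z) (X p) < \<rho>"
    using AB(1) by (simp add: continuous_at_eps_delta)
  then obtain d where d: "d > 0" "\<And>z. dist z p < d \<Longrightarrow> dist (X z) (X p) < \<rho>" by blast
  define R where "R = min R0 d"
  have R: "R > 0" "R \<le> R0" using loc(1) d(1) by (simp_all add: R_def)
  then have sub: "ball p R \<subseteq> ball p R0" by auto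
  have Xball: "X z \<in> ball 0 \<rho>" if "z \<in> ball p R" for z
    using d(2)[of z] that by (simp add: R_def X_def dist_commute)
  have X0: "X z \<noteq> 0" if "z \<noteq> p" for z using that by (simp add: X_def)
  have hol: "k4 holomorphic_on ball p R" "k6 holomorphic_on ball p R" "kD holomorphic_on ball p R" "X holomorphic_on ball p R"
    using loc(3-5) X sub by (auto intro: holomorphic_on_subset)
  have compX: "(\<lambda>z. C (X z)) holomorphic_on ball p R" if "C holomorphic_on ball 0 \<rho>" for C
    using holomorphic_on_compose_gen[OF hol(4) that] Xball by (auto simp: o_def image_subset_iff)
  define V where "V = slit_ball p R"
  have V: "open V" "V \<subseteq> ball p R" "V \<subseteq> ball p R - {p}"
    unfolding V_def using open_slit_ball slit_ball_subset[of p R] by blast+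
  have VU: "V \<subseteq> upper_half_plane" using V(2) sub loc(2) by blast
  define l6 where "l6 z = Ln (z - p) + k6 z" for z
  define \<ll> where "\<ll> z = 2 * l6 z - 3 * k4 z" for z
  have Lnh: "(\<lambda>z. Ln (z - p)) holomorphic_on V" unfolding V_def by (rule Ln_slit_ball_holomorphic)
  have lV: "k4 holomorphic_on V" "l6 holomorphic_on V" "kD holomorphic_on V"
    unfolding l6_def using hol V(2) by (auto intro!: holomorphic_intros Lnh intro: holomorphic_on_subset)
  have l6: "E6 z = exp (l6 z)" if "z \<in> V" for z
  proof -
    have "z \<noteq> p" using V(3) that by blast
    then show ?thesis using E(2)[of z] that V(2) sub by (auto simp: l6_def exp_add)
  qed
  define y where "y z = prefactor k4 l6 kD z * (A (X z) + B (X z) * \<ll> z)" for z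
  have sol: "solution_on (ode_coeff r s t) V y"
    unfolding y_def
  proof (rule pullback_log_solution[OF V(1) VU lV, where \<sigma> = "-1" and n = ni and m = nf and \<rho> = \<rho>])
    show "- 1 = (1::real) \<and> ni = nf \<and> (\<forall>z\<in>V. X z = inv_j z) \<and> nf = ni \<or>
        - 1 = (- 1::real) \<and> ni = ni \<and> (\<forall>z\<in>V. X z = 1 - inv_j z) \<and> nf = nf"
      using X_eq V(2) sub by blast
    show "\<ll> holomorphic_on V" unfolding \<ll>_def by (intro holomorphic_intros lV)
    show "X z = exp (\<ll> z)" if "z \<in> V" for z
    proof -
      have "z - p \<noteq> 0" using V(3) that by auto
      then have "exp (2 * Ln (z - p)) = (z - p) ^ 2"
        using exp_of_nat_mult[of 2 "Ln (z - p)"] by simp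
      then show ?thesis by (simp add: \<ll>_def X_def l6_def exp_add exp_diff algebra_simps)
    qed
    show "E4 z = exp (k4 z)" "E6 z = exp (l6 z)" "discr z = exp (kD z)" "X z \<in> ball 0 \<rho>" if "z \<in> V" for z
      using that V(2) sub E(1) l6 loc(8) Xball by blast+
  qed (use AB n in auto)
  define \<beta> where "\<beta> = (of_real (1/2 - ni) :: complex)"
  define K where "K z = of_real ee * k4 z + of_real (1/2 - ni) * k6 z - of_real (nf / 2) * kD z" for z
  define g where "g z = exp (K z) * (A (X z) + B (X z) * (2 * k6 z - 3 * k4 z))" for z
  define h where "h z = exp (K z) * (2 * B (X z))" for z
  have "log_solution_at (ode_coeff r s t) p y"
    unfolding log_solution_at_def
  proof (intro exI conjI)
    show "R > 0" by fact
    show "ode_coeff r s t holomorphic_on ball p R - {p}"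
    proof (rule ode_coeff_holomorphic)
      show "ball p R - {p} \<subseteq> upper_half_plane" using sub loc(2) by blast
      fix z assume "z \<in> ball p R - {p}"
      then show "E4 z \<noteq> 0" "E6 z \<noteq> 0" using E[of z] sub by auto
    qed
    show "solution_on (ode_coeff r s t) (slit_ball p R) y" using sol by (simp add: V_def)
    show "g holomorphic_on ball p R" "h holomorphic_on ball p R"
      unfolding g_def h_def K_def by (intro holomorphic_intros compX AB hol)+
    have w: "p + of_real (R / 2) \<in> ball p R" "p + of_real (R / 2) \<noteq> p" using R by (auto simp: dist_norm)
    then have "B (X (p + of_real (R / 2))) \<noteq> 0" using Xball X0 by (intro AB(4)) auto
    then show "\<exists>z\<in>ball p R. h z \<noteq> 0"
      using w by (intro bexI[of _ "p + of_real (R / 2)"]) (auto simp: h_def)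
    show "\<forall>z\<in>slit_ball p R. y z = (z - p) powr \<beta> * (g z + h z * Ln (z - p))"
    proof
      fix z assume "z \<in> slit_ball p R"
      then have "z \<noteq> p" using slit_ball_subset by blast
      then have "(z - p) powr \<beta> = exp (\<beta> * Ln (z - p))" by (simp add: powr_def)
      moreover have "prefactor k4 l6 kD z = exp (\<beta> * Ln (z - p)) * exp (K z)"
        unfolding prefactor_def l6_def K_def \<beta>_def exp_add[symmetric] by (simp add: algebra_simps)
      ultimately show "y z = (z - p) powr \<beta> * (g z + h z * Ln (z - p))"
        unfolding y_def g_def h_def \<ll>_def l6_def by (simp add: algebra_simps)
    qed
  qed
  then show ?thesis by blast
qed

lemma nome_comp_holomorphic:
  assumes "f holomorphic_on ball 0 R" "\<And>z. z \<in> V \<Longrightarrow> nome z \<in> ball 0 R"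
  shows "(\<lambda>z. f (nome z)) holomorphic_on V"
  using holomorphic_on_compose_gen[of nome V f "ball 0 R"] assms nome_holomorphic[OF holomorphic_on_ident]
  by (auto simp: o_def image_subset_iff)

text \<open>The same at x = 0. Here x has a simple zero at q = 0, so log x is 2 \<pi> i z plus a
  holomorphic function of q.\<close>

lemma log_solution_at_cusp:
  assumes n: "nf = real n" and ind: "\<And>k. k < n \<Longrightarrow> ind_poly n ni ab k \<noteq> 0"
  shows "\<exists>y. log_solution_infinity (ode_coeff r s t) y"
proof -
  obtain R0 k4 k6 kD where loc: "0 < R0" "R0 < 1"
    "k4 holomorphic_on ball 0 R0" "k6 holomorphic_on ball 0 R0" "kD holomorphic_on ball 0 R0"
    "\<And>q. q \<in> ball 0 R0 \<Longrightarrow> e4 q = exp (k4 q)"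
    "\<And>q. q \<in> ball 0 R0 \<Longrightarrow> e6 q = exp (k6 q)"
    "\<And>q. q \<in> ball 0 R0 \<Longrightarrow> e4 q ^ 3 - e6 q ^ 2 = q * exp (kD q)"
    using cusp_factorization by blast
  obtain \<rho> A B where AB: "\<rho> > 0" "A holomorphic_on ball 0 \<rho>" "B holomorphic_on ball 0 \<rho>"
    "\<And>\<xi>. \<xi> \<in> ball 0 \<rho> - {0} \<Longrightarrow> B \<xi> \<noteq> 0"
    "\<And>\<xi>. \<xi> \<in> ball 0 \<rho> - {0} \<Longrightarrow> \<xi> * (1 - \<xi>) * deriv (deriv B) \<xi> +
       (1 - of_nat n - (2 - of_nat n - of_real ni) * \<xi>) * deriv B \<xi> - of_real ab * B \<xi> = 0"
    "\<And>\<xi>. \<xi> \<in> ball 0 \<rho> - {0} \<Longrightarrow> \<xi> * (1 - \<xi>) * (deriv (deriv A) \<xi> + 2 * deriv B \<xi> / \<xi> - B \<xi> / \<xi> ^ 2) +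
       (1 - of_nat n - (2 - of_nat n - of_real ni) * \<xi>) * (deriv A \<xi> + B \<xi> / \<xi>) - of_real ab * A \<xi> = 0"
    using hypergeometric_log_solution[OF ind] by blast
  define X where "X q = q * exp (kD q - 3 * k4 q)" for q
  have X: "X holomorphic_on ball 0 R0" unfolding X_def by (intro holomorphic_intros loc)
  have "isCont X 0"
    using X loc(1) by (auto intro!: continuous_on_interior[OF holomorphic_on_imp_continuous_on])
  then have "\<exists>d>0. \<forall>z. dist z 0 < d \<longrightarrow> dist (X z) (X 0) < \<rho>"
    using AB(1) by (simp add: continuous_at_eps_delta)
  then obtain d where d: "d > 0" "\<And>z. dist z 0 < d \<Longrightarrow> dist (X z) (X 0) < \<rho>" by blast
  define R where "R = min R0 d"
  have R: "R > 0" "R \<le> R0" "R < 1" using loc(1,2) d(1) by (simp_all add: R_def)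
  then have sub: "ball 0 R \<subseteq> ball (0::complex) R0" by auto
  have Xball: "X q \<in> ball 0 \<rho>" if "q \<in> ball 0 R" for q
    using d(2)[of q] that by (simp add: R_def X_def)
  have X0: "X q \<noteq> 0" if "q \<noteq> 0" for q using that by (simp add: X_def)
  have hol: "k4 holomorphic_on ball 0 R" "k6 holomorphic_on ball 0 R" "kD holomorphic_on ball 0 R" "X holomorphic_on ball 0 R"
    using loc(3-5) X sub by (auto intro: holomorphic_on_subset)
  have compX: "(\<lambda>z. C (X z)) holomorphic_on ball 0 R" if "C holomorphic_on ball 0 \<rho>" for C
    using holomorphic_on_compose_gen[OF hol(4) that] Xball by (auto simp: o_def image_subset_iff)
  \<comment> \<open>Chosen so that Im z > Y means |q| < R.\<close>
  define Y where "Y = - ln R / (2 * pi)"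
  have Y: "exp (- 2 * pi * Y) = R" "Y > 0" using R by (simp_all add: Y_def divide_neg_pos)
  define V where "V = {z. Im z > Y}"
  have V: "open V" "V \<subseteq> upper_half_plane"
    unfolding V_def using Y(2) by (auto simp: open_halfspace_Im_gt)
  have q: "nome z \<in> ball 0 R" if "z \<in> V" for z
    using that unfolding Y(1)[symmetric] by (simp add: norm_nome V_def)
  have q': "nome z \<in> ball 0 R0" and I: "Im z > 0" if "z \<in> V" for z using q[OF that] sub V(2) that by auto
  define l4 l6 lD where "l4 z = k4 (nome z)" "l6 z = k6 (nome z)" "lD z = tpi * z + kD (nome z)" for z
  have lV: "l4 holomorphic_on V" "l6 holomorphic_on V" "lD holomorphic_on V"
    unfolding l4_l6_lD_def
    using nome_comp_holomorphic[OF hol(1) q] nome_comp_holomorphic[OF hol(2) q] nome_comp_holomorphic[OF hol(3) q]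
    by (auto intro!: holomorphic_intros)
  have nome_exp: "nome z = exp (tpi * z)" for z by (simp add: nome_def tpi_def)
  have lE: "E4 z = exp (l4 z)" "E6 z = exp (l6 z)" "discr z = exp (lD z)" if "z \<in> V" for z
  proof -
    show "E4 z = exp (l4 z)" "E6 z = exp (l6 z)"
      using loc(6,7)[OF q'[OF that]] by (simp_all add: l4_l6_lD_def E4_eq_e4 E6_eq_e6 I[OF that])
    show "discr z = exp (lD z)"
      using loc(8)[OF q'[OF that]]
      by (simp add: l4_l6_lD_def discr_def E4_eq_e4 E6_eq_e6 I[OF that] exp_add nome_exp[symmetric])
  qed
  define \<ll> where "\<ll> z = lD z - 3 * l4 z" for z
  have X_exp: "X (nome z) = exp (\<ll> z)" for z
    by (simp add: X_def \<ll>_def l4_l6_lD_def exp_add exp_diff nome_exp[symmetric])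
  have X_eq: "X (nome z) = inv_j z" if "z \<in> V" for z
    unfolding inv_j_def lE[OF that] X_exp \<ll>_def exp_diff using exp_of_nat_mult[of 3 "l4 z"] by simp
  define y where "y z = prefactor l4 l6 lD z * (A (X (nome z)) + B (X (nome z)) * \<ll> z)" for z
  have sol: "solution_on (ode_coeff r s t) V y"
    unfolding y_def
  proof (rule pullback_log_solution[OF V lV lE, where \<sigma> = 1 and n = nf and m = ni and \<rho> = \<rho>])
    show "1 = (1::real) \<and> nf = nf \<and> (\<forall>z\<in>V. X (nome z) = inv_j z) \<and> ni = ni \<or>
        1 = (- 1::real) \<and> nf = ni \<and> (\<forall>z\<in>V. X (nome z) = 1 - inv_j z) \<and> ni = nf"
      using X_eq by blast
    show "\<ll> holomorphic_on V" unfolding \<ll>_def by (intro holomorphic_intros lV)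
    show "X (nome z) = exp (\<ll> z)" for z by (rule X_exp)
    show "X (nome z) \<in> ball 0 \<rho>" if "z \<in> V" for z using Xball q[OF that] by blast
  qed (use AB n in auto)
  define \<beta> where "\<beta> = (- of_real (nf / 2) :: complex)"
  define K where "K q = of_real ee * k4 q + of_real (1/2 - ni) * k6 q - of_real (nf / 2) * kD q" for q
  define g where "g q = exp (K q) * (A (X q) + B (X q) * (kD q - 3 * k4 q))" for q
  define h where "h q = exp (K q) * B (X q)" for q
  have "log_solution_infinity (ode_coeff r s t) y"
    unfolding log_solution_infinity_def
  proof (rule exI[of _ Y], unfold Y(1), intro exI conjI)
    show "ode_coeff r s t holomorphic_on {z. Y < Im z}"
      using ode_coeff_holomorphic[OF V(2)] lE by (simp add: V_def)
    show "solution_on (ode_coeff r s t) {z. Y < Im z} y" using sol by (simp add: V_def)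
    show "g holomorphic_on ball 0 R" "h holomorphic_on ball 0 R"
      unfolding g_def h_def K_def by (intro holomorphic_intros compX AB hol)+
    have w: "of_real (R / 2) \<in> ball (0::complex) R" "(of_real (R / 2) :: complex) \<noteq> 0" using R by auto
    then have "B (X (of_real (R / 2))) \<noteq> 0" using Xball X0 by (intro AB(4)) auto
    then show "\<exists>q\<in>ball 0 R. h q \<noteq> 0"
      using w by (intro bexI[of _ "of_real (R / 2)"]) (auto simp: h_def)
    show "\<forall>z. Y < Im z \<longrightarrow> y z = exp (2 * of_real pi * \<i> * \<beta> * z) * (g (nome z) + h (nome z) * (2 * of_real pi * \<i> * z))"
    proof (intro allI impI)
      fix z assume "Y < Im z"
      have "prefactor l4 l6 lD z = exp (\<beta> * (tpi * z)) * exp (K (nome z))"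
        unfolding prefactor_def l4_l6_lD_def K_def \<beta>_def exp_add[symmetric] by (simp add: algebra_simps)
      then show "y z = exp (2 * of_real pi * \<i> * \<beta> * z) * (g (nome z) + h (nome z) * (2 * of_real pi * \<i> * z))"
        unfolding y_def g_def h_def \<ll>_def l4_l6_lD_def tpi_def by (simp add: algebra_simps)
    qed
  qed
  then show ?thesis by blast
qed

end

section \<open>The apparent case\<close>

text \<open>Ratios of solutions are ratios of homogeneous polynomials of the same degree in \<open>E4\<^sup>3\<close> and \<open>discr\<close>.\<close>

definition hom_poly :: "nat \<Rightarrow> complex poly \<Rightarrow> complex \<Rightarrow> complex \<Rightarrow> complex" where
  "hom_poly d p X Y = (\<Sum>k\<le>d. coeff p k * Y ^ k * X ^ (d - k))"

lemma hom_poly_eq: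
  assumes "degree p \<le> d" "X \<noteq> 0"
  shows "hom_poly d p X Y = X ^ d * poly p (Y / X)"
proof -
  have "poly p (Y / X) = (\<Sum>k\<le>d. coeff p k * (Y / X) ^ k)"
    unfolding poly_altdef using assms(1) by (intro sum.mono_neutral_left) (auto simp: coeff_eq_0)
  then have "X ^ d * poly p (Y / X) = (\<Sum>k\<le>d. X ^ d * (coeff p k * (Y / X) ^ k))"
    by (simp add: sum_distrib_left)
  also have "\<dots> = hom_poly d p X Y"
    unfolding hom_poly_def using assms(2)
    by (intro sum.cong) (auto simp: power_diff power_divide field_simps)
  finally show ?thesis by simp
qed

lemma hom_poly_scale: "hom_poly d p (c * X) (c * Y) = c ^ d * hom_poly d p X Y"
  unfolding hom_poly_def sum_distrib_left
  by (rule sum.cong) (auto simp: power_mult_distrib mult_ac simp flip: power_add)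

lemma regular_point_exists:
  assumes "open U" "U \<noteq> {}" "U \<subseteq> upper_half_plane"
  obtains z where "z \<in> U" "E4 z \<noteq> 0" "E6 z \<noteq> 0"
proof (rule ccontr)
  assume *: "\<not> thesis"
  note found = that
  have 0: "E4 z * E6 z = 0" if "z \<in> U" for z using * found[OF that] by auto
  obtain z where z: "z \<in> U" using assms by blast
  have I: "Im z > 0" using assms z by auto
  have "((\<lambda>z. E4 z * E6 z) has_field_derivative deriv E4 z * E6 z + E4 z * deriv E6 z) (at z)"
    by (auto intro!: derivative_eq_intros has_deriv_upper E4_holomorphic E6_holomorphic I)
  moreover have "((\<lambda>z. E4 z * E6 z) has_field_derivative 0) (at z)"
    by (rule has_field_derivative_transform_within_open[where f = "\<lambda>_. 0" and S = U])
      (use 0 assms z in auto)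
  ultimately have "deriv E4 z * E6 z + E4 z * deriv E6 z = 0" by (rule DERIV_unique)
  moreover have "E4 z = 0 \<or> E6 z = 0" using 0[OF z] by simp
  ultimately show False
    using deriv_E4_at_zero[OF I] deriv_E6_at_zero[OF I] E4_E6_not_both_zero[OF I] by auto
qed

text \<open>\<open>remove_sings\<close> is defined by limits, and a Moebius map carries punctured
  neighbourhoods to punctured neighbourhoods. So invariance of a quotient passes to the function
  with its removable singularities filled in.\<close>

lemma filtermap_mobius:
  assumes "a * d - b * c = 1" "Im z > 0"
  shows "filtermap (mobius a b c d) (at z) = at (mobius a b c d z)"
proof (rule filtermap_fun_inverse)
  have det': "d * a - (- b) * (- c) = 1" using assms(1) by (simp add: algebra_simps)
  have inv: "mobius d (- b) (- c) a (mobius a b c d w) = w" if "Im w > 0" for w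
  proof -
    have J: "of_int c * w + of_int d \<noteq> 0" using mobius_denom_nonzero[OF assms(1) that] .
    have det: "(of_int a :: complex) * of_int d - of_int b * of_int c = 1"
      using arg_cong[OF assms(1), of "of_int :: int \<Rightarrow> complex"] by simp
    have "(- of_int c) * ((of_int a * w + of_int b) / (of_int c * w + of_int d)) + of_int a = 1 / (of_int c * w + of_int d)"
      using J det by (simp add: field_simps)
    moreover have "of_int d * ((of_int a * w + of_int b) / (of_int c * w + of_int d)) + (- of_int b) = w / (of_int c * w + of_int d)"
    proof -
      have "of_int d * (of_int a * w + of_int b) - of_int b * (of_int c * w + of_int d) = w"
        using det by algebra
      then show ?thesis using J by (simp add: field_simps)
    qed
    ultimately show ?thesis unfolding mobius_def using J by simp
  qed
  have inv': "mobius a b c d (mobius d (- b) (- c) a w) = w" if "Im w > 0" for w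
  proof -
    have J: "of_int (- c) * w + of_int a \<noteq> 0" using mobius_denom_nonzero[OF det' that] .
    have det: "(of_int a :: complex) * of_int d - of_int b * of_int c = 1"
      using arg_cong[OF assms(1), of "of_int :: int \<Rightarrow> complex"] by simp
    have "of_int c * ((of_int d * w + of_int (- b)) / (of_int (- c) * w + of_int a)) + of_int d = 1 / (of_int (- c) * w + of_int a)"
    proof -
      have "of_int c * (of_int d * w + of_int (- b)) + of_int d * (of_int (- c) * w + of_int a) = (1::complex)"
        using det by simp algebra
      then show ?thesis using J by (simp add: field_simps)
    qed
    moreover have "of_int a * ((of_int d * w + of_int (- b)) / (of_int (- c) * w + of_int a)) + of_int b = w / (of_int (- c) * w + of_int a)"
    proof -
      have "of_int a * (of_int d * w + of_int (- b)) + of_int b * (of_int (- c) * w + of_int a) = (w::complex)"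
        using det by simp algebra
      then show ?thesis using J by (simp add: field_simps)
    qed
    ultimately show ?thesis unfolding mobius_def[of a b c d] mobius_def[of d] using J by simp
  qed
  have lim: "filterlim (mobius a' b' c' d') (at (mobius a' b' c' d' w)) (at w)"
    if "a' * d' - b' * c' = 1" "Im w > 0" "\<And>v. Im v > 0 \<Longrightarrow> m (mobius a' b' c' d' v) = v" for a' b' c' d' w m
  proof -
    have "isCont (mobius a' b' c' d') w" using mobius_derivative[OF that(1,2)] by (rule DERIV_isCont)
    moreover have "\<forall>\<^sub>F v in at w. v \<in> upper_half_plane - {w}"
      using that(2) by (intro eventually_at_in_open) auto
    then have "\<forall>\<^sub>F v in at w. mobius a' b' c' d' v \<noteq> mobius a' b' c' d' w"
      by (rule eventually_mono) (use that(2,3) in \<open>metis DiffD1 DiffD2 insertI1 upper_half_plane_iff\<close>)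
    ultimately show ?thesis by (simp add: filterlim_at isCont_def)
  qed
  have I: "Im (mobius a b c d z) > 0" using Im_mobius_pos[OF assms] .
  show "filterlim (mobius a b c d) (at (mobius a b c d z)) (at z)" by (rule lim[OF assms inv])
  show "filterlim (mobius d (- b) (- c) a) (at z) (at (mobius a b c d z))"
    using lim[OF det' I inv'] by (simp add: inv[OF assms(2)])
  have "\<forall>\<^sub>F v in at (mobius a b c d z). v \<in> upper_half_plane - {mobius a b c d z}"
    using I by (intro eventually_at_in_open) auto
  then show "\<forall>\<^sub>F v in at (mobius a b c d z). mobius a b c d (mobius d (- b) (- c) a v) = v"
    by (rule eventually_mono) (use inv' in auto)
qed

text \<open>Both forms have weight 12 k, so their quotient is invariant. Near the cusp they are
  holomorphic functions of q, and the zeros of the denominator are isolated, so for large Im z the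
  quotient is a genuine value and not a default one.\<close>

lemma ratio_of_forms_modular:
  assumes p2: "\<exists>z. Im z > 0 \<and> hom_poly k p2 (E4 z ^ 3) (discr z) \<noteq> 0"
  shows "modular_function (remove_sings (\<lambda>z. hom_poly k p1 (E4 z ^ 3) (discr z) / hom_poly k p2 (E4 z ^ 3) (discr z)))"
proof -
  define N where "N p z = hom_poly k p (E4 z ^ 3) (discr z)" for p z
  define F where "F z = N p1 z / N p2 z" for z
  have N: "N p holomorphic_on upper_half_plane" for p
    unfolding N_def hom_poly_def by (intro holomorphic_intros E4_holomorphic discr_holomorphic)
  then have N_an: "N p analytic_on upper_half_plane" for p by (simp add: analytic_on_open)
  define n where "n p q = hom_poly k p (e4 q ^ 3) (e4 q ^ 3 - e6 q ^ 2)" for p q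
  have n: "n p holomorphic_on ball 0 1" for p
    unfolding n_def hom_poly_def by (intro holomorphic_intros) auto
  have Nn: "N p z = n p (nome z)" if "Im z > 0" for p z
    by (simp add: N_def n_def discr_def E4_eq_e4 E6_eq_e6 that)
  obtain z0 where z0: "Im z0 > 0" "N p2 z0 \<noteq> 0" using p2 by (auto simp: N_def)
  have "remove_sings F nicely_meromorphic_on upper_half_plane"
    unfolding F_def using N_an
    by (intro remove_sings_nicely_meromorphic meromorphic_intros analytic_on_imp_meromorphic_on)
  moreover have "remove_sings F (mobius a b c d z) = remove_sings F z"
    if det: "a * d - b * c = 1" and z: "z \<in> upper_half_plane" for a b c d z
  proof -
    have I: "Im z > 0" using z by simp
    have inv: "F (mobius a b c d w) = F w" if w: "Im w > 0" for w
    proof -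
      define J where "J = of_int c * w + of_int d"
      have "J \<noteq> 0" using mobius_denom_nonzero[OF det w] by (simp add: J_def)
      moreover have "N p (mobius a b c d w) = (J ^ 12) ^ k * N p w" for p
        unfolding N_def E4_mobius[OF det w] discr_mobius[OF det w] J_def[symmetric] hom_poly_scale[symmetric]
        by (simp add: power_mult_distrib flip: power_mult)
      ultimately show ?thesis by (simp add: F_def)
    qed
    have "remove_sings F (mobius a b c d z) = remove_sings (F \<circ> mobius a b c d) z"
      by (rule remove_sings_compose[symmetric, OF filtermap_mobius[OF det I]])
    also have "\<dots> = remove_sings F z"
    proof (rule remove_sings_cong[OF _ refl])
      have "\<forall>\<^sub>F v in at z. v \<in> upper_half_plane - {z}"
        using z by (intro eventually_at_in_open) auto
      then show "\<forall>\<^sub>F v in at z. (F \<circ> mobius a b c d) v = F v"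
        by (rule eventually_mono) (use inv in auto)
    qed
    finally show ?thesis .
  qed
  moreover have "\<exists>g Y. g meromorphic_on {0} \<and> (\<forall>z. Im z > Y \<longrightarrow> remove_sings F z = g (nome z))"
  proof -
    have "\<forall>\<^sub>F q in at 0. n p2 q \<noteq> 0 \<and> q \<in> ball 0 1"
      using z0 Nn[OF z0(1), of p2] norm_nome_less_1_iff[of z0]
      by (intro non_zero_neighbour_alt[OF n, of _ "nome z0"]) auto
    then obtain \<delta> where \<delta>: "\<delta> > 0" "\<And>q. q \<noteq> 0 \<Longrightarrow> norm q < \<delta> \<Longrightarrow> n p2 q \<noteq> 0"
      by (auto simp: eventually_at)
    define Y where "Y = max 0 (- ln \<delta> / (2 * pi))"
    have "remove_sings F z = n p1 (nome z) / n p2 (nome z)" if z: "Im z > Y" for z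
    proof -
      have I: "Im z > 0" using z by (simp add: Y_def)
      have "- ln \<delta> / (2 * pi) < Im z" using z by (simp add: Y_def)
      then have "- 2 * pi * Im z < ln \<delta>" by (simp add: field_simps)
      then have "exp (- 2 * pi * Im z) < exp (ln \<delta>)" by (simp only: exp_less_cancel_iff)
      then have "norm (nome z) < \<delta>" using \<delta>(1) by (simp add: norm_nome)
      then have "N p2 z \<noteq> 0" using \<delta>(2)[of "nome z"] Nn[OF I] by simp
      then have "F analytic_on {z}"
        unfolding F_def using I by (intro analytic_intros analytic_on_subset[OF N_an]) auto
      then have "remove_sings F z = F z" by (rule remove_sings_at_analytic)
      then show ?thesis by (simp add: F_def Nn[OF I])
    qed
    moreover have "(\<lambda>q. n p1 q / n p2 q) meromorphic_on {0}"
      by (intro meromorphic_intros analytic_on_imp_meromorphic_on holomorphic_on_imp_analytic_at[OF n]) auto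
    ultimately show ?thesis by blast
  qed
  ultimately show ?thesis
    unfolding modular_function_def F_def N_def by blast
qed

section \<open>Consequences of the parity and triangle conditions\<close>

locale apparent_case = pulled_back "real Ni" "real Nr" "real Nf" r s t
  for Ni Nr Nf :: nat and r s t :: complex +
  assumes pos: "Nf > 0" and odd: "odd (Ni + Nr + Nf)"
    and tri: "Ni + Nr > Nf" "Ni + Nf > Nr" "Nr + Nf > Ni"
begin

text \<open>Two independent polynomial solutions pull back to a basis of the solutions on V, so
  every solution is a combination of them.\<close>

lemma solution_is_polynomial:
  assumes V: "open V" "connected V" "V \<noteq> {}" "V \<subseteq> upper_half_plane"
    and l: "l4 holomorphic_on V" "l6 holomorphic_on V" "lD holomorphic_on V"
      "\<And>z. z \<in> V \<Longrightarrow> E4 z = exp (l4 z)" "\<And>z. z \<in> V \<Longrightarrow> E6 z = exp (l6 z)" "\<And>z. z \<in> V \<Longrightarrow> discr z = exp (lD z)"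
    and y: "solution_on (ode_coeff r s t) V y"
  obtains p where "\<And>z. z \<in> V \<Longrightarrow> y z = prefactor l4 l6 lD z * poly p (inv_j z)"
proof -
  have ab: "((1 - of_nat Ni - of_nat Nf) ^ 2 - of_nat Nr ^ 2) / 4 = (of_real ab :: complex)"
    by (simp add: ab_def)
  obtain u v :: "complex poly" where uv:
    "[:0, 1, -1:] * pderiv (pderiv u) + [:1 - of_nat Nf, - (2 - of_nat Ni - of_nat Nf):] * pderiv u - smult (of_real ab) u = 0"
    "[:0, 1, -1:] * pderiv (pderiv v) + [:1 - of_nat Nf, - (2 - of_nat Ni - of_nat Nf):] * pderiv v - smult (of_real ab) v = 0"
    "u * pderiv v - pderiv u * v \<noteq> 0"
    by (rule two_polynomial_solutions[OF pos odd tri, unfolded ab]) (rule that)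
  define \<Phi> where "\<Phi> = prefactor l4 l6 lD"
  have sol: "solution_on (ode_coeff r s t) V (\<lambda>z. \<Phi> z * poly u (inv_j z))"
    "solution_on (ode_coeff r s t) V (\<lambda>z. \<Phi> z * poly v (inv_j z))"
    unfolding \<Phi>_def using uv(1,2)
    by (intro pullback_poly_solution[OF V(1,4) l]; simp)+
  have nz: "Im z > 0" "E4 z \<noteq> 0" "E6 z \<noteq> 0" "discr z \<noteq> 0" "\<Phi> z \<noteq> 0" if "z \<in> V" for z
    using l(4-6)[OF that] V(4) that by (auto simp: \<Phi>_def prefactor_def)
  have "\<Phi> holomorphic_on V"
    unfolding \<Phi>_def prefactor_def by (intro holomorphic_intros l)
  then have d\<Phi>: "(\<Phi> has_field_derivative deriv \<Phi> z) (at z)" if "z \<in> V" for z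
    using V(1) that by (rule holomorphic_derivI)
  define x' where "x' z = tpi * (inv_j z * psi z)" for z
  have dx: "(inv_j has_field_derivative x' z) (at z)" if z: "z \<in> V" for z
    unfolding x'_def by (rule inv_j_has_derivative[OF nz(1)[OF z] nz(2)[OF z]])
  have x'0: "x' z \<noteq> 0" if z: "z \<in> V" for z
    using nz[OF z] by (simp add: x'_def inv_j_def psi_def)
  have dp: "deriv (\<lambda>z. \<Phi> z * poly w (inv_j z)) z = deriv \<Phi> z * poly w (inv_j z) + \<Phi> z * (poly (pderiv w) (inv_j z) * x' z)"
    if z: "z \<in> V" for w z
    using DERIV_mult[OF d\<Phi>[OF z] DERIV_chain2[OF poly_DERIV dx[OF z]], of w]
    by (intro DERIV_imp_deriv) (simp add: algebra_simps)
  have W: "\<exists>z\<in>V. \<Phi> z * poly u (inv_j z) * deriv (\<lambda>z. \<Phi> z * poly v (inv_j z)) z -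
      deriv (\<lambda>z. \<Phi> z * poly u (inv_j z)) z * (\<Phi> z * poly v (inv_j z)) \<noteq> 0"
  proof (rule ccontr)
    assume *: "\<not> ?thesis"
    \<comment> \<open>The Wronskian of the pulled-back pair is \<Phi>^2 x' times that of u and v; if
      it vanished on V, the latter would be the zero polynomial.\<close>
    have "poly (u * pderiv v - pderiv u * v) (inv_j z) = 0" if z: "z \<in> V" for z
    proof -
      have "\<Phi> z ^ 2 * x' z * poly (u * pderiv v - pderiv u * v) (inv_j z) =
        \<Phi> z * poly u (inv_j z) * deriv (\<lambda>z. \<Phi> z * poly v (inv_j z)) z -
        deriv (\<lambda>z. \<Phi> z * poly u (inv_j z)) z * (\<Phi> z * poly v (inv_j z))"
        unfolding dp[OF z] by (simp add: algebra_simps power2_eq_square)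
      also have "\<Phi> z * poly u (inv_j z) * deriv (\<lambda>z. \<Phi> z * poly v (inv_j z)) z -
        deriv (\<lambda>z. \<Phi> z * poly u (inv_j z)) z * (\<Phi> z * poly v (inv_j z)) = 0"
        using * z by blast
      finally show ?thesis using nz(5)[OF z] x'0[OF z] by simp
    qed
    then have "u * pderiv v - pderiv u * v = 0"
      using poly_vanishes_on_image[OF V(1,3) dx x'0] by blast
    then show False using uv(3) by simp
  qed
  obtain c1 c2 where c: "\<And>z. z \<in> V \<Longrightarrow> y z = c1 * (\<Phi> z * poly u (inv_j z)) + c2 * (\<Phi> z * poly v (inv_j z))"
    using solution_combination[OF V(1,2) y sol W] by blast
  show ?thesis
  proof (rule that)
    fix z assume "z \<in> V"
    then show "y z = prefactor l4 l6 lD z * poly (smult c1 u + smult c2 v) (inv_j z)"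
      using c[of z] by (simp add: \<Phi>_def algebra_simps)
  qed
qed

text \<open>On a slit disc a solution is a power of z - p times a function that is single-valued on
  the punctured disc. In the coordinate w = log (z - p) this contradicts a logarithmic term by
  \<open>no_logarithm\<close>.\<close>

lemma no_log_solution_at:
  assumes p: "Im p > 0"
  shows "\<not> log_solution_at (ode_coeff r s t) p y"
proof
  assume "log_solution_at (ode_coeff r s t) p y"
  then obtain R \<alpha> g h where log: "R > 0" "solution_on (ode_coeff r s t) (slit_ball p R) y"
    "g holomorphic_on ball p R" "h holomorphic_on ball p R" "\<exists>z\<in>ball p R. h z \<noteq> 0"
    "\<And>z. z \<in> slit_ball p R \<Longrightarrow> y z = (z - p) powr \<alpha> * (g z + h z * Ln (z - p))"
    unfolding log_solution_at_def by blast
  obtain R0 k4 k6 kD where loc: "R0 > 0" "ball p R0 \<subseteq> upper_half_plane"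
    "k4 holomorphic_on ball p R0" "k6 holomorphic_on ball p R0" "kD holomorphic_on ball p R0"
    "\<And>z. z \<in> ball p R0 \<Longrightarrow> E4 z = (z - p) ^ of_bool (E4 p = 0) * exp (k4 z)"
    "\<And>z. z \<in> ball p R0 \<Longrightarrow> E6 z = (z - p) ^ of_bool (E6 p = 0) * exp (k6 z)"
    "\<And>z. z \<in> ball p R0 \<Longrightarrow> discr z = exp (kD z)"
    using local_factorization[OF p] by blast
  define R1 where "R1 = min R R0"
  have R1: "R1 > 0" "R1 \<le> R" "R1 \<le> R0" using log(1) loc(1) by (simp_all add: R1_def)
  then have sub: "ball p R1 \<subseteq> ball p R" "ball p R1 \<subseteq> ball p R0" by auto
  define V where "V = slit_ball p R1"
  have V: "open V" "connected V" "V \<subseteq> ball p R1" "V \<subseteq> slit_ball p R" "V \<subseteq> ball p R1 - {p}"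
    unfolding V_def using open_slit_ball connected_slit_ball slit_ball_subset[of p R1] slit_ball_mono[OF R1(2)]
    by blast+
  have "p + of_real (R1 / 2) \<in> V"
    using R1(1) by (auto simp: V_def slit_ball_def dist_norm complex_nonpos_Reals_iff)
  then have V0: "V \<noteq> {}" by blast
  have VU: "V \<subseteq> upper_half_plane" using V(3) sub(2) loc(2) by blast
  define m4 m6 where "m4 = (of_bool (E4 p = 0) :: real)" "m6 = (of_bool (E6 p = 0) :: real)"
  define l4 l6 where "l4 z = of_real m4 * Ln (z - p) + k4 z" "l6 z = of_real m6 * Ln (z - p) + k6 z" for z
  have Lnh: "(\<lambda>z. Ln (z - p)) holomorphic_on V" unfolding V_def by (rule Ln_slit_ball_holomorphic)
  have kV: "k4 holomorphic_on V" "k6 holomorphic_on V" "kD holomorphic_on V"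
    using loc(3-5) V(3) sub(2) by (auto intro: holomorphic_on_subset)
  have lV: "l4 holomorphic_on V" "l6 holomorphic_on V" "kD holomorphic_on V"
    unfolding l4_l6_def using kV by (auto intro!: holomorphic_intros Lnh)
  have "E4 z = exp (l4 z)" "E6 z = exp (l6 z)" "discr z = exp (kD z)" if z: "z \<in> V" for z
  proof -
    have zb: "z \<in> ball p R0" using z V(3) sub(2) by blast
    have zs: "z \<in> slit_ball p R1" using z by (simp add: V_def)
    show "E4 z = exp (l4 z)"
      unfolding loc(6)[OF zb] l4_l6_def exp_add using exp_Ln_slit[OF zs, of m4] by (simp add: m4_m6_def)
    show "E6 z = exp (l6 z)"
      unfolding loc(7)[OF zb] l4_l6_def exp_add using exp_Ln_slit[OF zs, of m6] by (simp add: m4_m6_def)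
    show "discr z = exp (kD z)" by (rule loc(8)[OF zb])
  qed
  then obtain P where P: "\<And>z. z \<in> V \<Longrightarrow> y z = prefactor l4 l6 kD z * poly P (inv_j z)"
    using solution_is_polynomial[OF V(1,2) V0 VU lV _ _ _ solution_on_subset[OF log(2) V(4)]] by blast
  define \<beta> where "\<beta> = (of_real (ee * m4 + (1/2 - real Ni) * m6) :: complex)"
  define K where "K z = of_real ee * k4 z + of_real (1/2 - real Ni) * k6 z - of_real (real Nf / 2) * kD z" for z
  \<comment> \<open>M is taken on the punctured disc: at a zero of \<open>E4\<close> the function
    \<open>inv_j\<close> has a pole.\<close>
  define M where "M \<zeta> = exp (K (p + \<zeta>)) * poly P (inv_j (p + \<zeta>))" for \<zeta>
  have shift: "(\<lambda>\<zeta>. f (p + \<zeta>)) holomorphic_on S" if "f holomorphic_on T" "\<And>\<zeta>. \<zeta> \<in> S \<Longrightarrow> p + \<zeta> \<in> T" for f S T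
  proof -
    have "(\<lambda>\<zeta>. p + \<zeta>) holomorphic_on S" by (intro holomorphic_intros)
    from holomorphic_on_compose_gen[OF this that(1)] that(2) show ?thesis
      by (auto simp: o_def image_subset_iff)
  qed
  have in_ball: "p + \<zeta> \<in> ball p R1" if "\<zeta> \<in> ball 0 R1" for \<zeta> using that by (simp add: dist_norm)
  have "h (p + \<zeta>) = 0" if "\<zeta> \<in> ball 0 R1" for \<zeta>
  proof (rule no_logarithm[where g = "\<lambda>\<zeta>. g (p + \<zeta>)" and h = "\<lambda>\<zeta>. h (p + \<zeta>)" and M = M and R = R1 and \<alpha> = \<alpha> and \<beta> = \<beta>])
    show "(\<lambda>\<zeta>. g (p + \<zeta>)) holomorphic_on ball 0 R1"
      by (rule shift[OF log(3)]) (use in_ball sub(1) in blast)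
    show "(\<lambda>\<zeta>. h (p + \<zeta>)) holomorphic_on ball 0 R1"
      by (rule shift[OF log(4)]) (use in_ball sub(1) in blast)
    have "K holomorphic_on ball p R0" unfolding K_def by (intro holomorphic_intros loc)
    then have 1: "(\<lambda>\<zeta>. K (p + \<zeta>)) holomorphic_on ball 0 R1 - {0}"
      by (rule shift) (use in_ball sub(2) in blast)
    have nz: "E4 z \<noteq> 0" if "z \<in> ball p R1 - {p}" for z using loc(6)[of z] that sub(2) by auto
    have "inv_j holomorphic_on ball p R1 - {p}"
      unfolding inv_j_def
      by (intro holomorphic_intros holomorphic_on_subset[OF discr_holomorphic] holomorphic_on_subset[OF E4_holomorphic])
        (use nz sub(2) loc(2) in auto)
    then have 2: "(\<lambda>\<zeta>. inv_j (p + \<zeta>)) holomorphic_on ball 0 R1 - {0}"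
      by (rule shift) (use in_ball in auto)
    show "M holomorphic_on ball 0 R1 - {0}"
      unfolding M_def poly_altdef by (intro holomorphic_intros 1 2)
    fix w assume w: "Re w < ln R1" "\<bar>Im w\<bar> < pi"
    have Lw: "Ln (exp w) = w" using w by (intro Ln_exp) auto
    have "exp (Re w) < exp (ln R1)" using w by simp
    then have "exp w \<in> ball 0 R1" using R1(1) by (simp add: norm_exp_eq_Re)
    moreover have "exp w \<notin> \<real>\<^sub>\<le>\<^sub>0"
    proof
      assume "exp w \<in> \<real>\<^sub>\<le>\<^sub>0"
      then have "Re (exp w) \<le> 0" "Im (exp w) = 0" unfolding complex_nonpos_Reals_iff by auto
      moreover have "Re (exp w) \<noteq> 0" using \<open>Im (exp w) = 0\<close> exp_not_eq_zero[of w] complex_eqI[of "exp w" 0] by auto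
      ultimately have "Im (Ln (exp w)) = pi" by (intro Im_Ln_eq_pi[THEN iffD2]) auto
      then show False using w Lw by simp
    qed
    ultimately have wV: "p + exp w \<in> V" by (simp add: V_def slit_ball_def dist_norm)
    have "prefactor l4 l6 kD (p + exp w) = exp (\<beta> * w) * exp (K (p + exp w))"
      unfolding l4_l6_def prefactor_slit \<beta>_def K_def by (simp add: Lw)
    moreover have "(p + exp w - p) powr \<alpha> = exp (\<alpha> * w)" by (simp add: powr_def Lw)
    ultimately show "exp (\<alpha> * w) * (g (p + exp w) + h (p + exp w) * w) = exp (\<beta> * w) * M (exp w)"
      using P[OF wV] log(6)[OF subsetD[OF V(4) wV]] by (simp add: M_def Lw mult.assoc)
  qed (use R1 that in auto)
  from this[of "z - p" for z] have h0: "h z = 0" if "z \<in> ball p R1" for z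
    using that by (simp add: dist_norm norm_minus_commute)
  \<comment> \<open>So far h vanishes on the smaller disc; the disc of radius R given with the
    solution may be larger.\<close>
  have "h z = 0" if z: "z \<in> ball p R" for z
    by (rule analytic_continuation_open[of "ball p R1" "ball p R" h "\<lambda>_. 0"])
      (use log(4) h0 z R1 in auto)
  then show False using log(5) by blast
qed

text \<open>Q is assumed to agree with the coefficient on the upper half-plane only, because this is
  what modularity gives for the transforms \<open>slash4\<close>. The half-plane of the logarithmic
  solution may reach below the real axis, hence the passage to a smaller disc.\<close>

lemma no_log_solution_infinity:
  assumes Q: "\<And>z. Im z > 0 \<Longrightarrow> Q z = ode_coeff r s t z"
  shows "\<not> log_solution_infinity Q y"
proof
  assume "log_solution_infinity Q y"
  then obtain Y \<alpha> g h where log: "solution_on Q {z. Im z > Y} y"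
    "g holomorphic_on ball 0 (exp (- 2 * pi * Y))" "h holomorphic_on ball 0 (exp (- 2 * pi * Y))"
    "\<exists>q\<in>ball 0 (exp (- 2 * pi * Y)). h q \<noteq> 0"
    "\<And>z. Im z > Y \<Longrightarrow> y z = exp (2 * of_real pi * \<i> * \<alpha> * z) * (g (nome z) + h (nome z) * (2 * of_real pi * \<i> * z))"
    unfolding log_solution_infinity_def by blast
  define R where "R = exp (- 2 * pi * Y)"
  have R: "R > 0" by (simp add: R_def)
  obtain R0 k4 k6 kD where loc: "0 < R0" "R0 < 1"
    "k4 holomorphic_on ball 0 R0" "k6 holomorphic_on ball 0 R0" "kD holomorphic_on ball 0 R0"
    "\<And>q. q \<in> ball 0 R0 \<Longrightarrow> e4 q = exp (k4 q)"
    "\<And>q. q \<in> ball 0 R0 \<Longrightarrow> e6 q = exp (k6 q)"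
    "\<And>q. q \<in> ball 0 R0 \<Longrightarrow> e4 q ^ 3 - e6 q ^ 2 = q * exp (kD q)"
    using cusp_factorization by blast
  define R1 where "R1 = min R R0"
  have R1: "R1 > 0" "R1 \<le> R" "R1 \<le> R0" "R1 < 1" using R loc(1,2) by (simp_all add: R1_def)
  then have sub: "ball 0 R1 \<subseteq> ball (0::complex) R" "ball 0 R1 \<subseteq> ball (0::complex) R0" by auto
  have gh: "g holomorphic_on ball 0 R1" "h holomorphic_on ball 0 R1"
    using log(2,3) sub(1) unfolding R_def by (auto intro: holomorphic_on_subset)
  define Y1 where "Y1 = - ln R1 / (2 * pi)"
  have Y1: "exp (- 2 * pi * Y1) = R1" "Y1 > 0" using R1 by (simp_all add: Y1_def divide_neg_pos)
  have "exp (- 2 * pi * Y1) \<le> exp (- 2 * pi * Y)" using R1(2) unfolding Y1(1) R_def .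
  then have YY: "Y \<le> Y1" by simp
  define V where "V = {z. Im z > Y1}"
  have V: "open V" "connected V" "V \<subseteq> upper_half_plane" "V \<subseteq> {z. Im z > Y}"
    unfolding V_def using Y1(2) YY
    by (auto simp: open_halfspace_Im_gt convex_connected convex_halfspace_Im_gt)
  have "Complex 0 (Y1 + 1) \<in> V" by (simp add: V_def)
  then have V0: "V \<noteq> {}" by blast
  have q: "nome z \<in> ball 0 R1" if "z \<in> V" for z
    using that unfolding Y1(1)[symmetric] by (simp add: norm_nome V_def)
  have q': "nome z \<in> ball 0 R0" and I: "Im z > 0" if "z \<in> V" for z using q[OF that] sub V(3) that by auto
  define l4 l6 lD where "l4 z = k4 (nome z)" "l6 z = k6 (nome z)" "lD z = tpi * z + kD (nome z)" for z
  have lV: "l4 holomorphic_on V" "l6 holomorphic_on V" "lD holomorphic_on V"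
    unfolding l4_l6_lD_def
    using nome_comp_holomorphic[OF loc(3) q'] nome_comp_holomorphic[OF loc(4) q'] nome_comp_holomorphic[OF loc(5) q']
    by (auto intro!: holomorphic_intros)
  have nome_exp: "nome z = exp (tpi * z)" for z by (simp add: nome_def tpi_def)
  have lE: "E4 z = exp (l4 z)" "E6 z = exp (l6 z)" "discr z = exp (lD z)" if "z \<in> V" for z
  proof -
    show "E4 z = exp (l4 z)" "E6 z = exp (l6 z)"
      using loc(6,7)[OF q'[OF that]] by (simp_all add: l4_l6_lD_def E4_eq_e4 E6_eq_e6 I[OF that])
    show "discr z = exp (lD z)"
      using loc(8)[OF q'[OF that]]
      by (simp add: l4_l6_lD_def discr_def E4_eq_e4 E6_eq_e6 I[OF that] exp_add nome_exp[symmetric])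
  qed
  have "solution_on (ode_coeff r s t) V y"
    using solution_on_subset[OF log(1) V(4)] Q I by (simp add: solution_on_def)
  then obtain P where P: "\<And>z. z \<in> V \<Longrightarrow> y z = prefactor l4 l6 lD z * poly P (inv_j z)"
    using solution_is_polynomial[OF V(1,2) V0 V(3) lV lE] by blast
  define \<beta> where "\<beta> = (- of_real (real Nf / 2) :: complex)"
  define K where "K q = of_real ee * k4 q + of_real (1/2 - real Ni) * k6 q - of_real (real Nf / 2) * kD q" for q
  define M where "M q = exp (K q) * poly P ((e4 q ^ 3 - e6 q ^ 2) / e4 q ^ 3)" for q
  have h0: "h \<zeta> = 0" if "\<zeta> \<in> ball 0 R1" for \<zeta>
  proof (rule no_logarithm[where g = g and h = h and M = M and R = R1 and \<alpha> = \<alpha> and \<beta> = \<beta>])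
    have nz: "e4 q \<noteq> 0" if "q \<in> ball 0 R1" for q using loc(6)[of q] that sub(2) by auto
    have "k4 holomorphic_on ball 0 R1 - {0}" "k6 holomorphic_on ball 0 R1 - {0}" "kD holomorphic_on ball 0 R1 - {0}"
      using loc(3-5) sub(2) by (auto intro: holomorphic_on_subset)
    then show "M holomorphic_on ball 0 R1 - {0}"
      unfolding M_def K_def poly_altdef using nz R1(4) by (intro holomorphic_intros) auto
    fix w assume w: "Re w < ln R1" "\<bar>Im w\<bar> < pi"
    define z where "z = w / tpi"
    have zw: "tpi * z = w" by (simp add: z_def)
    then have nz: "nome z = exp w" by (simp add: nome_exp)
    have "exp (Re w) < exp (ln R1)" using w by simp
    then have "norm (nome z) < R1" unfolding nz using R1(1) by (simp add: norm_exp_eq_Re)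
    then have zV: "z \<in> V" unfolding Y1(1)[symmetric] by (simp add: norm_nome V_def)
    have "prefactor l4 l6 lD z = exp (\<beta> * w) * exp (K (nome z))"
      unfolding prefactor_def l4_l6_lD_def K_def \<beta>_def exp_add[symmetric] zw
      by (simp add: algebra_simps add_divide_distrib)
    moreover have "inv_j z = (e4 (nome z) ^ 3 - e6 (nome z) ^ 2) / e4 (nome z) ^ 3"
      by (simp add: inv_j_def discr_def E4_eq_e4 E6_eq_e6 I[OF zV])
    ultimately have "y z = exp (\<beta> * w) * M (exp w)" using P[OF zV] by (simp add: M_def nz)
    moreover have "y z = exp (\<alpha> * w) * (g (exp w) + h (exp w) * w)"
    proof -
      have 1: "2 * of_real pi * \<i> * \<alpha> * z = \<alpha> * w" "2 * of_real pi * \<i> * z = w"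
        unfolding zw[symmetric] tpi_def by simp_all
      have "Im z > Y" using zV V(4) by blast
      from log(5)[OF this] show ?thesis unfolding 1 nz .
    qed
    ultimately show "exp (\<alpha> * w) * (g (exp w) + h (exp w) * w) = exp (\<beta> * w) * M (exp w)" by simp
  qed (use R1 that gh in auto)
  have "h z = 0" if z: "z \<in> ball 0 R" for z
    by (rule analytic_continuation_open[of "ball 0 R1" "ball 0 R" h "\<lambda>_. 0"])
      (use log(3) h0 z R1 in \<open>auto simp: R_def\<close>)
  then show False using log(4) by (auto simp: R_def)
qed

text \<open>The polynomials come from a small disc without zeros of \<open>E4\<close> and
  \<open>E6\<close>, where logarithms exist. Cleared of denominators, the identity between y1 / y2
  and the quotient of forms is holomorphic on U and extends to all of U without any choice of
  branch.\<close>

lemma ratios_modular: "solution_ratios_modular (ode_coeff r s t)"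
  unfolding solution_ratios_modular_def
proof (intro allI impI, elim conjE)
  fix U y1 y2
  assume U: "open U" "connected U" "U \<subseteq> upper_half_plane"
    and y: "solution_on (ode_coeff r s t) U y1" "solution_on (ode_coeff r s t) U y2"
    and nz: "\<exists>z\<in>U. y2 z \<noteq> 0"
  have hy: "y1 holomorphic_on U" "y2 holomorphic_on U" using y by (auto simp: solution_on_def)
  obtain z0 where z0: "z0 \<in> U" "E4 z0 \<noteq> 0" "E6 z0 \<noteq> 0"
    using regular_point_exists[OF U(1) _ U(3)] nz by blast
  have "open (U \<inter> {z \<in> upper_half_plane. E4 z \<noteq> 0 \<and> E6 z \<noteq> 0})"
    using U(1) open_regular_points by (rule open_Int)
  moreover have "z0 \<in> U \<inter> {z \<in> upper_half_plane. E4 z \<noteq> 0 \<and> E6 z \<noteq> 0}" using z0 U(3) by auto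
  ultimately obtain \<rho> where \<rho>: "\<rho> > 0" "ball z0 \<rho> \<subseteq> U \<inter> {z \<in> upper_half_plane. E4 z \<noteq> 0 \<and> E6 z \<noteq> 0}"
    by (rule openE)
  define B where "B = ball z0 \<rho>"
  have B: "open B" "connected B" "B \<noteq> {}" "B \<subseteq> upper_half_plane" "B \<subseteq> U"
    "\<And>z. z \<in> B \<Longrightarrow> E4 z \<noteq> 0" "\<And>z. z \<in> B \<Longrightarrow> E6 z \<noteq> 0"
    using \<rho> by (auto simp: B_def)
  have contr: "contractible B" unfolding B_def by (rule convex_imp_contractible[OF convex_ball])
  have discr0: "discr z \<noteq> 0" if "z \<in> B" for z using discr_nonzero[of z] B(4) that by auto
  have hB: "E4 holomorphic_on B" "E6 holomorphic_on B" "discr holomorphic_on B"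
    using E4_holomorphic E6_holomorphic discr_holomorphic B(4) by (auto intro: holomorphic_on_subset)
  obtain l4 where l4: "l4 holomorphic_on B" "\<And>z. z \<in> B \<Longrightarrow> E4 z = exp (l4 z)"
    using contractible_imp_holomorphic_log[OF hB(1) contr B(6)] by blast
  obtain l6 where l6: "l6 holomorphic_on B" "\<And>z. z \<in> B \<Longrightarrow> E6 z = exp (l6 z)"
    using contractible_imp_holomorphic_log[OF hB(2) contr B(7)] by blast
  obtain lD where lD: "lD holomorphic_on B" "\<And>z. z \<in> B \<Longrightarrow> discr z = exp (lD z)"
    using contractible_imp_holomorphic_log[OF hB(3) contr discr0] by blast
  note form = solution_is_polynomial[OF B(1-4) l4(1) l6(1) lD(1) l4(2) l6(2) lD(2)]
  obtain p1 where p1: "\<And>z. z \<in> B \<Longrightarrow> y1 z = prefactor l4 l6 lD z * poly p1 (inv_j z)"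
    using form[OF _ _ _ solution_on_subset[OF y(1) B(5)]] by blast
  obtain p2 where p2: "\<And>z. z \<in> B \<Longrightarrow> y2 z = prefactor l4 l6 lD z * poly p2 (inv_j z)"
    using form[OF _ _ _ solution_on_subset[OF y(2) B(5)]] by blast
  define k where "k = max (degree p1) (degree p2)"
  define N where "N p z = hom_poly k p (E4 z ^ 3) (discr z)" for p z
  have N: "N p holomorphic_on upper_half_plane" for p
    unfolding N_def hom_poly_def by (intro holomorphic_intros E4_holomorphic discr_holomorphic)
  have NB: "N p z = (E4 z ^ 3) ^ k * poly p (inv_j z)" if "degree p \<le> k" "z \<in> B" for p z
    unfolding N_def inv_j_def using B(6)[OF that(2)] by (intro hom_poly_eq that) auto
  obtain z1 where z1: "z1 \<in> B" "y2 z1 \<noteq> 0"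
  proof (rule ccontr)
    assume "\<not> thesis"
    with that have 0: "y2 z = 0" if "z \<in> B" for z using that by blast
    have "y2 z = 0" if z: "z \<in> U" for z
      by (rule analytic_continuation_open[of B U y2 "\<lambda>_. 0"]) (use B U hy z 0 in auto)
    then show False using nz by blast
  qed
  have N2: "N p2 z1 \<noteq> 0"
    using z1 p2[OF z1(1)] NB[of p2 z1] B(6)[OF z1(1)] by (auto simp: k_def)
  have cross: "y1 z * N p2 z - y2 z * N p1 z = 0" if z: "z \<in> U" for z
  proof (rule analytic_continuation_open[of B U "\<lambda>z. y1 z * N p2 z - y2 z * N p1 z" "\<lambda>_. 0"])
    show "(\<lambda>z. y1 z * N p2 z - y2 z * N p1 z) holomorphic_on U"
      by (intro holomorphic_intros hy holomorphic_on_subset[OF N U(3)])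
    show "y1 z * N p2 z - y2 z * N p1 z = 0" if "z \<in> B" for z
      using NB[of p1 z] NB[of p2 z] p1[OF that] p2[OF that] that by (simp add: k_def)
  qed (use B U z in auto)
  define f where "f = remove_sings (\<lambda>z. N p1 z / N p2 z)"
  have "modular_function f"
    unfolding f_def N_def
    by (rule ratio_of_forms_modular) (rule exI[of _ z1], use N2 z1 B(4) in \<open>auto simp: N_def\<close>)
  moreover have "f z = y1 z / y2 z" if z: "z \<in> U" "y2 z \<noteq> 0" for z
    unfolding f_def
  proof (rule remove_sings_eqI)
    have zH: "z \<in> upper_half_plane" using z U(3) by blast
    have cont: "isCont y1 z" "isCont y2 z"
      using hy U(1) z by (auto simp: continuous_on_eq_continuous_at dest!: holomorphic_on_imp_continuous_on)
    then have lim: "(\<lambda>z. y1 z / y2 z) \<midarrow>z\<rightarrow> y1 z / y2 z"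
      using z(2) by (auto simp: isCont_def intro!: tendsto_intros)
    have "\<forall>\<^sub>F w in at z. w \<in> U - {z}" using U(1) z by (intro eventually_at_in_open) auto
    moreover have "\<forall>\<^sub>F w in at z. N p2 w \<noteq> 0 \<and> w \<in> upper_half_plane"
      by (rule non_zero_neighbour_alt[OF N open_upper_half_plane connected_upper_half_plane zH _ N2])
        (use z1 B(4) in auto)
    moreover have "\<forall>\<^sub>F w in at z. y2 w \<noteq> 0"
      using cont(2) z(2) by (auto simp: isCont_def intro: tendsto_imp_eventually_ne)
    ultimately have ev: "\<forall>\<^sub>F w in at z. y1 w / y2 w = N p1 w / N p2 w"
      by eventually_elim (use cross in \<open>auto simp: field_simps\<close>)
    show "(\<lambda>z. N p1 z / N p2 z) \<midarrow>z\<rightarrow> y1 z / y2 z"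
      by (rule Lim_transform_eventually[OF lim ev])
  qed
  ultimately show "\<exists>f. modular_function f \<and> (\<forall>z\<in>U. y2 z \<noteq> 0 \<longrightarrow> f z = y1 z / y2 z)" by blast
qed

end

section \<open>From apparentness to the arithmetic conditions\<close>

lemma mobius_one: "mobius 1 0 0 1 z = z"
  by (simp add: mobius_def)

lemma ode_coeff_mobius:
  assumes "a * d - b * c = 1" "Im z > 0"
  shows "slash4 (ode_coeff r s t) a b c d z = ode_coeff r s t z"
proof -
  define J where "J = of_int c * z + of_int d"
  have J: "J \<noteq> 0" using mobius_denom_nonzero[OF assms] by (simp add: J_def)
  have J6: "J ^ 6 = J ^ 4 * J ^ 2" and J8: "(J ^ 4) ^ 2 = (J ^ 4 * J ^ 2) * J ^ 2"
    by (simp_all flip: power_add power_mult)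
  have "(J ^ 6 * v) ^ 2 / (J ^ 4 * u) ^ 2 = J ^ 4 * (v ^ 2 / u ^ 2)" for u v
  proof -
    have "(J ^ 6 * v) / (J ^ 4 * u) = J ^ 2 * (v / u)"
      unfolding J6 mult.assoc by (subst mult_divide_mult_cancel_left) (use J in simp_all)
    then have "((J ^ 6 * v) / (J ^ 4 * u)) ^ 2 = (J ^ 2 * (v / u)) ^ 2" by simp
    then show ?thesis by (simp add: power_mult_distrib power_divide flip: power_mult)
  qed
  moreover have "(J ^ 4 * u) ^ 4 / (J ^ 6 * v) ^ 2 = J ^ 4 * (u ^ 4 / v ^ 2)" for u v
  proof -
    have "(J ^ 4 * u) ^ 2 / (J ^ 6 * v) = J ^ 2 * (u ^ 2 / v)"
      unfolding J6 power_mult_distrib J8 mult.assoc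
      by (subst mult_divide_mult_cancel_left, use J in simp)+ simp
    then have "((J ^ 4 * u) ^ 2 / (J ^ 6 * v)) ^ 2 = (J ^ 2 * (u ^ 2 / v)) ^ 2" by simp
    then show ?thesis by (simp add: power_mult_distrib power_divide flip: power_mult)
  qed
  ultimately have "ode_coeff r s t (mobius a b c d z) = J ^ 4 * ode_coeff r s t z"
    unfolding ode_coeff_def E4_mobius[OF assms] E6_mobius[OF assms] J_def[symmetric]
    by (simp add: algebra_simps)
  then show ?thesis using J by (simp add: slash4_def J_def)
qed

lemma local_exponents_infinity_ode_coeff:
  fixes \<kappa> :: complex
  assumes "\<And>z. Im z > 0 \<Longrightarrow> Q z = ode_coeff r s t z"
  shows "local_exponents_infinity Q \<kappa> (- \<kappa>) \<longleftrightarrow> r + s + t = - ((2 * \<kappa>) ^ 2)"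
proof -
  obtain R G where *: "0 < R" "R < 1" "G holomorphic_on ball 0 R"
    "\<And>z. nome z \<in> ball 0 R \<Longrightarrow> ode_coeff r s t z = G (nome z)" "G 0 = of_real pi ^ 2 * (r + s + t)"
    using ode_coeff_at_cusp by metis
  have "Q z = G (nome z)" if "nome z \<in> ball 0 R" for z
  proof -
    have "Im z > 0" using that *(2) norm_nome_less_1_iff[of z] by simp
    then show ?thesis using assms *(4)[OF that] by simp
  qed
  then have "local_exponents_infinity Q \<kappa> (- \<kappa>) \<longleftrightarrow> G 0 = - (4 * of_real pi ^ 2 * \<kappa> ^ 2)"
    by (rule local_exponents_infinity_iff[OF *(1,3)])
  also have "\<dots> \<longleftrightarrow> of_real pi ^ 2 * (r + s + t) = of_real pi ^ 2 * (- ((2 * \<kappa>) ^ 2))"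
    unfolding *(5) by (simp add: power_mult_distrib mult_ac)
  also have "\<dots> \<longleftrightarrow> r + s + t = - ((2 * \<kappa>) ^ 2)" by (subst mult_cancel_left) simp
  finally show ?thesis .
qed

lemma local_exponents_E4_zero:
  fixes \<kappa> :: complex
  assumes "Im p > 0" "E4 p = 0"
  shows "local_exponents_at (ode_coeff r s t) p (1/2 + \<kappa>) (1/2 - \<kappa>) \<longleftrightarrow> s = (1 - 4 * \<kappa> ^ 2) / 9"
proof -
  obtain R A where *: "R > 0" "A holomorphic_on ball p R"
    "\<And>z. z \<in> ball p R - {p} \<Longrightarrow> ode_coeff r s t z = A z / (z - p) ^ 2" "A p = - (9 * s / 4)"
    using ode_coeff_at_E4_zero[OF assms] by blast
  have "- (9 * s / 4) = \<kappa> ^ 2 - 1/4 \<longleftrightarrow> s = (1 - 4 * \<kappa> ^ 2) / 9"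
    by (auto simp: field_simps)
  then show ?thesis using local_exponents_at_iff[OF *(1-3), of \<kappa>] *(4) by simp
qed

lemma local_exponents_E6_zero:
  fixes \<kappa> :: complex
  assumes "Im p > 0" "E6 p = 0"
  shows "local_exponents_at (ode_coeff r s t) p (1/2 + \<kappa>) (1/2 - \<kappa>) \<longleftrightarrow> t = (1 - 4 * \<kappa> ^ 2) / 4"
proof -
  obtain R A where *: "R > 0" "A holomorphic_on ball p R"
    "\<And>z. z \<in> ball p R - {p} \<Longrightarrow> ode_coeff r s t z = A z / (z - p) ^ 2" "A p = - t"
    using ode_coeff_at_E6_zero[OF assms] by blast
  have "- t = \<kappa> ^ 2 - 1/4 \<longleftrightarrow> t = (1 - 4 * \<kappa> ^ 2) / 4"
    by (auto simp: field_simps)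
  then show ?thesis using local_exponents_at_iff[OF *(1-3), of \<kappa>] *(4) by simp
qed

lemma pole_at_rho: "s \<noteq> 0 \<Longrightarrow> is_pole (ode_coeff r s t) rho"
  using ode_coeff_at_E4_zero[OF Im_rho E4_rho, of r s t] is_pole_double
  by (metis divide_eq_0_iff mult_eq_0_iff neg_equal_0_iff_equal zero_neq_numeral)

lemma pole_at_ii: "t \<noteq> 0 \<Longrightarrow> is_pole (ode_coeff r s t) \<i>"
  using ode_coeff_at_E6_zero[OF _ E6_ii, of r s t] is_pole_double
  by (metis imaginary_unit.sel(2) neg_equal_0_iff_equal zero_less_one)

lemma square_eq_of_nat_half:
  fixes \<kappa> :: real
  assumes "(of_real \<kappa> :: complex) ^ 2 = (of_nat k / 2) ^ 2" "\<kappa> \<ge> 0"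
  shows "2 * \<kappa> = real k"
proof -
  have "(of_real (\<kappa> ^ 2) :: complex) = of_real ((real k / 2) ^ 2)" using assms(1) by simp
  then have "\<kappa> ^ 2 = (real k / 2) ^ 2" by (simp only: of_real_eq_iff)
  then have "\<kappa> = real k / 2" using assms(2) by (simp add: power2_eq_iff_nonneg)
  then show ?thesis by simp
qed

lemma ind_poly_factor:
  "ind_poly n m (((1 - m - real n) ^ 2 - c ^ 2) / 4) k =
    (2 * real k + 1 - m - real n - c) * (2 * real k + 1 - m - real n + c) / 4"
  by (simp add: ind_poly_def power2_eq_square field_simps)

text \<open>Clearing denominators gives 3 a +- 2 b = 6 j; reduction modulo 2 and modulo 3 separates
  a from b.\<close>

lemma half_third_integer:
  fixes a b :: nat and j :: int
  assumes "real a / 2 + \<epsilon> * (real b / 3) = of_int j" "\<epsilon> = 1 \<or> \<epsilon> = -1"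
  shows "\<exists>Na Nb. real a / 2 = real Na \<and> real b / 3 = real Nb"
proof -
  have "3 * real a + \<epsilon> * 2 * real b = 6 * of_int j" using assms(1) by (simp add: field_simps)
  then have "real_of_int (3 * int a + 2 * int b) = of_int (6 * j) \<or> real_of_int (3 * int a - 2 * int b) = of_int (6 * j)"
    using assms(2) by auto
  then have "3 * int a + 2 * int b = 6 * j \<or> 3 * int a - 2 * int b = 6 * j"
    by (simp only: of_int_eq_iff)
  then have "even a \<and> 3 dvd b" by presburger
  then show ?thesis by (auto elim!: evenE dvdE)
qed

lemma apparent_imp_conditions:
  fixes \<kappa>i \<kappa>\<rho> \<kappa>inf :: real and r s t :: complex
  assumes nonneg: "\<kappa>i \<ge> 0" "\<kappa>\<rho> \<ge> 0" "\<kappa>inf \<ge> 0"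
    and s: "s = (1 - 4 * of_real \<kappa>\<rho> ^ 2) / 9" and t: "t = (1 - 4 * of_real \<kappa>i ^ 2) / 4"
    and rst: "r + s + t = - ((2 * of_real \<kappa>inf) ^ 2)"
    and app: "apparent_throughout (ode_coeff r s t)"
  shows "\<exists>ni n\<rho> ninf :: nat. real ni = \<kappa>i \<and> real n\<rho> = 2 * \<kappa>\<rho> / 3 \<and> real ninf = 2 * \<kappa>inf \<and>
           ni > 0 \<and> n\<rho> > 0 \<and> ninf > 0 \<and> odd (ni + n\<rho> + ninf) \<and>
           ni + n\<rho> > ninf \<and> ni + ninf > n\<rho> \<and> n\<rho> + ninf > ni"
proof -
  let ?Q = "ode_coeff r s t"
  have slash: "slash4 ?Q 1 0 0 1 = ?Q" by (simp add: slash4_def mobius_one fun_eq_iff)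
  have "apparent_at_infinity ?Q"
    using app slash unfolding apparent_throughout_def by (metis diff_zero mult_1 mult_zero_left)
  then obtain kinf where kinf: "local_exponents_infinity ?Q (of_nat kinf / 2) (- (of_nat kinf / 2))"
    and nolog_inf: "\<not> (\<exists>y. log_solution_infinity ?Q y)"
    unfolding apparent_at_infinity_def by blast
  have "r + s + t = - ((2 * (of_nat kinf / 2)) ^ 2)"
    using kinf by (subst (asm) local_exponents_infinity_ode_coeff) auto
  then have "(of_real \<kappa>inf :: complex) ^ 2 = (of_nat kinf / 2) ^ 2"
    using rst by (simp add: power_mult_distrib power_divide mult.commute)
  then have kinf': "2 * \<kappa>inf = real kinf" using nonneg(3) by (rule square_eq_of_nat_half)
  have exps: "\<exists>k::nat. local_exponents_at ?Q p (1/2 + of_nat k / 2) (1/2 - of_nat k / 2)"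
    "\<not> (\<exists>y. log_solution_at ?Q p y)" if "Im p > 0" "is_pole ?Q p" for p
    using app that unfolding apparent_throughout_def apparent_at_def by auto
  obtain k\<rho> where k\<rho>: "2 * \<kappa>\<rho> = real k\<rho>"
  \<comment> \<open>If s = 0, then \<open>rho\<close> is an ordinary point to which the hypothesis
    does not apply, but s itself forces the exponent \<kappa>\<rho> = 1/2. The point
    \<open>\<i>\<close> is treated alike below.\<close>
  proof (cases "s = 0")
    case True
    then have "4 * of_real \<kappa>\<rho> ^ 2 = (1 :: complex)" using s by simp
    then have "(of_real \<kappa>\<rho> :: complex) ^ 2 = (of_nat 1 / 2) ^ 2" by (simp add: field_simps power_divide)
    then show ?thesis using that square_eq_of_nat_half[OF _ nonneg(2)] by blast
  next
    case False
    obtain k :: nat where "local_exponents_at ?Q rho (1/2 + of_nat k / 2) (1/2 - of_nat k / 2)"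
      using exps(1)[OF Im_rho pole_at_rho[OF False]] by blast
    then have "s = (1 - 4 * (of_nat k / 2) ^ 2) / 9"
      by (subst (asm) local_exponents_E4_zero[OF Im_rho E4_rho])
    then have "(of_real \<kappa>\<rho> :: complex) ^ 2 = (of_nat k / 2) ^ 2" unfolding s by (simp add: field_simps)
    then show ?thesis using that square_eq_of_nat_half[OF _ nonneg(2)] by blast
  qed
  have Ii: "Im \<i> > 0" by simp
  obtain ki where ki: "2 * \<kappa>i = real ki"
  proof (cases "t = 0")
    case True
    then have "4 * of_real \<kappa>i ^ 2 = (1 :: complex)" using t by simp
    then have "(of_real \<kappa>i :: complex) ^ 2 = (of_nat 1 / 2) ^ 2" by (simp add: field_simps power_divide)
    then show ?thesis using that square_eq_of_nat_half[OF _ nonneg(1)] by blast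
  next
    case False
    obtain k :: nat where "local_exponents_at ?Q \<i> (1/2 + of_nat k / 2) (1/2 - of_nat k / 2)"
      using exps(1)[OF Ii pole_at_ii[OF False]] by blast
    then have "t = (1 - 4 * (of_nat k / 2) ^ 2) / 4"
      by (subst (asm) local_exponents_E6_zero[OF Ii E6_ii])
    then have "(of_real \<kappa>i :: complex) ^ 2 = (of_nat k / 2) ^ 2" unfolding t by (simp add: field_simps)
    then show ?thesis using that square_eq_of_nat_half[OF _ nonneg(1)] by blast
  qed
  interpret pulled_back \<kappa>i "2 * \<kappa>\<rho> / 3" "2 * \<kappa>inf" r s t
    by unfold_locales (use s t rst in \<open>simp_all add: power_mult_distrib power_divide\<close>)
  obtain k1 where k1: "k1 < kinf" "ind_poly kinf \<kappa>i ab k1 = 0"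
    using log_solution_at_cusp[OF kinf'] nolog_inf by blast
  have ab_eq: "ab = ((1 - \<kappa>i - real kinf) ^ 2 - (2 * \<kappa>\<rho> / 3) ^ 2) / 4" unfolding ab_def unfolding kinf' ..
  define c where "c = 2 * \<kappa>\<rho> / 3"
  have "(2 * real k1 + 1 - \<kappa>i - real kinf - c) * (2 * real k1 + 1 - \<kappa>i - real kinf + c) = 0"
    using k1(2) unfolding ab_eq ind_poly_factor c_def by simp
  then have "\<kappa>i + 1 * c = 2 * real k1 + 1 - real kinf \<or> \<kappa>i + (- 1) * c = 2 * real k1 + 1 - real kinf"
    by auto
  then obtain \<epsilon> :: real where \<epsilon>: "\<epsilon> = 1 \<or> \<epsilon> = -1" "\<kappa>i + \<epsilon> * c = 2 * real k1 + 1 - real kinf"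
    by blast
  have "real ki / 2 + \<epsilon> * (real k\<rho> / 3) = of_int (2 * int k1 + 1 - int kinf)"
    using \<epsilon>(2) ki k\<rho> by (simp add: c_def)
  then obtain Ni Nr where N: "real ki / 2 = real Ni" "real k\<rho> / 3 = real Nr"
    using half_third_integer \<epsilon>(1) by blast
  have Ni: "\<kappa>i = real Ni" and Nr: "c = real Nr" using N ki k\<rho> by (simp_all add: c_def)
  \<comment> \<open>Since \<kappa>i is now known to be an integer, it is not 1/2; so
    \<open>\<i>\<close> is a true pole and the hypothesis excludes logarithms there as well.\<close>
  have "t \<noteq> 0"
  proof
    assume "t = 0"
    then have "4 * of_real \<kappa>i ^ 2 = (1 :: complex)" using t by simp
    then have "(of_real \<kappa>i :: complex) ^ 2 = (of_nat 1 / 2) ^ 2" by (simp add: field_simps power_divide)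
    then have "2 * \<kappa>i = real 1" using nonneg(1) by (rule square_eq_of_nat_half)
    then have "real (2 * Ni) = real 1" by (simp add: Ni)
    then have "2 * Ni = 1" by (simp only: of_nat_eq_iff)
    then show False by presburger
  qed
  then have "\<not> (\<exists>y. log_solution_at ?Q \<i> y)" using exps(2)[OF Ii pole_at_ii] by blast
  then obtain k2 where k2: "k2 < Ni" "ind_poly Ni (2 * \<kappa>inf) ab k2 = 0"
    using log_solution_at_E6_zero[OF Ii E6_ii Ni] by blast
  have ab_eq': "ab = ((1 - real kinf - real Ni) ^ 2 - (2 * \<kappa>\<rho> / 3) ^ 2) / 4"
    unfolding ab_def unfolding kinf' Ni by (simp add: power2_eq_square algebra_simps)
  have "(2 * real k2 + 1 - real kinf - real Ni - c) * (2 * real k2 + 1 - real kinf - real Ni + c) = 0"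
    using k2(2) unfolding ab_eq' unfolding kinf' ind_poly_factor c_def by simp
  then have "2 * real k2 + 1 = real kinf + real Ni + real Nr \<or> 2 * real k2 + 1 + real Nr = real kinf + real Ni"
    unfolding Nr by auto
  then have "real (2 * k2 + 1) = real (kinf + Ni + Nr) \<or> real (2 * k2 + 1 + Nr) = real (kinf + Ni)" by auto
  then have A2: "2 * k2 + 1 = kinf + Ni + Nr \<or> 2 * k2 + 1 + Nr = kinf + Ni" by (simp only: of_nat_eq_iff)
  have "real (Ni + Nr + kinf) = real (2 * k1 + 1) \<or> real (Ni + kinf) = real (2 * k1 + 1 + Nr)"
    using \<epsilon> unfolding Ni Nr by auto
  then have A1: "Ni + Nr + kinf = 2 * k1 + 1 \<or> Ni + kinf = 2 * k1 + 1 + Nr" by (simp only: of_nat_eq_iff)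
  have "Ni + Nr + kinf = 2 * k1 + 1 \<or> Ni + Nr + kinf = 2 * (k1 + Nr) + 1" using A1 by auto
  then have "odd (Ni + Nr + kinf)" by (elim disjE) (erule ssubst, simp)+
  \<comment> \<open>Of the four combinations of A1 and A2 only that of the two second alternatives
    is compatible with k1 < kinf and k2 < Ni. It says that Ni + kinf - Nr is positive and less than
    both 2 kinf and 2 Ni, which are the three inequalities.\<close>
  moreover have "Ni + Nr > kinf \<and> Ni + kinf > Nr \<and> Nr + kinf > Ni"
    using A1 A2 k1(1) k2(1) by (elim disjE) linarith+
  moreover from this have "Ni > 0 \<and> Nr > 0 \<and> kinf > 0" by linarith
  ultimately show ?thesis
    using Ni Nr kinf' by (intro exI[of _ Ni] exI[of _ Nr] exI[of _ kinf]) (simp add: c_def)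
qed

section \<open>From the arithmetic conditions to apparentness, and the equivalence\<close>

context apparent_case begin

lemma apparent: "apparent_throughout (ode_coeff r s t)"
  unfolding apparent_throughout_def
proof (intro conjI ballI impI allI)
  fix p assume p: "p \<in> upper_half_plane" and pole: "is_pole (ode_coeff r s t) p"
  have I: "Im p > 0" using p by simp
  have "\<exists>k::nat. local_exponents_at (ode_coeff r s t) p (1/2 + of_nat k / 2) (1/2 - of_nat k / 2)"
    using pole_imp_zero[OF I pole]
  proof
    assume "E4 p = 0"
    \<comment> \<open>Here \<kappa>\<rho> = 3 Nr / 2, so the exponent difference 2 \<kappa>\<rho> is
      3 Nr; at the zeros of \<open>E6\<close> it is 2 Ni.\<close>
    then have "local_exponents_at (ode_coeff r s t) p (1/2 + of_nat (3 * Nr) / 2) (1/2 - of_nat (3 * Nr) / 2)"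
      by (subst local_exponents_E4_zero[OF I]) (simp_all add: s power_divide power_mult_distrib)
    then show ?thesis by blast
  next
    assume "E6 p = 0"
    then have "local_exponents_at (ode_coeff r s t) p (1/2 + of_nat (2 * Ni) / 2) (1/2 - of_nat (2 * Ni) / 2)"
      by (subst local_exponents_E6_zero[OF I]) (simp_all add: t power_divide power_mult_distrib)
    then show ?thesis by blast
  qed
  then show "apparent_at (ode_coeff r s t) p"
    unfolding apparent_at_def using no_log_solution_at[OF I] by blast
next
  fix a b c d :: int assume det: "a * d - b * c = 1"
  note eq = ode_coeff_mobius[OF det, of _ r s t]
  have "local_exponents_infinity (slash4 (ode_coeff r s t) a b c d) (of_nat Nf / 2) (- (of_nat Nf / 2))"
    by (subst local_exponents_infinity_ode_coeff[OF eq]) (simp_all add: rst)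
  then show "apparent_at_infinity (slash4 (ode_coeff r s t) a b c d)"
    unfolding apparent_at_infinity_def using no_log_solution_infinity[OF eq] by blast
qed

end

theorem theorem1p6:
  fixes r s t :: complex and \<kappa>i \<kappa>\<rho> \<kappa>inf :: real
  assumes "\<kappa>i \<ge> 0" and "\<kappa>\<rho> \<ge> 0" and "\<kappa>inf \<ge> 0"
  shows
    "((local_exponents_at (ode_coeff r s t) \<i> (1/2 + of_real \<kappa>i) (1/2 - of_real \<kappa>i) \<and>
       local_exponents_at (ode_coeff r s t) rho (1/2 + of_real \<kappa>\<rho>) (1/2 - of_real \<kappa>\<rho>) \<and>
       local_exponents_infinity (ode_coeff r s t) (of_real \<kappa>inf) (- of_real \<kappa>inf))
      \<longleftrightarrow>
      (s = (1 - 4 * of_real \<kappa>\<rho> ^ 2) / 9 \<and>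
       t = (1 - 4 * of_real \<kappa>i ^ 2) / 4 \<and>
       r + s + t = - ((2 * of_real \<kappa>inf) ^ 2)))
     \<and>
     (local_exponents_at (ode_coeff r s t) \<i> (1/2 + of_real \<kappa>i) (1/2 - of_real \<kappa>i) \<and>
      local_exponents_at (ode_coeff r s t) rho (1/2 + of_real \<kappa>\<rho>) (1/2 - of_real \<kappa>\<rho>) \<and>
      local_exponents_infinity (ode_coeff r s t) (of_real \<kappa>inf) (- of_real \<kappa>inf)
      \<longrightarrow>
      (apparent_throughout (ode_coeff r s t) \<longleftrightarrow>
        (\<exists>ni n\<rho> ninf :: nat.
           real ni = \<kappa>i \<and> real n\<rho> = 2 * \<kappa>\<rho> / 3 \<and> real ninf = 2 * \<kappa>inf \<and>
           ni > 0 \<and> n\<rho> > 0 \<and> ninf > 0 \<and>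
           odd (ni + n\<rho> + ninf) \<and>
           ni + n\<rho> > ninf \<and> ni + ninf > n\<rho> \<and> n\<rho> + ninf > ni)) \<and>
      (apparent_throughout (ode_coeff r s t) \<longrightarrow> solution_ratios_modular (ode_coeff r s t)))"
proof -
  let ?Q = "ode_coeff r s t"
  let ?C = "\<exists>ni n\<rho> ninf :: nat. real ni = \<kappa>i \<and> real n\<rho> = 2 * \<kappa>\<rho> / 3 \<and> real ninf = 2 * \<kappa>inf \<and>
           ni > 0 \<and> n\<rho> > 0 \<and> ninf > 0 \<and> odd (ni + n\<rho> + ninf) \<and>
           ni + n\<rho> > ninf \<and> ni + ninf > n\<rho> \<and> n\<rho> + ninf > ni"
  have Ii: "Im \<i> > 0" by simp
  have exps: "(local_exponents_at ?Q \<i> (1/2 + of_real \<kappa>i) (1/2 - of_real \<kappa>i) \<and>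
       local_exponents_at ?Q rho (1/2 + of_real \<kappa>\<rho>) (1/2 - of_real \<kappa>\<rho>) \<and>
       local_exponents_infinity ?Q (of_real \<kappa>inf) (- of_real \<kappa>inf)) \<longleftrightarrow>
      (s = (1 - 4 * of_real \<kappa>\<rho> ^ 2) / 9 \<and> t = (1 - 4 * of_real \<kappa>i ^ 2) / 4 \<and>
       r + s + t = - ((2 * of_real \<kappa>inf) ^ 2))"
    unfolding local_exponents_E6_zero[OF Ii E6_ii] local_exponents_E4_zero[OF Im_rho E4_rho]
      local_exponents_infinity_ode_coeff[where Q = ?Q, OF refl] by blast
  have main: "(apparent_throughout ?Q \<longleftrightarrow> ?C) \<and> (apparent_throughout ?Q \<longrightarrow> solution_ratios_modular ?Q)"
    if st: "s = (1 - 4 * of_real \<kappa>\<rho> ^ 2) / 9" "t = (1 - 4 * of_real \<kappa>i ^ 2) / 4"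
      "r + s + t = - ((2 * of_real \<kappa>inf) ^ 2)"
  proof -
    have backward: "apparent_throughout ?Q \<and> solution_ratios_modular ?Q" if C: "?C"
    proof -
      obtain ni n\<rho> ninf :: nat where n: "real ni = \<kappa>i" "real n\<rho> = 2 * \<kappa>\<rho> / 3" "real ninf = 2 * \<kappa>inf"
        "0 < ninf" "odd (ni + n\<rho> + ninf)" "ni + n\<rho> > ninf" "ni + ninf > n\<rho>" "n\<rho> + ninf > ni"
        using C by blast
      have "2 * \<kappa>\<rho> = 3 * real n\<rho>" using n(2) by simp
      then have "4 * \<kappa>\<rho> ^ 2 = 9 * real n\<rho> ^ 2" by algebra
      then have "complex_of_real (4 * \<kappa>\<rho> ^ 2) = of_real (9 * real n\<rho> ^ 2)" by (rule arg_cong)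
      then have "s = (1 - 9 * of_real (real n\<rho>) ^ 2) / 9" using st(1) by simp
      moreover have "t = (1 - 4 * of_real (real ni) ^ 2) / 4" using st(2) n(1) by simp
      moreover have "(2 * of_real \<kappa>inf :: complex) = of_real (real ninf)" unfolding n(3) by simp
      then have "r + s + t = - (of_real (real ninf) ^ 2)" using st(3) by (simp only:)
      ultimately interpret apparent_case ni n\<rho> ninf r s t
        using n by unfold_locales
      show ?thesis using apparent ratios_modular by blast
    qed
    have forward: "?C" if "apparent_throughout ?Q"
      by (rule apparent_imp_conditions[OF assms st that])
    show ?thesis using backward forward by blast
  qed
  show ?thesis unfolding exps using main by blast
qed

end
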